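(* A word $w$ in $X$ is a shifted tableau word if and only if it can be written as $w=u_lu_{l-1}\cdots u_1$ where (1) each $u_i$ is a hook word, and (2) for $1\le i\le l-1$, $u_i$ is a hook subword of maximum length in $u_lu_{l-1}\cdots u_i$ (i.e. no subsequence of $u_l\cdots u_i$ that is a hook word is longer than $u_i$). Furthermore, writing $\lambda_i=|u_i|$, for $1\le i\le l$ the shape of $P_{\mathrm{mix}}(u_l\cdots u_{i+1}u_i)$ is $(\lambda_i,\lambda_{i+1},\dots,\lambda_l)$. In particular $\mathrm{shape}(P_{\mathrm{mix}}(w))=\lambda=(\lambda_1,\dots,\lambda_l)$.
   Context: $X=\{1<2<\cdots\}$, $X'=\{1'<1<2'<2<\cdots\}$; words are finite sequences in $X$. A hook word is a word $w_1\cdots w_r$ such that for some $1\le k\le r$, $w_1>w_2>\cdots>w_k\le w_{k+1}\le\cdots\le w_r$. A hook subword of a word is a (not necessarily contiguous) subsequence which is a hook word. A strict partition $\lambda$ has shifted diagram with $\lambda_i$ cells in row $i$, row $i$ shifted $i-1$ units right. A shifted Young tableau is a filling with letters of $X'$, rows and columns weakly increasing, each unprimed $k$ at most once per column, each primed $k'$ at most once per row, no primed entries on the main diagonal. A standard shifted (skew) tableau contains $1,\dots,N$ once each, rows and columns increasing. Mixed insertion of $w=w_1\cdots w_n$: starting from the empty pair, insert letters successively. A letter is inserted into the first row, bumping the smallest entry $a$ strictly greater than it (order of $X'$), or placed at the end of the row if none. Whenever $a$ is bumped: if off the main diagonal and unprimed, insert it into the next row likewise; if off the diagonal and primed, insert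 it into the next column to the right, bumping the smallest strictly greater entry there (or placing it at the end); if on the main diagonal, prime it and insert $a'$ into the next column to the right. Stop when a letter is placed at the end of a row or column. $P_{\mathrm{mix}}(w)$ is the resulting tableau and $Q_{\mathrm{mix}}(w)$ records by $i$ the box added at step $i$; $w\mapsto(P_{\mathrm{mix}},Q_{\mathrm{mix}})$ is a bijection onto pairs (shifted Young tableau, standard shifted tableau of the same shape). A vee is a standard skew shifted tableau with entries $i,\dots,k$ whose shape is a (possibly disconnected) border strip such that for some $i\le j\le k$: entries $i,\dots,j$ form a vertical strip increasing downward; entries $j,\dots,k$ form a horizontal strip increasing left to right; each box of the vertical strip is left of the boxes of the horizontal strip in the same row; connected if its shape is. The special recording tableau of shape $\lambda=(\lambda_1,\dots,\lambda_l)$ is the unique standard shifted tableau of shape $\lambda$ in which for each $i$ the entries $\lambda_l+\cdots+\lambda_{i+1}+1,\dots,\lambda_l+\cdots+\lambda_{i}$ form a connected vee. $\mathrm{mread}(T)$ is the word $w$ with $P_{\mathrm{mix}}(w)=T$ and $Q_{\mathrm{mix}}(w)$ the special recording tableau of shape $\mathrm{shape}(T)$; a shifted tableau word is a word $\mathrm{mread}(T)$ for some shifted Young tableau $T$. *)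

theory Defs
  imports Main "HOL-Library.Sublist" "HOL-Library.While_Combinator"
begin

text \<open>Words are lists of natural numbers; the alphabet X = {1,2,...} corresponds to
  naturals >= 1.  The primed alphabet X' = {1' < 1 < 2' < 2 < ...}: PL k is k', UL k is k.\<close>

datatype xl = PL nat | UL nat

fun xidx :: "xl \<Rightarrow> nat" where
  "xidx (PL k) = k" | "xidx (UL k) = k"

fun primed :: "xl \<Rightarrow> bool" where
  "primed (PL k) = True" | "primed (UL k) = False"

fun xkey :: "xl \<Rightarrow> nat" where
  "xkey (PL k) = 2 * k" | "xkey (UL k) = 2 * k + 1"

definition xless :: "xl \<Rightarrow> xl \<Rightarrow> bool" where
  "xless a b \<longleftrightarrow> xkey a < xkey b"

fun prime_it :: "xl \<Rightarrow> xl" where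
  "prime_it (UL k) = PL k" | "prime_it (PL k) = PL k"

definition hook_word :: "nat list \<Rightarrow> bool" where
  "hook_word w \<longleftrightarrow> (\<exists>k. 1 \<le> k \<and> k \<le> length w \<and>
      sorted_wrt (>) (take k w) \<and> sorted (drop (k - 1) w))"

definition hook_subword :: "nat list \<Rightarrow> nat list \<Rightarrow> bool" where
  "hook_subword u v \<longleftrightarrow> subseq u v \<and> hook_word u"

definition max_hook_subword :: "nat list \<Rightarrow> nat list \<Rightarrow> bool" where
  "max_hook_subword u v \<longleftrightarrow> hook_subword u v \<and>
      (\<forall>u'. hook_subword u' v \<longrightarrow> length u' \<le> length u)"

text \<open>A (shifted) tableau is a list of rows; row r (0-indexed) occupies the columns
  r, r+1, ..., r + length(row r) - 1 of the shifted diagram.  Cells are pairs (row, column);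
  the main diagonal consists of the cells (r, r).\<close>

definition cells :: "'a list list \<Rightarrow> (nat \<times> nat) set" where
  "cells T = {(r, c). r < length T \<and> r \<le> c \<and> c < r + length (T ! r)}"

definition ent :: "'a list list \<Rightarrow> nat \<times> nat \<Rightarrow> 'a" where
  "ent T x = T ! fst x ! (snd x - fst x)"

definition shape :: "'a list list \<Rightarrow> nat list" where
  "shape T = map length T"

definition strict_partition :: "nat list \<Rightarrow> bool" where
  "strict_partition lam \<longleftrightarrow> sorted_wrt (>) lam \<and> 0 \<notin> set lam"

definition shifted_young_tableau :: "xl list list \<Rightarrow> bool" where
  "shifted_young_tableau T \<longleftrightarrow>
     strict_partition (shape T) \<and>
     (\<forall>x\<in>cells T. xidx (ent T x) \<ge> 1) \<and>
     (\<forall>r c c'. (r, c) \<in> cells T \<longrightarrow> (r, c') \<in> cells T \<longrightarrow> c < c' \<longrightarrow>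
         xkey (ent T (r, c)) \<le> xkey (ent T (r, c'))) \<and>
     (\<forall>r r' c. (r, c) \<in> cells T \<longrightarrow> (r', c) \<in> cells T \<longrightarrow> r < r' \<longrightarrow>
         xkey (ent T (r, c)) \<le> xkey (ent T (r', c))) \<and>
     (\<forall>r r' c. (r, c) \<in> cells T \<longrightarrow> (r', c) \<in> cells T \<longrightarrow> r < r' \<longrightarrow>
         ent T (r, c) = ent T (r', c) \<longrightarrow> primed (ent T (r, c))) \<and>
     (\<forall>r c c'. (r, c) \<in> cells T \<longrightarrow> (r, c') \<in> cells T \<longrightarrow> c < c' \<longrightarrow>
         ent T (r, c) = ent T (r, c') \<longrightarrow> \<not> primed (ent T (r, c))) \<and>
     (\<forall>r. (r, r) \<in> cells T \<longrightarrow> \<not> primed (ent T (r, r)))"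

definition standard_shifted :: "nat list list \<Rightarrow> bool" where
  "standard_shifted Q \<longleftrightarrow>
     strict_partition (shape Q) \<and>
     distinct (concat Q) \<and> set (concat Q) = {1..length (concat Q)} \<and>
     (\<forall>r c c'. (r, c) \<in> cells Q \<longrightarrow> (r, c') \<in> cells Q \<longrightarrow> c < c' \<longrightarrow>
         ent Q (r, c) < ent Q (r, c')) \<and>
     (\<forall>r r' c. (r, c) \<in> cells Q \<longrightarrow> (r', c) \<in> cells Q \<longrightarrow> r < r' \<longrightarrow>
         ent Q (r, c) < ent Q (r', c))"

datatype target = RowIns nat | ColIns nat | Placed nat
  \<comment> \<open>insert into row r / column c; or: finished, a box was added at the end of row r\<close>

fun is_placed :: "target \<Rightarrow> bool" where
  "is_placed (Placed r) = True" | "is_placed _ = False"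

definition add_at_row :: "'a list list \<Rightarrow> nat \<Rightarrow> 'a \<Rightarrow> 'a list list" where
  "add_at_row T r a = (if r < length T then T[r := T ! r @ [a]] else T @ [[a]])"

definition set_ent :: "'a list list \<Rightarrow> nat \<times> nat \<Rightarrow> 'a \<Rightarrow> 'a list list" where
  "set_ent T x a = T[fst x := (T ! fst x)[snd x - fst x := a]]"

definition col_rows :: "'a list list \<Rightarrow> nat \<Rightarrow> nat list" where
  "col_rows T c = filter (\<lambda>r. r \<le> c \<and> c < r + length (T ! r)) [0..<length T]"

definition route :: "nat \<times> nat \<Rightarrow> xl \<Rightarrow> target \<times> xl" where
  "route x a = (if fst x = snd x then (ColIns (snd x + 1), prime_it a)
                else if primed a then (ColIns (snd x + 1), a)
                else (RowIns (fst x + 1), a))"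

fun ins_step :: "xl list list \<times> target \<times> xl \<Rightarrow> xl list list \<times> target \<times> xl" where
  "ins_step (T, RowIns r, a) =
     (if r < length T then
        (let ps = filter (\<lambda>p. xless a (T ! r ! p)) [0..<length (T ! r)] in
         if ps = [] then (add_at_row T r a, Placed r, a)
         else (let p = hd ps; b = T ! r ! p; (t', b') = route (r, r + p) b
               in (set_ent T (r, r + p) a, t', b')))
      else (add_at_row T r a, Placed r, a))"
| "ins_step (T, ColIns c, a) =
     (let rs = col_rows T c; qs = filter (\<lambda>r. xless a (ent T (r, c))) rs in
      if qs = [] then (add_at_row T (length rs) a, Placed (length rs), a)
      else (let r = hd qs; b = ent T (r, c); (t', b') = route (r, c) b
            in (set_ent T (r, c) a, t', b')))"
| "ins_step (T, Placed r, a) = (T, Placed r, a)"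

definition mix_insert :: "xl list list \<Rightarrow> xl \<Rightarrow> xl list list \<times> nat" where
  "mix_insert T a =
     (case the (while_option (\<lambda>(_, t, _). \<not> is_placed t) ins_step (T, RowIns 0, a)) of
        (T', Placed r, _) \<Rightarrow> (T', r) | (T', _, _) \<Rightarrow> (T', 0))"

definition mix_step :: "xl list list \<times> nat list list \<Rightarrow> nat \<Rightarrow> xl list list \<times> nat list list" where
  "mix_step PQ a = (let (P, Q) = PQ; (P', r) = mix_insert P (UL a)
                    in (P', add_at_row Q r (length (concat Q) + 1)))"

definition mix :: "nat list \<Rightarrow> xl list list \<times> nat list list" where
  "mix w = foldl mix_step ([], []) w"

definition P_mix :: "nat list \<Rightarrow> xl list list" where
  "P_mix w = fst (mix w)"

definition Q_mix :: "nat list \<Rightarrow> nat list list" where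
  "Q_mix w = snd (mix w)"

definition adj_in :: "(nat \<times> nat) set \<Rightarrow> nat \<times> nat \<Rightarrow> nat \<times> nat \<Rightarrow> bool" where
  "adj_in S x y \<longleftrightarrow> x \<in> S \<and> y \<in> S \<and>
     ((fst x = fst y \<and> (snd y = snd x + 1 \<or> snd x = snd y + 1)) \<or>
      (snd x = snd y \<and> (fst y = fst x + 1 \<or> fst x = fst y + 1)))"

definition connected_cells :: "(nat \<times> nat) set \<Rightarrow> bool" where
  "connected_cells S \<longleftrightarrow> S \<noteq> {} \<and> (\<forall>x\<in>S. \<forall>y\<in>S. (adj_in S)\<^sup>*\<^sup>* x y)"

text \<open>(Possibly disconnected) border strip: contains no 2x2 square.\<close>
definition no_square :: "(nat \<times> nat) set \<Rightarrow> bool" where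
  "no_square S \<longleftrightarrow> (\<forall>r c. \<not> ((r, c) \<in> S \<and> (r, c + 1) \<in> S \<and> (r + 1, c) \<in> S \<and> (r + 1, c + 1) \<in> S))"

definition is_vee :: "nat list list \<Rightarrow> nat \<Rightarrow> nat \<Rightarrow> bool" where
  "is_vee Q i k \<longleftrightarrow>
     (let S = {x \<in> cells Q. i \<le> ent Q x \<and> ent Q x \<le> k} in
      i \<le> k \<and> no_square S \<and>
      (\<exists>j. i \<le> j \<and> j \<le> k \<and>
        (let V = {x \<in> S. ent Q x \<le> j}; H = {x \<in> S. j \<le> ent Q x} in
          (\<forall>x\<in>V. \<forall>y\<in>V. fst x = fst y \<longrightarrow> x = y) \<and>
          (\<forall>x\<in>V. \<forall>y\<in>V. fst x < fst y \<longrightarrow> ent Q x < ent Q y) \<and>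
          (\<forall>x\<in>H. \<forall>y\<in>H. snd x = snd y \<longrightarrow> x = y) \<and>
          (\<forall>x\<in>H. \<forall>y\<in>H. snd x < snd y \<longrightarrow> ent Q x < ent Q y) \<and>
          (\<forall>x\<in>V. \<forall>y\<in>H. fst x = fst y \<longrightarrow> snd x \<le> snd y))))"

definition is_connected_vee :: "nat list list \<Rightarrow> nat \<Rightarrow> nat \<Rightarrow> bool" where
  "is_connected_vee Q i k \<longleftrightarrow> is_vee Q i k \<and>
     connected_cells {x \<in> cells Q. i \<le> ent Q x \<and> ent Q x \<le> k}"

text \<open>lam = [lambda_1, ..., lambda_l]; block i (0-indexed) uses the entries
  lambda_l + ... + lambda_(i+2) + 1, ..., lambda_l + ... + lambda_(i+1).\<close>
definition special_recording :: "nat list \<Rightarrow> nat list list" where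
  "special_recording lam = (THE Q. standard_shifted Q \<and> shape Q = lam \<and>
     (\<forall>i < length lam. is_connected_vee Q (sum_list (drop (Suc i) lam) + 1) (sum_list (drop i lam))))"

definition shifted_tableau_word :: "nat list \<Rightarrow> bool" where
  "shifted_tableau_word w \<longleftrightarrow>
     (\<exists>T. shifted_young_tableau T \<and> P_mix w = T \<and> Q_mix w = special_recording (shape T))"

end

theory Submission
  imports Defs
begin

text \<open>The last occurrence of the largest letter of \<open>w\<close> enters the recording tableau by a Sagan-Worley
  insertion of its position, so \<open>Q\<^sub>m\<^sub>i\<^sub>x(w)\<close> is the Sagan-Worley insertion tableau of the word of positions
  of the letters of \<open>w\<close> in increasing order. Hook subwords of \<open>w\<close> correspond to pairs of a
  decreasing and an increasing subsequence of that word. The possible lengths of such pairs are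
  invariant under Knuth relations, which account for the bumping within rows and within columns,
  and under a cyclic move of an extreme letter, which accounts for the change of direction at the
  diagonal. Hence they can be computed from the reading word of \<open>Q\<^sub>m\<^sub>i\<^sub>x(w)\<close>, and the maximum is the
  length of its first row.

  The boxes added by inserting a word \<open>u\<close> form a vee, in this order, iff \<open>u\<close> is a hook word. The
  contents (column minus row) of the boxes of a vee are distinct and bounded by the length of the
  first row. If \<open>u\<close> is as long as the first row, every content occurs, so that every diagonal grows
  by one box: the old shape is moved one step along the diagonal and receives a new first row of
  length \<open>|u|\<close>, and the vee is connected. Conversely, a connected vee that meets the main
  diagonal has such contents, and in a tableau all of whose blocks are vees, as many as there are
  rows, every block meets the main diagonal.\<close>

section \<open>Shifted shapes\<close>

text \<open>The obstacle is the diagonal: there a bumped letter is primed and changes direction, so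
  a whole insertion is not a sequence of local word relations. Two devices deal with this. An
  insertion is treated as one pass through the letters in increasing order that follows the single
  box by which the shapes before and after it differ; two insertions are then compared by comparing
  two such boxes, one letter at a time. Hook statistics are compared by two equivalences of
  different strength: \<open>keq\<close>, stable under words on both sides, holds for Knuth
  relations, while the cyclic moves only give \<open>heq\<close>, which is shown to be stable on the
  right. This suffices because a cyclic move is always applied to a prefix of a reading word. The
  interval in the statistic makes a recursion possible: the last letter of a word, if used, is the
  largest or the smallest of the selection, and cuts the interval at its own value. That each block
  of a special tableau meets the diagonal is a count: there are as many diagonal boxes as rows, and
  a vee has at most one because its contents are distinct.\<close>

definition ideal :: "(nat \<times> nat) set \<Rightarrow> bool" where
  "ideal S \<longleftrightarrow> finite S \<and> (\<forall>r c. (r, c) \<in> S \<longrightarrow> r \<le> c) \<and>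
     (\<forall>r c r' c'. (r, c) \<in> S \<longrightarrow> r' \<le> r \<longrightarrow> c' \<le> c \<longrightarrow> r' \<le> c' \<longrightarrow> (r', c') \<in> S)"

definition addable :: "(nat \<times> nat) set \<Rightarrow> nat \<times> nat \<Rightarrow> bool" where
  "addable S b \<longleftrightarrow> ideal S \<and> b \<notin> S \<and> ideal (insert b S)"

text \<open>The bound keeps the search off the boxes left of the diagonal, which lie in no shape.
  For a column filled down to the diagonal, \<open>col_end\<close> returns
  \<open>(Suc c, c)\<close>, which is outside the shifted plane.\<close>

definition row_end :: "(nat \<times> nat) set \<Rightarrow> nat \<Rightarrow> nat \<times> nat" where
  "row_end S r = (r, LEAST c. r \<le> c \<and> (r, c) \<notin> S)"

definition col_end :: "(nat \<times> nat) set \<Rightarrow> nat \<Rightarrow> nat \<times> nat" where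
  "col_end S c = (LEAST r. (r, c) \<notin> S, c)"

lemma fst_row_end [simp]: "fst (row_end S r) = r"
  by (simp add: row_end_def)

lemma snd_col_end [simp]: "snd (col_end S c) = c"
  by (simp add: col_end_def)

lemma ideal_down: "ideal S \<Longrightarrow> (r, c) \<in> S \<Longrightarrow> r' \<le> r \<Longrightarrow> c' \<le> c \<Longrightarrow> r' \<le> c' \<Longrightarrow> (r', c') \<in> S"
  unfolding ideal_def by blast

lemma ideal_le: "ideal S \<Longrightarrow> (r, c) \<in> S \<Longrightarrow> r \<le> c"
  unfolding ideal_def by blast

lemma ideal_finite: "ideal S \<Longrightarrow> finite S"
  unfolding ideal_def by blast

lemma ideal_empty [simp]: "ideal {}"
  by (simp add: ideal_def)

lemma ideal_Un: "ideal S \<Longrightarrow> ideal T \<Longrightarrow> ideal (S \<union> T)"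
  unfolding ideal_def by blast

lemma row_end_Least:
  assumes "ideal S"
  shows "r \<le> snd (row_end S r) \<and> (r, snd (row_end S r)) \<notin> S"
proof -
  define k where "k = Suc (Max (insert r (snd ` S)))"
  have fin: "finite (insert r (snd ` S))" using ideal_finite[OF assms] by simp
  have "r < k" unfolding k_def using fin by (simp add: le_imp_less_Suc)
  moreover have "(r, k) \<notin> S"
  proof
    assume "(r, k) \<in> S"
    hence "k \<in> insert r (snd ` S)" by force
    hence "k \<le> Max (insert r (snd ` S))" using fin by (rule Max_ge[rotated])
    thus False by (simp add: k_def)
  qed
  ultimately have "\<exists>c. r \<le> c \<and> (r, c) \<notin> S" by (meson less_imp_le)
  from LeastI_ex[OF this] show ?thesis by (simp add: row_end_def)
qed

lemma mem_row_iff: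
  assumes "ideal S"
  shows "(r, c) \<in> S \<longleftrightarrow> r \<le> c \<and> c < snd (row_end S r)"
proof
  assume a: "(r, c) \<in> S"
  hence rc: "r \<le> c" using ideal_le[OF assms] by blast
  have "\<not> snd (row_end S r) \<le> c"
    using ideal_down[OF assms a order_refl] row_end_Least[OF assms, of r] by blast
  thus "r \<le> c \<and> c < snd (row_end S r)" using rc by simp
next
  assume a: "r \<le> c \<and> c < snd (row_end S r)"
  show "(r, c) \<in> S"
    using not_less_Least[of c "\<lambda>c. r \<le> c \<and> (r, c) \<notin> S"] a by (auto simp: row_end_def)
qed

lemma mem_col_iff:
  assumes "ideal S"
  shows "(r, c) \<in> S \<longleftrightarrow> r < fst (col_end S c)"
proof -
  have "(Suc c, c) \<notin> S" using ideal_le[OF assms, of "Suc c" c] by auto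
  hence n: "(fst (col_end S c), c) \<notin> S"
    unfolding col_end_def using LeastI[of "\<lambda>r. (r, c) \<notin> S" "Suc c"] by simp
  show ?thesis
  proof
    assume a: "(r, c) \<in> S"
    show "r < fst (col_end S c)"
    proof (rule ccontr)
      assume "\<not> r < fst (col_end S c)"
      hence "fst (col_end S c) \<le> r" by simp
      hence "(fst (col_end S c), c) \<in> S"
        using ideal_down[OF assms a, of "fst (col_end S c)" c] ideal_le[OF assms a] by simp
      thus False using n by simp
    qed
  next
    assume "r < fst (col_end S c)"
    thus "(r, c) \<in> S" using not_less_Least[of r "\<lambda>r. (r, c) \<notin> S"] by (auto simp: col_end_def)
  qed
qed

lemma row_end_gt:
  assumes "ideal S" "b \<in> S" "r \<le> fst b"
  shows "snd b < snd (row_end S r)"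
proof -
  obtain r' c where b: "b = (r', c)" by (cases b)
  have "r' \<le> c" using ideal_le assms b by blast
  hence "(r, c) \<in> S" using ideal_down[OF assms(1), of r' c r c] assms b by simp
  thus ?thesis using mem_row_iff[OF assms(1)] b by simp
qed

lemma col_end_gt:
  assumes "ideal S" "b \<in> S" "c \<le> snd b" "fst b \<le> c"
  shows "fst b < fst (col_end S c)"
proof -
  obtain r c' where b: "b = (r, c')" by (cases b)
  have "(r, c) \<in> S" using ideal_down[OF assms(1), of r c' r c] assms b by simp
  thus ?thesis using mem_col_iff[OF assms(1)] b by simp
qed

text \<open>Every other box weakly above and left of \<open>(r, c)\<close> is weakly above and left
  of its upper or its left neighbour, so these two neighbours suffice.\<close>

lemma addableI:
  assumes S: "ideal S" and n: "(r, c) \<notin> S" and rc: "r \<le> c"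
    and up: "0 < r \<Longrightarrow> (r - 1, c) \<in> S" and left: "r < c \<Longrightarrow> (r, c - 1) \<in> S"
  shows "addable S (r, c)"
proof -
  have key: "(r', c') \<in> insert (r, c) S" if "r' \<le> r" "c' \<le> c" "r' \<le> c'" for r' c'
  proof (cases "r' < r")
    case True
    hence "(r - 1, c) \<in> S" using up by simp
    thus ?thesis using ideal_down[OF S, of "r - 1" c r' c'] True that by simp
  next
    case False
    hence r: "r' = r" using that by simp
    show ?thesis
    proof (cases "c' = c")
      case False
      hence "(r, c - 1) \<in> S" using left that r by simp
      thus ?thesis using ideal_down[OF S, of r "c - 1" r' c'] False that r by simp
    qed (use r in simp)
  qed
  have "ideal (insert (r, c) S)"
    unfolding ideal_def
  proof (intro conjI allI impI)
    show "finite (insert (r, c) S)" using ideal_finite[OF S] by simp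
  next
    fix a b assume "(a, b) \<in> insert (r, c) S"
    thus "a \<le> b" using rc ideal_le[OF S] by auto
  next
    fix a b a' b' assume *: "(a, b) \<in> insert (r, c) S" "a' \<le> a" "b' \<le> b" "a' \<le> b'"
    show "(a', b') \<in> insert (r, c) S"
    proof (cases "(a, b) = (r, c)")
      case True thus ?thesis using key[of a' b'] * by simp
    next
      case False
      hence "(a, b) \<in> S" using *(1) False by (metis insertE)
      hence "(a', b') \<in> S" using ideal_down[OF S _ *(2,3,4)] by metis
      thus ?thesis by simp
    qed
  qed
  thus ?thesis using S n by (simp add: addable_def)
qed

lemma addable_ideal: "addable S b \<Longrightarrow> ideal S"
  and addable_ideal': "addable S b \<Longrightarrow> ideal (insert b S)"
  and addable_notin: "addable S b \<Longrightarrow> b \<notin> S"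
  by (auto simp: addable_def)

lemma addable_le: "addable S b \<Longrightarrow> fst b \<le> snd b"
  using ideal_le[of "insert b S" "fst b" "snd b"] by (auto simp: addable_def)

lemma addable_below:
  assumes "addable S (r, c)" "r' \<le> r" "c' \<le> c" "r' \<le> c'" "(r', c') \<noteq> (r, c)"
  shows "(r', c') \<in> S"
  using ideal_down[OF addable_ideal'[OF assms(1)], of r c r' c'] assms by auto

lemma addable_above:
  assumes "addable S (r, c)" "r \<le> r'" "c \<le> c'"
  shows "(r', c') \<notin> S"
  using ideal_down[OF addable_ideal[OF assms(1)], of r' c' r c] assms addable_le[OF assms(1)]
    addable_notin[OF assms(1)] by auto

lemma addable_col_end: "addable S b \<Longrightarrow> b = col_end S (snd b)"
proof -
  assume a: "addable S b"
  obtain r c where b: "b = (r, c)" by (cases b)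
  note a = a[unfolded b]
  have n: "\<not> r < fst (col_end S c)" using mem_col_iff[OF addable_ideal[OF a]] addable_notin[OF a] by blast
  have "\<not> fst (col_end S c) < r"
  proof
    assume l: "fst (col_end S c) < r"
    have "(fst (col_end S c), c) \<in> S"
      using addable_below[OF a, of "fst (col_end S c)" c] l addable_le[OF a] by simp
    thus False using mem_col_iff[OF addable_ideal[OF a]] by blast
  qed
  thus ?thesis using b n by (metis fst_conv linorder_neqE_nat prod.collapse snd_col_end snd_conv)
qed

text \<open>If one of the two boxes were weakly above and left of the other, it would already belong
  to the shape. So the addable boxes are linearly ordered from southwest to northeast, which keeps
  the case distinctions for bumping paths short.\<close>

lemma addable_cmp:
  assumes "addable S a" "addable S b" "a \<noteq> b"
  shows "(fst a < fst b \<and> snd b < snd a) \<or> (fst b < fst a \<and> snd a < snd b)"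
proof -
  obtain r c where a: "a = (r, c)" by (cases a)
  obtain r' c' where b: "b = (r', c')" by (cases b)
  have 1: "\<not> (r \<le> r' \<and> c \<le> c')"
    using addable_below[of S r' c' r c] addable_le[OF assms(1)] addable_notin[OF assms(1)] assms a b by auto
  have 2: "\<not> (r' \<le> r \<and> c' \<le> c)"
    using addable_below[of S r c r' c'] addable_le[OF assms(2)] addable_notin[OF assms(2)] assms a b by auto
  show ?thesis using 1 2 a b by auto
qed

lemma addable_insert:
  assumes "addable S a" "addable S b" "a \<noteq> b"
  shows "addable (insert a S) b"
proof -
  have "insert b (insert a S) = insert a S \<union> insert b S" by auto
  thus ?thesis using assms ideal_Un[of "insert a S" "insert b S"] by (auto simp: addable_def)
qed

text \<open>The box to which the letter in box \<open>a\<close> is bumped, when \<open>S\<close> is the shape of all smaller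
  letters, including the one that has just taken over \<open>a\<close>.\<close>

definition nxt :: "(nat \<times> nat) set \<Rightarrow> nat \<times> nat \<Rightarrow> bool \<Rightarrow> nat \<times> nat" where
  "nxt S a m = (if m \<or> fst a = snd a then col_end S (Suc (snd a)) else row_end S (Suc (fst a)))"

text \<open>The box to the right of \<open>a\<close> is still free, so the end of the next column is
  no lower than \<open>a\<close>; its left neighbour, if there is one, is then weakly above
  \<open>a\<close> in the column of \<open>a\<close>, hence in the shape.\<close>

lemma nxt_col:
  assumes a: "addable S a" and m: "m \<or> fst a = snd a"
  shows "snd (nxt (insert a S) a m) = Suc (snd a)" "fst (nxt (insert a S) a m) \<le> fst a"
    "addable (insert a S) (nxt (insert a S) a m)"
proof -
  obtain r c where rc: "a = (r, c)" by (cases a)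
  define S' where "S' = insert a S"
  have S': "ideal S'" using addable_ideal'[OF a] by (simp add: S'_def)
  define k where "k = fst (col_end S' (Suc c))"
  have nx: "nxt S' a m = (k, Suc c)"
    using m rc by (auto simp: nxt_def k_def col_end_def)
  have "(r, Suc c) \<notin> S'" using addable_above[of S r c r "Suc c"] a rc by (simp add: S'_def)
  hence kr: "k \<le> r" using mem_col_iff[OF S', of r "Suc c"] by (simp add: k_def)
  show "snd (nxt (insert a S) a m) = Suc (snd a)" "fst (nxt (insert a S) a m) \<le> fst a"
    using nx kr rc by (simp_all add: S'_def)
  have rle: "r \<le> c" using addable_le[OF a] rc by simp
  have "addable S' (k, Suc c)"
  proof (rule addableI[OF S'])
    show "(k, Suc c) \<notin> S'" using mem_col_iff[OF S', of k "Suc c"] by (simp add: k_def)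
    show "k \<le> Suc c" using kr rle by simp
    show "(k - 1, Suc c) \<in> S'" if "0 < k" using mem_col_iff[OF S', of "k - 1" "Suc c"] that by (simp add: k_def)
    show "(k, Suc c - 1) \<in> S'" if "k < Suc c"
      using ideal_down[OF S', of r c k c] kr that rc by (simp add: S'_def)
  qed
  thus "addable (insert a S) (nxt (insert a S) a m)" using nx by (simp add: S'_def)
qed

text \<open>The transposed argument; as \<open>a\<close> is off the diagonal, the position below
  \<open>a\<close> exists in the shifted plane and is free.\<close>

lemma nxt_row:
  assumes a: "addable S a" and m: "\<not> (m \<or> fst a = snd a)"
  shows "fst (nxt (insert a S) a m) = Suc (fst a)" "snd (nxt (insert a S) a m) \<le> snd a"
    "addable (insert a S) (nxt (insert a S) a m)"
proof -
  obtain r c where rc: "a = (r, c)" by (cases a)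
  define S' where "S' = insert a S"
  have S': "ideal S'" using addable_ideal'[OF a] by (simp add: S'_def)
  define k where "k = snd (row_end S' (Suc r))"
  have nx: "nxt S' a m = (Suc r, k)"
    using m rc by (auto simp: nxt_def k_def row_end_def)
  have rle: "r < c" using addable_le[OF a] rc m by simp
  have rk: "Suc r \<le> k" "(Suc r, k) \<notin> S'" using row_end_Least[OF S', of "Suc r"] by (simp_all add: k_def)
  have "(Suc r, c) \<notin> S'" using addable_above[of S r c "Suc r" c] a rc by (simp add: S'_def)
  hence kc: "k \<le> c" using mem_row_iff[OF S', of "Suc r" c] rle by (simp add: k_def)
  show "fst (nxt (insert a S) a m) = Suc (fst a)" "snd (nxt (insert a S) a m) \<le> snd a"
    using nx kc rc by (simp_all add: S'_def)
  have "addable S' (Suc r, k)"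
  proof (rule addableI[OF S'])
    show "(Suc r, k) \<notin> S'" "Suc r \<le> k" using rk by auto
    show "(Suc r - 1, k) \<in> S'"
      using ideal_down[OF S', of r c r k] kc rk rc by (simp add: S'_def)
    show "(Suc r, k - 1) \<in> S'" if "Suc r < k"
      using mem_row_iff[OF S', of "Suc r" "k - 1"] that by (simp add: k_def)
  qed
  thus "addable (insert a S) (nxt (insert a S) a m)" using nx by (simp add: S'_def)
qed

lemma addable_nxt: "addable S a \<Longrightarrow> addable (insert a S) (nxt (insert a S) a m)"
  using nxt_col(3) nxt_row(3) by blast

lemma addable_row_end_0: "ideal S \<Longrightarrow> addable S (row_end S 0)"
proof -
  assume S: "ideal S"
  define k where "k = snd (row_end S 0)"
  have e: "row_end S 0 = (0, k)" by (simp add: k_def row_end_def)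
  have "addable S (0, k)"
  proof (rule addableI[OF S])
    show "(0, k) \<notin> S" using row_end_Least[OF S, of 0] by (simp add: k_def)
    show "(0, k - 1) \<in> S" if "0 < k" using mem_row_iff[OF S, of 0 "k - 1"] that by (simp add: k_def)
  qed auto
  thus ?thesis using e by simp
qed

section \<open>Relative position of boxes, and chains of shapes\<close>

text \<open>Rows are numbered downwards, so these are the steps of a horizontal strip filled from
  left to right (weakly upwards) and of a vertical strip filled downwards (weakly
  leftwards).\<close>

definition rightof :: "nat \<times> nat \<Rightarrow> nat \<times> nat \<Rightarrow> bool" where
  "rightof x y \<longleftrightarrow> snd x < snd y \<and> fst y \<le> fst x"

definition below :: "nat \<times> nat \<Rightarrow> nat \<times> nat \<Rightarrow> bool" where
  "below x y \<longleftrightarrow> fst x < fst y \<and> snd y \<le> snd x"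

text \<open>A saturated chain of shapes, given by its start and the boxes added one by one; it plays
  the part of a standard skew tableau.\<close>

fun chain :: "(nat \<times> nat) set \<Rightarrow> (nat \<times> nat) list \<Rightarrow> bool" where
  "chain S [] \<longleftrightarrow> ideal S"
| "chain S (b # bs) \<longleftrightarrow> addable S b \<and> chain (insert b S) bs"

lemma chain_append: "chain S (bs @ cs) \<longleftrightarrow> chain S bs \<and> chain (S \<union> set bs) cs"
proof (induction bs arbitrary: S)
  case Nil
  then show ?case by (cases cs) (auto simp: addable_ideal)
qed auto

lemma chain_ideal: "chain S bs \<Longrightarrow> ideal S"
  by (cases bs) (auto simp: addable_ideal)

lemma chain_ideal': "chain S bs \<Longrightarrow> ideal (S \<union> set bs)"
  using chain_append[of S bs "[]"] by simp

lemma chain_distinct: "chain S bs \<Longrightarrow> distinct bs \<and> set bs \<inter> S = {}"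
proof (induction bs arbitrary: S)
  case (Cons b bs)
  from Cons.prems have "distinct bs \<and> set bs \<inter> insert b S = {}" using Cons.IH[of "insert b S"] by simp
  then show ?case using Cons.prems addable_notin by auto
qed simp

text \<open>Two distinct addable boxes can be added in either order, so \<open>a\<close> can be
  moved in front of the whole chain.\<close>

lemma chain_insert:
  assumes "chain S bs" "addable S a" "a \<notin> set bs"
  shows "chain (insert a S) bs"
  using assms
proof (induction bs arbitrary: S)
  case Nil
  then show ?case by (simp add: addable_ideal')
next
  case (Cons b bs)
  have "addable (insert b S) a" using Cons.prems by (auto intro: addable_insert)
  hence "chain (insert a (insert b S)) bs" using Cons by auto
  moreover have "addable (insert a S) b" using Cons.prems by (auto intro: addable_insert)
  ultimately show ?case by (simp add: insert_commute)
qed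

lemma addable_chain:
  assumes "chain S bs" "addable S a" "a \<notin> set bs"
  shows "addable (S \<union> set bs) a"
  using assms
proof (induction bs arbitrary: S)
  case (Cons b bs)
  have "addable (insert b S) a" using Cons.prems by (auto intro: addable_insert)
  hence "addable (insert b S \<union> set bs) a" using Cons.IH[of "insert b S"] Cons.prems by simp
  thus ?case by simp
qed simp

section \<open>Mixed insertion as a list of boxes in the order of their letters\<close>

definition bumped :: "nat \<times> nat \<Rightarrow> xl \<Rightarrow> xl" where
  "bumped b x = (if fst b = snd b then prime_it x else x)"

text \<open>\<open>S\<close> is the shape of the letters passed so far, before the insertion;
  \<open>a\<close> is the one box by which their shape after the insertion exceeds it. A letter
  found in \<open>a\<close> has been displaced and takes the box given by \<open>nxt\<close>, which
  becomes the new moving box; every other letter stays.\<close>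

fun run :: "(nat \<times> nat) set \<Rightarrow> nat \<times> nat \<Rightarrow> ((nat \<times> nat) \<times> xl) list \<Rightarrow> ((nat \<times> nat) \<times> xl) list" where
  "run S a [] = []"
| "run S a ((b, x) # L) =
    (if b = a then (nxt (insert a S) a (primed x), bumped a x) # run (insert a S) (nxt (insert a S) a (primed x)) L
     else (b, x) # run (insert b S) a L)"

fun newbox :: "(nat \<times> nat) set \<Rightarrow> nat \<times> nat \<Rightarrow> ((nat \<times> nat) \<times> xl) list \<Rightarrow> nat \<times> nat" where
  "newbox S a [] = a"
| "newbox S a ((b, x) # L) =
    (if b = a then newbox (insert a S) (nxt (insert a S) a (primed x)) L
     else newbox (insert b S) a L)"

text \<open>Records whether the moving box is ever on the main diagonal. The final position counts
  as well, although no letter is displaced there.\<close>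

fun touch :: "(nat \<times> nat) set \<Rightarrow> nat \<times> nat \<Rightarrow> ((nat \<times> nat) \<times> xl) list \<Rightarrow> bool" where
  "touch S a [] \<longleftrightarrow> fst a = snd a"
| "touch S a ((b, x) # L) \<longleftrightarrow> fst a = snd a \<or>
    (if b = a then touch (insert a S) (nxt (insert a S) a (primed x)) L
     else touch (insert b S) a L)"

lemma touch_diag: "fst a = snd a \<Longrightarrow> touch S a L"
  by (cases L) auto

text \<open>This is a local growth rule: at each letter the shapes before and after the insertion
  differ by the moving box alone, so the output is again a chain and the last moving box is the one
  added.\<close>

lemma chain_run:
  assumes "chain S (map fst L)" "addable S a"
  shows "chain (insert a S) (map fst (run S a L))"
    and "addable (S \<union> set (map fst L)) (newbox S a L)"
    and "insert a S \<union> set (map fst (run S a L)) = insert (newbox S a L) (S \<union> set (map fst L))"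
proof -
  have "chain (insert a S) (map fst (run S a L)) \<and> addable (S \<union> set (map fst L)) (newbox S a L) \<and>
    insert a S \<union> set (map fst (run S a L)) = insert (newbox S a L) (S \<union> set (map fst L))"
    using assms
  proof (induction L arbitrary: S a)
    case Nil
    then show ?case by (simp add: addable_ideal')
  next
    case (Cons e L)
    obtain b x where e: "e = (b, x)" by (cases e)
    show ?case
    proof (cases "b = a")
      case True
      define g where "g = nxt (insert a S) a (primed x)"
      have g: "addable (insert a S) g" unfolding g_def using Cons.prems(2) by (rule addable_nxt)
      have "chain (insert a S) (map fst L)" using Cons.prems e True by simp
      from Cons.IH[OF this g] show ?thesis using e True g by (simp flip: g_def)
    next
      case False
      have c: "chain (insert b S) (map fst L)" and b: "addable S b" using Cons.prems e by auto
      have a: "addable (insert b S) a" using b Cons.prems(2) False by (rule addable_insert)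
      have b': "addable (insert a S) b" using Cons.prems(2) b False by (auto intro: addable_insert)
      from Cons.IH[OF c a] show ?thesis using e False b' by (auto simp: insert_commute)
    qed
  qed
  thus "chain (insert a S) (map fst (run S a L))"
    and "addable (S \<union> set (map fst L)) (newbox S a L)"
    and "insert a S \<union> set (map fst (run S a L)) = insert (newbox S a L) (S \<union> set (map fst L))"
    by auto
qed

lemma run_append:
  "run S a (L @ M) = run S a L @ run (S \<union> set (map fst L)) (newbox S a L) M"
  by (induction S a L rule: run.induct) auto

lemma newbox_append:
  "newbox S a (L @ M) = newbox (S \<union> set (map fst L)) (newbox S a L) M"
  by (induction S a L rule: newbox.induct) auto

lemma touch_append:
  "touch S a (L @ M) \<longleftrightarrow> touch S a L \<or> touch (S \<union> set (map fst L)) (newbox S a L) M"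
  by (induction S a L rule: newbox.induct) (auto simp: touch_diag)

lemma run_notin: "a \<notin> fst ` set L \<Longrightarrow> run S a L = L"
  and newbox_notin: "a \<notin> fst ` set L \<Longrightarrow> newbox S a L = a"
  by (induction S a L rule: run.induct) auto

section \<open>Comparison of two successive bumping paths\<close>

lemma primed_bumped_diag: "primed (bumped a x) \<longleftrightarrow> primed x \<or> fst a = snd a"
  by (cases x) (auto simp: bumped_def)

text \<open>The second pass reads the output of the first, so both moving boxes are followed letter
  by letter. The delicate case is a letter sent by the first pass into the box of the second: as
  that box is further to the right, the move was a column move, the letter arrives primed, and the
  second pass sends it one more column to the right. A box \<open>rightof\<close> another one is
  never on the diagonal.\<close>

lemma rightof_run:
  assumes "addable S a" "addable (insert a S) a'" "chain S (map fst L)" "rightof a a'"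
  shows "rightof (newbox S a L) (newbox (insert a S) a' (run S a L)) \<and> \<not> touch (insert a S) a' (run S a L)"
  using assms
proof (induction L arbitrary: S a a')
  case Nil
  have "fst a \<le> snd a" using Nil addable_le by blast
  thus ?case using Nil by (auto simp: rightof_def)
next
  case (Cons e L)
  obtain b x where e: "e = (b, x)" by (cases e)
  have nd: "fst a' \<noteq> snd a'" using addable_le[OF Cons.prems(1)] Cons.prems(4) by (auto simp: rightof_def)
  have b: "addable S b" and ch: "chain (insert b S) (map fst L)" using Cons.prems e by auto
  show ?case
  proof (cases "b = a")
    case True
    define g where "g = nxt (insert a S) a (primed x)"
    have g: "addable (insert a S) g" unfolding g_def using Cons.prems(1) by (rule addable_nxt)
    have ch': "chain (insert a S) (map fst L)" using ch True by simp
    show ?thesis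
    proof (cases "g = a'")
      case True2: True
      have m: "primed x \<or> fst a = snd a"
        using nxt_row(1)[OF Cons.prems(1), of "primed x"] True2 Cons.prems(4) unfolding rightof_def g_def
        by (metis Suc_n_not_le_n)
      define h where "h = nxt (insert g (insert a S)) g True"
      have h: "addable (insert g (insert a S)) h" unfolding h_def using g by (rule addable_nxt)
      have "rightof g h" using nxt_col[OF g, of True] by (auto simp: rightof_def h_def)
      from Cons.IH[OF g h ch' this] show ?thesis
        using e True True2 nd m by (auto simp: primed_bumped_diag h_def simp flip: g_def)
    next
      case False
      have a': "addable (insert g (insert a S)) a'" using g Cons.prems(2) False by (rule addable_insert)
      have "rightof g a'"
      proof (cases "primed x \<or> fst a = snd a")
        case True
        thus ?thesis using nxt_col(1,2)[OF Cons.prems(1) True, folded g_def] Cons.prems(4) addable_cmp[OF g Cons.prems(2) False]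
          by (auto simp: rightof_def)
      next
        case False
        thus ?thesis using nxt_row(1,2)[OF Cons.prems(1) False, folded g_def] Cons.prems(4)
          by (auto simp: rightof_def)
      qed
      from Cons.IH[OF g a' ch' this] show ?thesis using e True False nd by (auto simp flip: g_def)
    qed
  next
    case False
    have a: "addable (insert b S) a" using b Cons.prems(1) False by (rule addable_insert)
    have b': "addable (insert a S) b" using Cons.prems(1) b False by (auto intro: addable_insert)
    show ?thesis
    proof (cases "b = a'")
      case True
      define g where "g = nxt (insert b (insert a S)) b (primed x)"
      have g: "addable (insert b (insert a S)) g" unfolding g_def using b' by (rule addable_nxt)
      hence g2: "addable (insert a (insert b S)) g" by (simp add: insert_commute)
      have lt: "snd a < snd b" "fst b < fst a"
        using addable_cmp[OF Cons.prems(1) b] False Cons.prems(4) True by (auto simp: rightof_def)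
      have "rightof a g"
      proof (cases "primed x \<or> fst b = snd b")
        case True
        thus ?thesis using nxt_col(1,2)[OF b' True, folded g_def] lt by (auto simp: rightof_def)
      next
        case F: False
        have "g = row_end (insert b (insert a S)) (Suc (fst b))" using F by (simp add: g_def nxt_def)
        \<comment> \<open>The row entered is weakly above \<open>a\<close>, so it extends beyond the
          column of \<open>a\<close>.\<close>
        moreover have "snd a < snd (row_end (insert b (insert a S)) (Suc (fst b)))"
          using row_end_gt[OF addable_ideal[OF g], of a "Suc (fst b)"] lt by simp
        ultimately show ?thesis using lt by (simp add: rightof_def)
      qed
      from Cons.IH[OF a g2 ch this] show ?thesis
        using e False nd True g_def by (auto simp: insert_commute)
    next
      case F2: False
      have "addable (insert b (insert a S)) a'" using b' Cons.prems(2) F2 by (rule addable_insert)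
      hence "addable (insert a (insert b S)) a'" by (simp add: insert_commute)
      from Cons.IH[OF a this ch Cons.prems(4)] show ?thesis
        using e False nd F2 by (auto simp: insert_commute)
    qed
  qed
qed

text \<open>The relative position can change only at the diagonal: if the first pass sends a letter
  down into a diagonal box held by the second, the second sends it to the next column at once, and
  from there on \<open>rightof_run\<close> applies. Before that, the first moving box is off the
  diagonal, because some box lies strictly below and weakly left of it.\<close>

lemma below_run:
  assumes "addable S a" "addable (insert a S) a'" "chain S (map fst L)" "below a a'"
  shows "below (newbox S a L) (newbox (insert a S) a' (run S a L)) \<and> \<not> touch S a L \<or>
    rightof (newbox S a L) (newbox (insert a S) a' (run S a L)) \<and> touch S a L \<and> touch (insert a S) a' (run S a L)"
  using assms
proof (induction L arbitrary: S a a')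
  case Nil
  have "fst a' \<le> snd a'" using Nil addable_le by blast
  thus ?case using Nil by (auto simp: below_def)
next
  case (Cons e L)
  obtain b x where e: "e = (b, x)" by (cases e)
  have nd: "fst a \<noteq> snd a" using addable_le[OF Cons.prems(2)] Cons.prems(4) by (auto simp: below_def)
  have b: "addable S b" and ch: "chain (insert b S) (map fst L)" using Cons.prems e by auto
  show ?case
  proof (cases "b = a")
    case True
    define g where "g = nxt (insert a S) a (primed x)"
    have g: "addable (insert a S) g" unfolding g_def using Cons.prems(1) by (rule addable_nxt)
    have ch': "chain (insert a S) (map fst L)" using ch True by simp
    show ?thesis
    proof (cases "g = a'")
      case True2: True
      have m: "\<not> (primed x \<or> fst a = snd a)"
        using nxt_col(1)[OF Cons.prems(1), of "primed x"] True2 Cons.prems(4) unfolding below_def g_def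
        by (metis Suc_n_not_le_n)
      define h where "h = nxt (insert g (insert a S)) g (primed x)"
      have h: "addable (insert g (insert a S)) h" unfolding h_def using g by (rule addable_nxt)
      have pb: "primed (bumped a x) = primed x" using m by (simp add: primed_bumped_diag)
      have r1: "newbox S a (e # L) = newbox (insert a S) g L"
        and r2: "run S a (e # L) = (g, bumped a x) # run (insert a S) g L"
        and r3: "touch S a (e # L) \<longleftrightarrow> touch (insert a S) g L"
        using e True nd by (simp_all add: g_def)
      have r4: "newbox (insert a S) a' ((g, bumped a x) # M) = newbox (insert g (insert a S)) h M"
        and r5: "touch (insert a S) a' ((g, bumped a x) # M) \<longleftrightarrow>
          fst g = snd g \<or> touch (insert g (insert a S)) h M" for M
        using True2 pb by (auto simp: h_def)
      show ?thesis
      proof (cases "fst g = snd g")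
        case True3: True
        \<comment> \<open>The first path has just reached the diagonal box that the second one
          leaves for the next column: below turns into right.\<close>
        have "rightof g h" using nxt_col[OF g, of "primed x"] True3 by (auto simp: rightof_def h_def)
        from rightof_run[OF g h ch' this] show ?thesis
          unfolding r1 r2 r3 r4 r5 using touch_diag[OF True3] True3 True2 by simp
      next
        case False
        have "below g h" using nxt_row[OF g, of "primed x"] m False by (auto simp: below_def h_def)
        from Cons.IH[OF g h ch' this] show ?thesis unfolding r1 r2 r3 r4 r5 by blast
      qed
    next
      case False
      have a': "addable (insert g (insert a S)) a'" using g Cons.prems(2) False by (rule addable_insert)
      have "below g a'"
      proof (cases "primed x \<or> fst a = snd a")
        case True
        thus ?thesis using nxt_col(1,2)[OF Cons.prems(1) True, folded g_def] Cons.prems(4)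
          by (auto simp: below_def)
      next
        case F: False
        thus ?thesis using nxt_row(1,2)[OF Cons.prems(1) F, folded g_def] Cons.prems(4) addable_cmp[OF g Cons.prems(2) False]
          by (auto simp: below_def)
      qed
      from Cons.IH[OF g a' ch' this] show ?thesis using e True False nd by (auto simp flip: g_def)
    qed
  next
    case False
    have a: "addable (insert b S) a" using b Cons.prems(1) False by (rule addable_insert)
    have b': "addable (insert a S) b" using Cons.prems(1) b False by (auto intro: addable_insert)
    show ?thesis
    proof (cases "b = a'")
      case True
      define g where "g = nxt (insert b (insert a S)) b (primed x)"
      have g: "addable (insert b (insert a S)) g" unfolding g_def using b' by (rule addable_nxt)
      hence g2: "addable (insert a (insert b S)) g" by (simp add: insert_commute)
      have lt: "snd b < snd a" "fst a < fst b"
        using addable_cmp[OF Cons.prems(1) b] False Cons.prems(4) True by (auto simp: below_def)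
      have "below a g"
      proof (cases "primed x \<or> fst b = snd b")
        case T: True
        have "g = col_end (insert b (insert a S)) (Suc (snd b))" using T by (auto simp add: g_def nxt_def)
        moreover have "fst a < fst (col_end (insert b (insert a S)) (Suc (snd b)))"
          using col_end_gt[OF addable_ideal[OF g], of a "Suc (snd b)"] lt addable_le[OF b] by simp
        ultimately show ?thesis using lt by (simp add: below_def)
      next
        case F: False
        thus ?thesis using nxt_row(1,2)[OF b' F, folded g_def] lt by (auto simp: below_def)
      qed
      from Cons.IH[OF a g2 ch this] show ?thesis
        using e False nd True g_def by (auto simp: insert_commute)
    next
      case F2: False
      have "addable (insert b (insert a S)) a'" using b' Cons.prems(2) F2 by (rule addable_insert)
      hence "addable (insert a (insert b S)) a'" by (simp add: insert_commute)
      from Cons.IH[OF a this ch Cons.prems(4)] show ?thesis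
        using e False nd F2 by (auto simp: insert_commute)
    qed
  qed
qed

text \<open>The model of mixed insertion: the tableau is the list of its boxes and letters, in the order
  of the letters, where equal unprimed letters are read from left to right and equal primed letters
  from top to bottom. Each letter moves at most once during an insertion.\<close>

definition small :: "nat \<Rightarrow> (nat \<times> nat) \<times> xl \<Rightarrow> bool" where
  "small a e \<longleftrightarrow> xkey (snd e) \<le> 2 * a + 1"

text \<open>Letters weakly smaller than \<open>a\<close> keep their boxes, so row insertion of
  \<open>a\<close> into the first row takes place directly behind them.\<close>

definition startbox :: "((nat \<times> nat) \<times> xl) list \<Rightarrow> nat \<Rightarrow> nat \<times> nat" where
  "startbox L a = row_end (set (map fst (takeWhile (small a) L))) 0"

definition ins :: "((nat \<times> nat) \<times> xl) list \<Rightarrow> nat \<Rightarrow> ((nat \<times> nat) \<times> xl) list" where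
  "ins L a = takeWhile (small a) L @ (startbox L a, UL a) #
     run (set (map fst (takeWhile (small a) L))) (startbox L a) (dropWhile (small a) L)"

definition insbox :: "((nat \<times> nat) \<times> xl) list \<Rightarrow> nat \<Rightarrow> nat \<times> nat" where
  "insbox L a = newbox (set (map fst (takeWhile (small a) L))) (startbox L a) (dropWhile (small a) L)"

definition instouch :: "((nat \<times> nat) \<times> xl) list \<Rightarrow> nat \<Rightarrow> bool" where
  "instouch L a = touch (set (map fst (takeWhile (small a) L))) (startbox L a) (dropWhile (small a) L)"

lemma chain_split:
  assumes "chain {} (map fst (L1 @ L2))"
  shows "chain {} (map fst L1)" "chain (set (map fst L1)) (map fst L2)" "ideal (set (map fst L1))"
  using assms chain_append[of "{}" "map fst L1" "map fst L2"] chain_ideal by auto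

lemma chain_ins:
  assumes "chain {} (map fst L)"
  shows "chain {} (map fst (ins L a))" "addable (set (map fst L)) (insbox L a)"
    "set (map fst (ins L a)) = insert (insbox L a) (set (map fst L))"
proof -
  define L1 where "L1 = takeWhile (small a) L"
  define L2 where "L2 = dropWhile (small a) L"
  have L: "L = L1 @ L2" by (simp add: L1_def L2_def)
  define S where "S = set (map fst L1)"
  note c = chain_split[OF assms[unfolded L]]
  have s: "startbox L a = row_end S 0" by (simp add: startbox_def S_def L1_def)
  have ad: "addable S (row_end S 0)" using c(3) by (simp add: addable_row_end_0 S_def)
  note r = chain_run[OF c(2)[folded S_def] ad]
  have i: "ins L a = L1 @ (row_end S 0, UL a) # run S (row_end S 0) L2"
    by (simp add: ins_def s L1_def L2_def S_def)
  have ib: "insbox L a = newbox S (row_end S 0) L2"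
    by (simp add: insbox_def s L1_def L2_def S_def)
  show "chain {} (map fst (ins L a))"
    using c(1) ad r(1) by (simp add: i chain_append S_def)
  show "addable (set (map fst L)) (insbox L a)"
    unfolding ib using r(2) by (simp add: L S_def)
  show "set (map fst (ins L a)) = insert (insbox L a) (set (map fst L))"
    unfolding i ib using r(3) by (auto simp: L S_def)
qed

abbreviation xsorted :: "((nat \<times> nat) \<times> xl) list \<Rightarrow> bool" where
  "xsorted \<equiv> sorted_wrt (\<lambda>e f. xkey (snd e) \<le> xkey (snd f))"

lemma small_split:
  assumes "L = L1 @ L2" "\<forall>e\<in>set L1. small a e" "\<forall>e\<in>set L2. \<not> small a e"
  shows "takeWhile (small a) L = L1" "dropWhile (small a) L = L2"
  using assms by (cases L2; simp add: takeWhile_append dropWhile_append)+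

lemma dropWhile_not_small:
  "xsorted L \<Longrightarrow> e \<in> set (dropWhile (small a) L) \<Longrightarrow> \<not> small a e"
proof (induction L)
  case (Cons f L)
  thus ?case by (cases "small a f") (auto simp: small_def)
qed simp

text \<open>The pass for \<open>b\<close> starts behind all letters up to \<open>b\<close>, when the
  moving box of the first pass is at \<open>a1\<close>. It starts at the end of the first row of a
  shape that contains \<open>a1\<close>, hence to the right of it, and \<open>rightof_run\<close>
  does the rest.\<close>

lemma ins_ascent:
  assumes c: "chain {} (map fst L)" and s: "xsorted L" "xsorted (ins L a)" and ab: "a \<le> b"
  shows "rightof (insbox L a) (insbox (ins L a) b) \<and> \<not> instouch (ins L a) b"
proof -
  define L1 where "L1 = takeWhile (small a) L"
  define L2 where "L2 = dropWhile (small a) L"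
  define S where "S = set (map fst L1)"
  define al where "al = row_end S 0"
  have L: "L = L1 @ L2" by (simp add: L1_def L2_def)
  note c' = chain_split[OF c[unfolded L]]
  have st: "startbox L a = al" by (simp add: startbox_def S_def L1_def al_def)
  have ad: "addable S al" using c'(3) by (simp add: addable_row_end_0 S_def al_def)
  have i: "ins L a = L1 @ (al, UL a) # run S al L2"
    by (simp add: ins_def st L1_def L2_def S_def)
  define R1 where "R1 = takeWhile (small b) (run S al L2)"
  define R2 where "R2 = dropWhile (small b) (run S al L2)"
  have sr: "xsorted (run S al L2)" using s(2) by (simp add: i sorted_wrt_append)
  have R: "run S al L2 = R1 @ R2" "\<forall>e\<in>set R1. small b e" "\<forall>e\<in>set R2. \<not> small b e"
    using dropWhile_not_small[OF sr, of _ b] by (auto simp: R1_def R2_def dest: set_takeWhileD)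
  define M1 where "M1 = take (length R1) L2"
  define M2 where "M2 = drop (length R1) L2"
  have M: "L2 = M1 @ M2" by (simp add: M1_def M2_def)
  \<comment> \<open>The prefix \<open>R1\<close> of the output is traced back to a prefix of the
    input by its length, as displaced letters may have changed their value.\<close>
  have len: "length (run S al M) = length M" for S al M
    by (induction S al M rule: run.induct) auto
  have lM: "length R1 \<le> length L2" using R(1) len[of S al L2] by simp
  have rM: "run S al L2 = run S al M1 @ run (S \<union> set (map fst M1)) (newbox S al M1) M2"
    by (simp add: M run_append)
  have "length R1 = length (run S al M1)" using len[of S al M1] lM by (simp add: M1_def)
  moreover have "R1 @ R2 = run S al M1 @ run (S \<union> set (map fst M1)) (newbox S al M1) M2"
    using R(1) rM by simp
  ultimately have R1: "R1 = run S al M1" and R2: "R2 = run (S \<union> set (map fst M1)) (newbox S al M1) M2"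
    by (metis append_eq_append_conv)+
  have cM: "chain S (map fst M1)" "chain (S \<union> set (map fst M1)) (map fst M2)"
    using c'(2) by (simp_all add: M S_def chain_append)
  define T where "T = S \<union> set (map fst M1)"
  define a1 where "a1 = newbox S al M1"
  note cr = chain_run[OF cM(1) ad]
  have a1: "addable T a1" using cr(2) by (simp add: T_def a1_def)
  have "ins L a = (L1 @ (al, UL a) # R1) @ R2" using i R(1) by simp
  moreover have "\<forall>e\<in>set (L1 @ (al, UL a) # R1). small b e"
    using R(2) ab by (auto simp: small_def L1_def dest!: set_takeWhileD)
  ultimately have tw: "takeWhile (small b) (ins L a) = L1 @ (al, UL a) # R1"
    and dw: "dropWhile (small b) (ins L a) = R2" using small_split R(3) by blast+
  have se: "set (map fst (L1 @ (al, UL a) # R1)) = insert a1 T"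
    using cr(3) by (auto simp: R1 S_def a1_def T_def)
  define be where "be = row_end (insert a1 T) 0"
  have sb: "startbox (ins L a) b = be" by (simp only: startbox_def tw se be_def)
  have id: "ideal (insert a1 T)" using a1 by (rule addable_ideal')
  have be: "addable (insert a1 T) be" unfolding be_def using id by (rule addable_row_end_0)
  have "rightof a1 be" using row_end_gt[OF id, of a1 0] by (simp add: rightof_def be_def)
  from rightof_run[OF a1 be cM(2)[folded T_def] this]
  have "rightof (newbox T a1 M2) (newbox (insert a1 T) be R2) \<and> \<not> touch (insert a1 T) be R2"
    by (simp add: R2 T_def a1_def)
  moreover have "insbox L a = newbox T a1 M2"
    unfolding insbox_def st L1_def[symmetric] L2_def[symmetric] S_def[symmetric]
    by (simp add: M newbox_append T_def a1_def)
  moreover have "insbox (ins L a) b = newbox (insert a1 T) be R2"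
    by (simp only: insbox_def sb tw dw se)
  moreover have "instouch (ins L a) b = touch (insert a1 T) be R2"
    by (simp only: instouch_def sb tw dw se)
  ultimately show ?thesis by simp
qed

text \<open>Now \<open>b\<close> starts first. When its pass reaches the letter \<open>a\<close>
  just inserted, its moving box is either another corner, which lies below the end of the first row,
  or the box of \<open>a\<close> itself. In the latter case \<open>a\<close> is bumped: to the right
  if its box is on the diagonal, downwards otherwise.\<close>

lemma ins_descent:
  assumes c: "chain {} (map fst L)" and s: "xsorted L" and ab: "b < a"
  shows "if instouch L a then rightof (insbox L a) (insbox (ins L a) b) \<and> instouch (ins L a) b
    else below (insbox L a) (insbox (ins L a) b)"
proof -
  define L1 where "L1 = takeWhile (small a) L"
  define L2 where "L2 = dropWhile (small a) L"
  define S where "S = set (map fst L1)"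
  define al where "al = row_end S 0"
  have L: "L = L1 @ L2" by (simp add: L1_def L2_def)
  note c' = chain_split[OF c[unfolded L]]
  have st: "startbox L a = al" by (simp add: startbox_def S_def L1_def al_def)
  have ad: "addable S al" using c'(3) by (simp add: addable_row_end_0 S_def al_def)
  have i: "ins L a = L1 @ (al, UL a) # run S al L2"
    by (simp add: ins_def st L1_def L2_def S_def)
  define N1 where "N1 = takeWhile (small b) L1"
  define N2 where "N2 = dropWhile (small b) L1"
  have N: "L1 = N1 @ N2" by (simp add: N1_def N2_def)
  have nsa: "\<not> small b (al, UL a)" using ab by (simp add: small_def)
  have tw: "takeWhile (small b) (ins L a) = N1"
    using nsa by (simp add: i N1_def takeWhile_append) (metis takeWhile_eq_all_conv)
  have dw: "dropWhile (small b) (ins L a) = N2 @ (al, UL a) # run S al L2"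
  proof -
    have "N1 @ dropWhile (small b) (ins L a) = ins L a" using takeWhile_dropWhile_id tw by metis
    thus ?thesis using i N by simp
  qed
  define T where "T = set (map fst N1)"
  define be where "be = row_end T 0"
  have cN: "chain {} (map fst N1)" "chain T (map fst N2)" "ideal T"
    using chain_split[of N1 N2] c'(1) N by (simp_all add: T_def)
  have be: "addable T be" unfolding be_def using cN(3) by (rule addable_row_end_0)
  define b1 where "b1 = newbox T be N2"
  have TS: "T \<union> set (map fst N2) = S" by (simp add: T_def S_def N)
  have b1: "addable S b1" using chain_run(2)[OF cN(2) be] TS by (simp add: b1_def)
  have sb: "startbox (ins L a) b = be" by (simp only: startbox_def tw T_def be_def)
  have ia: "insbox L a = newbox S al L2" "instouch L a = touch S al L2"
    unfolding insbox_def instouch_def st L1_def[symmetric] L2_def[symmetric] S_def[symmetric] by (rule refl)+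
  have ib: "insbox (ins L a) b = newbox S b1 ((al, UL a) # run S al L2)"
    unfolding insbox_def sb tw dw T_def[symmetric] newbox_append TS b1_def[symmetric] by (rule refl)
  have it: "instouch (ins L a) b \<longleftrightarrow> touch T be N2 \<or> touch S b1 ((al, UL a) # run S al L2)"
    unfolding instouch_def sb tw dw T_def[symmetric] touch_append TS b1_def[symmetric] by (rule refl)
  show ?thesis
  proof (cases "b1 = al")
    case False
    have b1': "addable (insert al S) b1" using ad b1 False by (auto intro: addable_insert)
    have "below al b1" using addable_cmp[OF ad b1] False by (auto simp: below_def al_def)
    from below_run[OF ad b1' c'(2)[folded S_def] this]
    show ?thesis using False by (auto simp: ia ib it)
  next
    case True
    define g where "g = nxt (insert al S) al False"
    have g: "addable (insert al S) g" unfolding g_def using ad by (rule addable_nxt)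
    show ?thesis
    proof (cases "fst al = snd al")
      case T2: True
      have "rightof al g" using nxt_col[OF ad, of False] T2 by (auto simp: rightof_def g_def)
      from rightof_run[OF ad g c'(2)[folded S_def] this]
      show ?thesis using True T2 touch_diag[OF T2] by (auto simp: ia ib it simp flip: g_def)
    next
      case F2: False
      have "below al g" using nxt_row[OF ad, of False] F2 by (auto simp: below_def g_def)
      from below_run[OF ad g c'(2)[folded S_def] this]
      show ?thesis using True by (auto simp: ia ib it simp flip: g_def)
    qed
  qed
qed

section \<open>An insertion keeps the order of the letters\<close>

definition good :: "(nat \<times> nat) \<times> xl \<Rightarrow> (nat \<times> nat) \<times> xl \<Rightarrow> bool" where
  "good e f \<longleftrightarrow> xkey (snd e) < xkey (snd f) \<or>
     snd e = snd f \<and> (if primed (snd e) then below (fst e) (fst f) else rightof (fst e) (fst f))"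

definition undiag :: "(nat \<times> nat) \<times> xl \<Rightarrow> bool" where
  "undiag e \<longleftrightarrow> (primed (snd e) \<longrightarrow> fst (fst e) \<noteq> snd (fst e))"

lemma rightof_trans: "rightof x y \<Longrightarrow> rightof y z \<Longrightarrow> rightof x z"
  and below_trans: "below x y \<Longrightarrow> below y z \<Longrightarrow> below x z"
  by (auto simp: rightof_def below_def)

lemma transp_good: "transp good"
  by (rule transpI) (auto simp: good_def split: if_splits dest: rightof_trans below_trans)

lemma xkey_inj: "xkey x = xkey y \<Longrightarrow> x = y"
  by (cases x; cases y) (simp_all, presburger+)

lemma good_xkey: "good e f \<Longrightarrow> xkey (snd e) \<le> xkey (snd f)"
  by (auto simp: good_def)

lemma good_xsorted: "sorted_wrt good L \<Longrightarrow> xsorted L"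
  by (rule sorted_wrt_mono_rel[of _ good]) (auto dest: good_xkey)

text \<open>One iteration of \<open>run\<close>, split into its output and its new moving box, so
  that two consecutive iterations can be compared.\<close>

definition step_entry :: "(nat \<times> nat) set \<Rightarrow> nat \<times> nat \<Rightarrow> (nat \<times> nat) \<times> xl \<Rightarrow> (nat \<times> nat) \<times> xl" where
  "step_entry S a e = (if fst e = a then (nxt (insert a S) a (primed (snd e)), bumped a (snd e)) else e)"

definition step_box :: "(nat \<times> nat) set \<Rightarrow> nat \<times> nat \<Rightarrow> (nat \<times> nat) \<times> xl \<Rightarrow> nat \<times> nat" where
  "step_box S a e = (if fst e = a then nxt (insert a S) a (primed (snd e)) else a)"

lemma run_Cons: "run S a (e # L) = step_entry S a e # run (insert (fst e) S) (step_box S a e) L"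
  by (cases e) (auto simp: step_entry_def step_box_def)

lemma xkey_bumped: "xkey (bumped a x) \<le> xkey x" "xkey x \<le> Suc (xkey (bumped a x))"
  "xidx (bumped a x) = xidx x"
  by (cases x; simp add: bumped_def)+

lemma addable_step_box: "addable S a \<Longrightarrow> addable S (fst e) \<Longrightarrow> addable (insert (fst e) S) (step_box S a e)"
  by (auto simp: step_box_def addable_nxt intro: addable_insert)

lemma undiag_step: "addable S a \<Longrightarrow> undiag e \<Longrightarrow> undiag (step_entry S a e)"
  using nxt_col[of S a "primed (snd e)"] addable_le[of S a]
  by (auto simp: undiag_def step_entry_def primed_bumped_diag)

text \<open>As \<open>good\<close> is transitive, comparing neighbours is enough. A letter changes
  its value only on the diagonal, from \<open>k\<close> to \<open>k'\<close>. The critical case is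
  therefore a \<open>k'\<close> directly before a \<open>k\<close> that becomes primed: the new box
  must then lie below that of the old \<open>k'\<close>.\<close>

lemma good_step:
  assumes a: "addable S a" and b1: "addable S (fst e)" and b2: "addable (insert (fst e) S) (fst f)"
    and g: "good e f" and d: "undiag e" "undiag f"
  shows "good (step_entry S a e) (step_entry (insert (fst e) S) (step_box S a e) f)"
proof -
  define S' where "S' = insert (fst e) S"
  define a1 where "a1 = step_box S a e"
  have a1: "addable S' a1" using addable_step_box[OF a b1] by (simp add: S'_def a1_def)
  have eS: "fst e \<in> insert a1 S'" by (simp add: S'_def)
  have id1: "ideal (insert a1 S')" using a1 by (rule addable_ideal')
  define e' where "e' = step_entry S a e"
  define f' where "f' = step_entry S' a1 f"
  have a1e: "fst e \<noteq> a \<Longrightarrow> a1 = a \<and> e' = e"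
    by (auto simp: a1_def step_box_def e'_def step_entry_def)
  have a1e': "fst e = a \<Longrightarrow> fst e' = a1 \<and> snd e' = bumped a (snd e) \<and> a1 = nxt (insert a S) a (primed (snd e))"
    by (auto simp: a1_def step_box_def e'_def step_entry_def)
  have f1: "fst f \<noteq> a1 \<Longrightarrow> f' = f" by (auto simp: f'_def step_entry_def)
  have f2: "fst f = a1 \<Longrightarrow> fst f' = nxt (insert a1 S') a1 (primed (snd f)) \<and> snd f' = bumped a1 (snd f)"
    by (auto simp: f'_def step_entry_def)
  have ke: "xkey (snd e') \<le> xkey (snd e)"
    by (auto simp: e'_def step_entry_def xkey_bumped)
  have "good e' f'"
  proof (cases "xkey (snd e) < xkey (snd f)")
    case True
    show ?thesis
    proof (cases "xkey (snd e') < xkey (snd f')")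
      case True
      thus ?thesis by (simp add: good_def)
    next
      case False
      have fa: "fst f = a1" using f1 True False ke by force
      have k: "xkey (snd f') < xkey (snd f)" using False True ke by simp
      hence dg: "fst a1 = snd a1" using f2[OF fa] by (auto simp: bumped_def split: if_splits)
      then obtain k where uf: "snd f = UL k" using d(2) fa by (cases "snd f") (auto simp: undiag_def)
      have pf: "snd f' = PL k" using f2[OF fa] dg uf by (simp add: bumped_def)
      have "xkey (snd e) = 2 * k" using False ke True pf uf by simp
      hence pe: "snd e = PL k" using xkey_inj[of "snd e" "PL k"] by simp
      \<comment> \<open>Had the primed letter \<open>e\<close> been displaced, the moving box would
        have gone one column to the right without going down, and could not be on the
        diagonal.\<close>
      have ne: "fst e \<noteq> a"
      proof
        assume "fst e = a"
        hence "fst a1 \<le> fst a \<and> snd a1 = Suc (snd a)" using a1e' nxt_col[OF a, of True] pe by simp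
        thus False using dg addable_le[OF a] by simp
      qed
      have aa: "a1 = a" "e' = e" using a1e[OF ne] by auto
      have lt: "fst (fst e) < fst a \<and> snd a < snd (fst e)"
        using addable_cmp[OF a b1] ne addable_le[OF b1] dg aa by auto
      have nb: "fst f' = col_end (insert a1 S') (Suc (snd a1))"
        using f2[OF fa] dg by (simp add: nxt_def)
      \<comment> \<open>The box of \<open>e\<close> is strictly above and to the right of the
        diagonal box, so the next column has a box at the height of \<open>e\<close> and ends
        lower.\<close>
      have "fst (fst e) < fst (col_end (insert a1 S') (Suc (snd a1)))"
        using col_end_gt[OF id1 eS, of "Suc (snd a1)"] lt aa dg by simp
      hence "below (fst e) (fst f')" using nb lt aa by (simp add: below_def)
      thus ?thesis using aa pe pf by (simp add: good_def)
    qed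
  next
    case False
    hence eq: "snd e = snd f" using g by (auto simp: good_def)
    show ?thesis
    proof (cases "snd e")
      case (UL k)
      have R: "rightof (fst e) (fst f)" using g UL by (simp add: good_def eq[symmetric])
      have ndf: "fst (fst f) \<noteq> snd (fst f)" using R addable_le[OF b1] by (auto simp: rightof_def)
      have sf: "snd f' = UL k" using UL eq f1 f2 ndf by (cases "fst f = a1") (auto simp: bumped_def)
      show ?thesis
      proof (cases "snd e' = UL k")
        case False
        hence "snd e' = PL k" using a1e a1e' UL by (cases "fst e = a") (auto simp: bumped_def split: if_splits)
        thus ?thesis using sf by (simp add: good_def)
      next
        case True
        have "rightof (fst e') (fst f')"
        proof (cases "fst e = a")
          case ea: True
          have nd: "\<not> (primed (snd e) \<or> fst a = snd a)"
            using True a1e'[OF ea] UL by (auto simp: bumped_def)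
          have a1': "fst a1 = Suc (fst a)" "snd a1 \<le> snd a"
            using nxt_row[OF a nd] a1e'[OF ea] by simp_all
          hence "fst f \<noteq> a1" using R ea by (auto simp: rightof_def)
          thus ?thesis using f1 a1' a1e'[OF ea] R ea by (auto simp: rightof_def)
        next
          case ea: False
          have aa: "a1 = a" "e' = e" using a1e[OF ea] by auto
          show ?thesis
          proof (cases "fst f = a")
            case True
            have lt: "fst a < fst (fst e)" "snd (fst e) < snd a"
              using addable_cmp[OF a b1] ea R True by (auto simp: rightof_def)
            have nb: "fst f' = row_end (insert a1 S') (Suc (fst a))"
              using f2 True aa UL eq ndf by (auto simp: nxt_def)
            have "snd (fst e) < snd (row_end (insert a1 S') (Suc (fst a)))"
              using row_end_gt[OF id1 eS, of "Suc (fst a)"] lt by simp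
            thus ?thesis using nb lt aa by (simp add: rightof_def)
          qed (use f1 aa R in auto)
        qed
        thus ?thesis using True sf by (simp add: good_def)
      qed
    next
      case (PL k)
      have B: "below (fst e) (fst f)" using g PL by (simp add: good_def eq[symmetric])
      have nd: "fst (fst f) \<noteq> snd (fst f)" "fst (fst e) \<noteq> snd (fst e)"
        using d PL eq by (auto simp: undiag_def)
      have s: "snd e' = PL k" "snd f' = PL k"
        using PL eq f1 f2 a1e a1e' by (cases "fst f = a1"; cases "fst e = a"; auto simp: bumped_def)+
      have "below (fst e') (fst f')"
      proof (cases "fst e = a")
        case ea: True
        have a1': "snd a1 = Suc (snd a)" "fst a1 \<le> fst a"
          using nxt_col[OF a, of True] a1e'[OF ea] PL by simp_all
        hence "fst f \<noteq> a1" using B ea by (auto simp: below_def)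
        thus ?thesis using f1 a1' a1e'[OF ea] B ea by (auto simp: below_def)
      next
        case ea: False
        have aa: "a1 = a" "e' = e" using a1e[OF ea] by auto
        show ?thesis
        proof (cases "fst f = a")
          case True
          have lt: "fst (fst e) < fst a" "snd a < snd (fst e)"
            using addable_cmp[OF a b1] ea B True by (auto simp: below_def)
          have nb: "fst f' = col_end (insert a1 S') (Suc (snd a))"
            using f2 True aa PL eq by (auto simp: nxt_def)
          have "fst (fst e) < fst (col_end (insert a1 S') (Suc (snd a)))"
            using col_end_gt[OF id1 eS, of "Suc (snd a)"] lt addable_le[OF a] by simp
          thus ?thesis using nb lt aa by (simp add: below_def)
        qed (use f1 aa B in auto)
      qed
      thus ?thesis using s by (simp add: good_def)
    qed
  qed
  thus ?thesis by (simp add: e'_def f'_def S'_def a1_def)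
qed

lemma good_run:
  assumes "chain S (map fst L)" "addable S a" "sorted_wrt good L" "\<forall>e\<in>set L. undiag e"
  shows "sorted_wrt good (run S a L) \<and> (\<forall>e\<in>set (run S a L). undiag e)"
  using assms
proof (induction L arbitrary: S a)
  case (Cons e L)
  have b1: "addable S (fst e)" and ch: "chain (insert (fst e) S) (map fst L)" using Cons.prems by auto
  have a1: "addable (insert (fst e) S) (step_box S a e)" using Cons.prems(2) b1 by (rule addable_step_box)
  have IH: "sorted_wrt good (run (insert (fst e) S) (step_box S a e) L) \<and>
      (\<forall>e\<in>set (run (insert (fst e) S) (step_box S a e) L). undiag e)"
    using Cons.IH[OF ch a1] Cons.prems by simp
  show ?case
  proof (cases L)
    case Nil
    thus ?thesis using Cons.prems by (simp add: run_Cons undiag_step)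
  next
    case (Cons f L')
    have "good (step_entry S a e) (step_entry (insert (fst e) S) (step_box S a e) f)"
      using good_step[OF \<open>addable S a\<close> b1, of f] Cons.prems ch Cons by simp
    thus ?thesis using IH Cons.prems undiag_step
      unfolding Cons run_Cons sorted_wrt2[OF transp_good] by simp
  qed
qed simp

text \<open>Priming stays within a pair \<open>j'\<close>, \<open>j\<close>, and the bound in
  \<open>small\<close> separates whole pairs only.\<close>

lemma run_large:
  "\<forall>e\<in>set L. \<not> small k e \<Longrightarrow> \<forall>e\<in>set (run S a L). \<not> small k e"
proof (induction L arbitrary: S a)
  case (Cons e L)
  obtain b x where e: "e = (b, x)" by (cases e)
  have "\<not> small k (c, x) \<Longrightarrow> \<not> small k (c', bumped a x)" for c c'
    by (cases x) (auto simp: small_def bumped_def)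
  thus ?case using Cons e by (auto simp: small_def)
qed simp

definition state_ok :: "((nat \<times> nat) \<times> xl) list \<Rightarrow> bool" where
  "state_ok L \<longleftrightarrow> chain {} (map fst L) \<and> sorted_wrt good L \<and> (\<forall>e\<in>set L. undiag e)"

lemma state_ok_xsorted: "state_ok L \<Longrightarrow> xsorted L"
  by (simp add: state_ok_def good_xsorted)

lemma state_ok_ins:
  assumes "state_ok L"
  shows "state_ok (ins L a)"
proof -
  define L1 where "L1 = takeWhile (small a) L"
  define L2 where "L2 = dropWhile (small a) L"
  define S where "S = set (map fst L1)"
  define al where "al = row_end S 0"
  have L: "L = L1 @ L2" by (simp add: L1_def L2_def)
  have ch: "chain {} (map fst L)" and g: "sorted_wrt good L" and u: "\<forall>e\<in>set L. undiag e"
    using assms by (auto simp: state_ok_def)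
  note c' = chain_split[OF ch[unfolded L]]
  have st: "startbox L a = al" by (simp add: startbox_def S_def L1_def al_def)
  have ad: "addable S al" using c'(3) by (simp add: addable_row_end_0 S_def al_def)
  have i: "ins L a = L1 @ (al, UL a) # run S al L2"
    by (simp add: ins_def st L1_def L2_def S_def)
  have g': "sorted_wrt good L1" "sorted_wrt good L2" using g L by (simp_all add: sorted_wrt_append)
  note gr = good_run[OF c'(2)[folded S_def] ad g'(2)]
  have sm: "\<forall>e\<in>set L1. small a e" by (auto simp: L1_def dest: set_takeWhileD)
  have "\<forall>e\<in>set L2. \<not> small a e" using dropWhile_not_small[OF good_xsorted[OF g]] by (auto simp: L2_def)
  hence la: "\<forall>e\<in>set (run S al L2). \<not> small a e" by (rule run_large)
  have 1: "good e (al, UL a)" if "e \<in> set L1" for e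
  proof (cases "xkey (snd e) < xkey (UL a)")
    case False
    hence "snd e = UL a" using sm that xkey_inj[of "snd e" "UL a"] by (auto simp: small_def)
    moreover have "fst e \<in> S" using that by (simp add: S_def)
    hence "snd (fst e) < snd al" using row_end_gt[of S "fst e" 0] c'(3) by (simp add: S_def al_def)
    ultimately show ?thesis by (simp add: good_def rightof_def al_def)
  qed (simp add: good_def)
  have 2: "good e f" if "e \<in> set L1 \<or> e = (al, UL a)" "f \<in> set (run S al L2)" for e f
  proof -
    have "xkey (snd e) \<le> 2 * a + 1" "2 * a + 1 < xkey (snd f)"
      using that sm la by (auto simp: small_def not_le)
    thus ?thesis by (simp add: good_def)
  qed
  show ?thesis
    unfolding state_ok_def
  proof (intro conjI)
    show "chain {} (map fst (ins L a))" using ch by (rule chain_ins)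
    show "sorted_wrt good (ins L a)" unfolding i using g' gr 1 2 u L by (auto simp: sorted_wrt_append)
    show "\<forall>e\<in>set (ins L a). undiag e" unfolding i using gr u L by (auto simp: undiag_def)
  qed
qed

lemma ins_xidx:
  assumes "\<forall>e\<in>set L. 1 \<le> xidx (snd e)" "1 \<le> a"
  shows "\<forall>e\<in>set (ins L a). 1 \<le> xidx (snd e)"
proof -
  have "\<forall>e\<in>set M. 1 \<le> xidx (snd e) \<Longrightarrow> \<forall>e\<in>set (run S b M). 1 \<le> xidx (snd e)" for S b M
    by (induction S b M rule: run.induct) (auto simp: xkey_bumped)
  note r = this
  have "\<forall>e\<in>set (dropWhile (small a) L). 1 \<le> xidx (snd e)"
    using assms(1) by (auto dest: set_dropWhileD)
  from r[OF this] show ?thesis using assms unfolding ins_def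
    by (metis UnE in_set_conv_decomp set_ConsD set_append set_takeWhileD snd_conv xidx.simps(2))
qed

lemma state_ok_Nil: "state_ok []"
  by (simp add: state_ok_def)

lemma state_ok_foldl: "state_ok L \<Longrightarrow> state_ok (foldl ins L w)"
  by (induction w arbitrary: L) (auto simp: state_ok_ins)

section \<open>The list model computes mixed insertion\<close>

text \<open>Serves for both tableaux of the pair: with letters for the insertion tableau, with times
  for the recording tableau. Excluding empty rows makes the list of rows unique.\<close>

definition rep :: "'a list list \<Rightarrow> ((nat \<times> nat) \<times> 'a) set \<Rightarrow> bool" where
  "rep T E \<longleftrightarrow> [] \<notin> set T \<and> cells T = fst ` E \<and> (\<forall>e\<in>E. ent T (fst e) = snd e)"

lemma cells_iff: "(r, c) \<in> cells T \<longleftrightarrow> r < length T \<and> r \<le> c \<and> c < r + length (T ! r)"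
  by (simp add: cells_def)

lemma rep_length_iff: "rep T E \<Longrightarrow> r < length T \<longleftrightarrow> (r, r) \<in> cells T"
proof -
  assume a: "rep T E"
  have "T ! r \<noteq> []" if "r < length T" using a that nth_mem[of r T] by (metis rep_def)
  thus ?thesis by (auto simp: cells_iff)
qed

lemma rep_unique: "rep T E \<Longrightarrow> rep T' E \<Longrightarrow> T = T'"
proof -
  assume a: "rep T E" "rep T' E"
  hence c: "cells T = cells T'" by (simp add: rep_def)
  have "r < length T \<longleftrightarrow> r < length T'" for r using rep_length_iff a c by metis
  hence l: "length T = length T'" by (meson linorder_neqE_nat nat_neq_iff)
  show "T = T'"
  proof (rule nth_equalityI[OF l])
    fix r assume r: "r < length T"
    have "r + p \<in> {r..<r + length (T ! r)} \<longleftrightarrow> r + p \<in> {r..<r + length (T' ! r)}" for p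
      using cells_iff[of r "r + p" T] cells_iff[of r "r + p" T'] r l c by simp
    hence "p < length (T ! r) \<longleftrightarrow> p < length (T' ! r)" for p by simp
    hence lr: "length (T ! r) = length (T' ! r)" by (meson linorder_neqE_nat nat_neq_iff)
    show "T ! r = T' ! r"
    proof (rule nth_equalityI[OF lr])
      fix p assume "p < length (T ! r)"
      hence "(r, r + p) \<in> cells T" using r by (simp add: cells_iff)
      hence "(r, r + p) \<in> fst ` E" using a(1) by (simp add: rep_def)
      then obtain x where "((r, r + p), x) \<in> E" by auto
      hence "ent T (r, r + p) = x" "ent T' (r, r + p) = x" using a by (auto simp: rep_def)
      thus "T ! r ! p = T' ! r ! p" by (simp add: ent_def)
    qed
  qed
qed

lemma rep_row_end:
  assumes "rep T E" "ideal (fst ` E)" "addable (fst ` E) (r, c)"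
  shows "r \<le> length T" "r < length T \<Longrightarrow> c = r + length (T ! r)" "r = length T \<Longrightarrow> c = r"
proof -
  have cE: "cells T = fst ` E" using assms(1) by (simp add: rep_def)
  note rl = rep_length_iff[OF assms(1)]
  have rc: "r \<le> c" using addable_le[OF assms(3)] by simp
  have n: "(r, c) \<notin> cells T" using addable_notin[OF assms(3)] cE by simp
  show "r \<le> length T"
  proof (rule ccontr)
    assume *: "\<not> r \<le> length T"
    hence "(r - 1, c) \<in> cells T" using addable_below[OF assms(3), of "r - 1" c] rc cE by simp
    hence "r - 1 < length T" by (simp only: cells_iff)
    thus False using * by linarith
  qed
  show "c = r + length (T ! r)" if r: "r < length T"
  proof (rule ccontr)
    assume "c \<noteq> r + length (T ! r)"
    moreover have "\<not> c < r + length (T ! r)" using n r rc by (simp add: cells_iff)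
    ultimately have l: "r + length (T ! r) < c" by simp
    hence "(r, r + length (T ! r)) \<in> cells T" using addable_below[OF assms(3), of r "r + length (T ! r)"] cE by simp
    thus False by (simp add: cells_iff)
  qed
  show "c = r" if r: "r = length T"
  proof (rule ccontr)
    assume "c \<noteq> r"
    hence "(r, r) \<in> cells T" using addable_below[OF assms(3), of r r] rc cE by simp
    thus False using r by (simp add: cells_iff)
  qed
qed

lemma rep_add:
  assumes R: "rep T E" and ad: "addable (fst ` E) (r, c)"
  shows "rep (add_at_row T r x) (insert ((r, c), x) E)"
proof -
  note re = rep_row_end[OF R addable_ideal[OF ad] ad]
  have cE: "cells T = fst ` E" and en: "\<And>e. e \<in> E \<Longrightarrow> ent T (fst e) = snd e" and ne: "[] \<notin> set T"
    using R by (auto simp: rep_def)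
  define T' where "T' = add_at_row T r x"
  have c1: "cells T' = insert (r, c) (cells T)"
  proof (rule set_eqI)
    fix b :: "nat \<times> nat"
    obtain r' c' where b: "b = (r', c')" by (cases b)
    show "b \<in> cells T' \<longleftrightarrow> b \<in> insert (r, c) (cells T)"
    proof (cases "r < length T")
      case True
      note c = re(2)[OF True]
      show ?thesis unfolding b T'_def add_at_row_def c using True
        by (cases "r' = r") (auto simp: cells_iff)
    next
      case False
      hence r: "r = length T" "c = length T" using re by auto
      show ?thesis unfolding b T'_def add_at_row_def r
        by (cases "r' < length T") (auto simp: cells_iff nth_append)
    qed
  qed
  have n: "(r, c) \<notin> cells T" using addable_notin[OF ad] cE by simp
  have e1: "ent T' (r, c) = x"
    using re by (cases "r < length T") (auto simp: T'_def add_at_row_def ent_def nth_append)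
  have e2: "ent T' b = ent T b" if "b \<in> cells T" for b
  proof (cases b)
    case (Pair r' c')
    thus ?thesis using that by (auto simp: T'_def add_at_row_def ent_def nth_append nth_list_update cells_def)
  qed
  have "[] \<notin> set T'" using ne by (auto simp: T'_def add_at_row_def dest!: set_update_subset_insert[THEN subsetD])
  thus ?thesis using c1 e1 e2 cE en by (auto simp: rep_def simp flip: T'_def)
qed

lemma rep_set_ent:
  assumes R: "rep T E" and b: "b \<in> fst ` E"
  shows "rep (set_ent T b x) (insert (b, x) {e \<in> E. fst e \<noteq> b})"
proof -
  have cE: "cells T = fst ` E" and en: "\<And>e. e \<in> E \<Longrightarrow> ent T (fst e) = snd e" and ne: "[] \<notin> set T"
    using R by (auto simp: rep_def)
  obtain r c where rc: "b = (r, c)" by (cases b)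
  have "(r, c) \<in> cells T" using b rc cE by simp
  hence bc: "r < length T" "r \<le> c" "c < r + length (T ! r)" by (simp_all add: cells_iff)
  define T' where "T' = set_ent T b x"
  have l1: "length (T' ! i) = length (T ! i)" for i
    using bc rc by (cases "i = r") (simp_all add: T'_def set_ent_def)
  have l2: "length T' = length T" by (simp add: T'_def set_ent_def)
  have c1: "cells T' = cells T" using l1 l2 by (simp add: cells_def)
  have e1: "ent T' b = x" using bc rc by (simp add: T'_def set_ent_def ent_def)
  have e2: "ent T' b' = ent T b'" if "b' \<in> cells T" "b' \<noteq> b" for b'
  proof (cases b')
    case (Pair r' c')
    thus ?thesis using that bc rc by (auto simp: T'_def set_ent_def ent_def nth_list_update cells_def)
  qed
  have ne': "[] \<notin> set T'"
  proof
    assume "[] \<in> set T'"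
    then obtain i where i: "i < length T'" "T' ! i = []" by (auto simp: in_set_conv_nth)
    hence "i < length T" "T ! i = []" using l1[of i] l2 by simp_all
    thus False using ne nth_mem by force
  qed
  have "cells T' = fst ` insert (b, x) {e \<in> E. fst e \<noteq> b}" using b by (auto simp: c1 cE)
  moreover have "ent T' (fst e) = snd e" if e: "e \<in> insert (b, x) {e \<in> E. fst e \<noteq> b}" for e
  proof (cases "e = (b, x)")
    case True thus ?thesis using e1 by simp
  next
    case False
    hence "e \<in> E" "fst e \<noteq> b" using e by auto
    thus ?thesis using e2[of "fst e"] en cE by auto
  qed
  ultimately show ?thesis using ne' by (simp add: rep_def T'_def)
qed

lemma filter_upt_hd:
  assumes "\<And>i. i < k \<Longrightarrow> \<not> P i" "P k" "k < n"
  shows "filter P [0..<n] \<noteq> [] \<and> hd (filter P [0..<n]) = k"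
proof -
  have "[0..<n] = [0..<k] @ k # [Suc k..<n]" using assms(3) by (metis upt_add_eq_append upt_conv_Cons le0 less_imp_le_nat le_add_diff_inverse plus_nat.add_0)
  moreover have "filter P [0..<k] = []" using assms(1) by (simp add: filter_empty_conv)
  ultimately show ?thesis using assms(2) by simp
qed

text \<open>The final shape is an ideal with a box in the row of \<open>b\<close> beyond
  \<open>S\<close>, so it contains the leftmost free box of that row, which is \<open>b\<close>.
  Hence it is enough to look at the single box \<open>b\<close> to decide whether an insertion into
  its row bumps or stops.\<close>

lemma chain_row_first:
  assumes "chain S bs" "addable S b" "b' \<in> set bs" "fst b' = fst b"
  shows "b \<in> set bs"
proof -
  obtain r c where b: "b = (r, c)" by (cases b)
  obtain c' where b': "b' = (r, c')" using assms(4) b by (cases b') simp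
  have i: "ideal (S \<union> set bs)" using chain_ideal'[OF assms(1)] .
  have "b' \<notin> S" using chain_distinct[OF assms(1)] assms(3) by auto
  hence "\<not> c' < c" using addable_below[of S r c r c'] assms(2) b b' ideal_le[OF i, of r c'] assms(3) by auto
  hence "(r, c) \<in> S \<union> set bs"
    using ideal_down[OF i, of r c' r c] assms(3) b' addable_le[OF assms(2)] b by simp
  thus ?thesis using addable_notin[OF assms(2)] b by simp
qed

lemma chain_col_first:
  assumes "chain S bs" "addable S b" "b' \<in> set bs" "snd b' = snd b"
  shows "b \<in> set bs"
proof -
  obtain r c where b: "b = (r, c)" by (cases b)
  obtain r' where b': "b' = (r', c)" using assms(4) b by (cases b') simp
  have i: "ideal (S \<union> set bs)" using chain_ideal'[OF assms(1)] .
  have "b' \<notin> S" using chain_distinct[OF assms(1)] assms(3) by auto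
  hence "\<not> r' < r" using addable_below[of S r c r' c] assms(2) b b' ideal_le[OF i, of r' c] assms(3) by auto
  hence "(r, c) \<in> S \<union> set bs"
    using ideal_down[OF i, of r' c r c] assms(3) b' addable_le[OF assms(2)] b by simp
  thus ?thesis using addable_notin[OF assms(2)] b by simp
qed

lemma filter_less_upt: "filter (\<lambda>r. r < h) [0..<n] = [0..<min h n]"
  by (induction n) (auto simp: min_def le_Suc_eq)

text \<open>A configuration of the bumping loop: the letter \<open>x\<close> is about to enter box \<open>b\<close> of the
  tableau \<open>T\<close>, where \<open>pre\<close> is already in its final position and \<open>post\<close> is not yet processed.\<close>

definition pending :: "xl list list \<Rightarrow> target \<Rightarrow> xl \<Rightarrow> ((nat \<times> nat) \<times> xl) list \<Rightarrow> nat \<times> nat \<Rightarrow>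
    ((nat \<times> nat) \<times> xl) list \<Rightarrow> bool" where
  "pending T t x pre b post \<longleftrightarrow>
     chain {} (map fst (pre @ post)) \<and> addable (set (map fst pre)) b \<and>
     rep T (set (pre @ post)) \<and> sorted_wrt good post \<and> (\<forall>e\<in>set post. undiag e) \<and>
     (\<forall>e\<in>set pre. xkey (snd e) \<le> xkey x) \<and> (\<forall>e\<in>set post. xkey x \<le> xkey (snd e)) \<and>
     (t = RowIns (fst b) \<and> (\<forall>e\<in>set post. fst (fst e) = fst b \<longrightarrow> xkey x < xkey (snd e)) \<or>
      t = ColIns (snd b) \<and> (\<forall>e\<in>set post. snd (fst e) = snd b \<longrightarrow> xkey x < xkey (snd e)))"

text \<open>What precedes \<open>b\<close> in its row and column belongs to \<open>pre\<close> and
  is at most \<open>x\<close>, while letters of \<open>post\<close> in the row or column entered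
  exceed \<open>x\<close>. So the first larger entry met by the algorithm sits in \<open>b\<close>,
  and if \<open>b\<close> is free there is none.\<close>

lemma ins_step_pending:
  assumes p: "pending T t x pre b post"
  shows "b \<notin> fst ` set post \<Longrightarrow> ins_step (T, t, x) = (add_at_row T (fst b) x, Placed (fst b), x)"
    and "(b, y) \<in> set post \<Longrightarrow> ins_step (T, t, x) = (set_ent T b x, fst (route b y), snd (route b y))"
proof -
  define S where "S = set (map fst pre)"
  define E where "E = set (pre @ post)"
  have ad: "addable S b" and R: "rep T E" and chE: "chain {} (map fst (pre @ post))"
    and low: "\<And>e. e \<in> set pre \<Longrightarrow> xkey (snd e) \<le> xkey x"
    using p by (auto simp: pending_def S_def E_def)
  have ch: "chain S (map fst post)" using chain_split(2)[OF chE] by (simp add: S_def)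
  have fE: "fst ` E = S \<union> set (map fst post)" by (auto simp: E_def S_def)
  have iE: "ideal (fst ` E)" using chain_ideal'[OF ch] fE by simp
  have cE: "cells T = fst ` E" and en: "\<And>e. e \<in> E \<Longrightarrow> ent T (fst e) = snd e" using R by (auto simp: rep_def)
  have lowS: "\<not> xless x (ent T b')" if "b' \<in> S" for b'
  proof -
    obtain e where "e \<in> set pre" "fst e = b'" using \<open>b' \<in> S\<close> by (auto simp: S_def)
    thus ?thesis using low[of e] en[of e] by (auto simp: E_def xless_def)
  qed
  obtain r c where b: "b = (r, c)" by (cases b)
  have rc: "r \<le> c" using addable_le[OF ad] b by simp
  have tt: "t = RowIns r \<and> (\<forall>e\<in>set post. fst (fst e) = r \<longrightarrow> xkey x < xkey (snd e)) \<or>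
      t = ColIns c \<and> (\<forall>e\<in>set post. snd (fst e) = c \<longrightarrow> xkey x < xkey (snd e))"
    using p by (simp add: pending_def b)
  define h where "h = fst (col_end (fst ` E) c)"
  have hc: "(r', c) \<in> cells T \<longleftrightarrow> r' < h" for r' using mem_col_iff[OF iE] by (simp add: cE h_def)
  have "r' < length T" if "r' < h" for r' using hc[of r'] that by (simp add: cells_iff)
  hence hl: "h \<le> length T" by (meson leI less_irrefl)
  have cr: "col_rows T c = [0..<h]"
  proof -
    have "filter (\<lambda>r. r \<le> c \<and> c < r + length (T ! r)) [0..<length T] = filter (\<lambda>r. r < h) [0..<length T]"
      by (rule filter_cong) (auto simp flip: hc simp: cells_iff)
    thus ?thesis using hl by (simp add: col_rows_def filter_less_upt min_absorb1)
  qed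
  { assume nb: "b \<notin> fst ` set post"
    have adE: "addable (fst ` E) b" using addable_chain[OF ch ad] nb fE by simp
    have pos: "b' \<in> S" if "b' \<in> fst ` E" "fst b' = r \<or> snd b' = c" for b'
      using chain_row_first[OF ch ad, of b'] chain_col_first[OF ch ad, of b'] that nb fE b by auto
    note re = rep_row_end[OF R iE adE[unfolded b]]
    show "ins_step (T, t, x) = (add_at_row T (fst b) x, Placed (fst b), x)"
      using tt
    proof
      assume t: "t = RowIns r \<and> (\<forall>e\<in>set post. fst (fst e) = r \<longrightarrow> xkey x < xkey (snd e))"
      have "filter (\<lambda>p. xless x (T ! r ! p)) [0..<length (T ! r)] = []" if r: "r < length T"
      proof -
        have "\<not> xless x (T ! r ! p)" if "p < length (T ! r)" for p
        proof -
          have "(r, r + p) \<in> cells T" using r that by (simp add: cells_iff)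
          hence "(r, r + p) \<in> S" using pos cE by simp
          from lowS[OF this] show ?thesis by (simp add: ent_def)
        qed
        thus ?thesis by (auto simp: filter_empty_conv)
      qed
      thus ?thesis using t b by simp
    next
      assume t: "t = ColIns c \<and> (\<forall>e\<in>set post. snd (fst e) = c \<longrightarrow> xkey x < xkey (snd e))"
      have hr: "h = r" using addable_col_end[OF adE] b by (simp add: h_def prod_eq_iff)
      have "\<not> xless x (ent T (r', c))" if "r' < h" for r'
        using lowS pos[of "(r', c)"] hc[of r'] that cE by simp
      hence "filter (\<lambda>r. xless x (ent T (r, c))) [0..<h] = []" by (auto simp: filter_empty_conv)
      thus ?thesis using t b hr by (simp add: cr)
    qed
  }
  { assume yb: "(b, y) \<in> set post"
    have bE: "(b, y) \<in> E" using yb by (simp add: E_def)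
    have ey: "ent T (r, c) = y" using en[OF bE] b by simp
    have bc: "(r, c) \<in> cells T" using bE b cE by force
    have xy: "xless x y" using tt yb b by (force simp: xless_def)
    show "ins_step (T, t, x) = (set_ent T b x, fst (route b y), snd (route b y))"
      using tt
    proof
      assume t: "t = RowIns r \<and> (\<forall>e\<in>set post. fst (fst e) = r \<longrightarrow> xkey x < xkey (snd e))"
      have "filter (\<lambda>p. xless x (T ! r ! p)) [0..<length (T ! r)] \<noteq> [] \<and>
          hd (filter (\<lambda>p. xless x (T ! r ! p)) [0..<length (T ! r)]) = c - r"
      proof (rule filter_upt_hd)
        fix i assume "i < c - r"
        hence "(r, r + i) \<in> S" using addable_below[of S r c r "r + i"] ad b by simp
        from lowS[OF this] show "\<not> xless x (T ! r ! i)" by (simp add: ent_def)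
      next
        show "xless x (T ! r ! (c - r))" using xy ey by (simp add: ent_def)
        show "c - r < length (T ! r)" using bc by (auto simp: cells_iff)
      qed
      thus ?thesis using t b bc rc ey by (auto simp: cells_iff ent_def Let_def split: prod.split)
    next
      assume t: "t = ColIns c \<and> (\<forall>e\<in>set post. snd (fst e) = c \<longrightarrow> xkey x < xkey (snd e))"
      have "filter (\<lambda>r. xless x (ent T (r, c))) [0..<h] \<noteq> [] \<and>
          hd (filter (\<lambda>r. xless x (ent T (r, c))) [0..<h]) = r"
      proof (rule filter_upt_hd)
        fix i assume "i < r"
        hence "(i, c) \<in> S" using addable_below[of S r c i c] ad b rc by simp
        from lowS[OF this] show "\<not> xless x (ent T (i, c))" by simp
      next
        show "xless x (ent T (r, c))" using xy ey by simp
        show "r < h" using bc hc by simp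
      qed
      thus ?thesis using t b ey by (auto simp: cr Let_def split: prod.split)
    qed
  }
qed

text \<open>On the diagonal, priming lowers the bumped letter, so everything before it must be
  strictly smaller than the unprimed letter: an equal one would lie to its left and weakly below,
  outside the shifted plane. Off the diagonal, later copies of the bumped letter lie weakly above it
  if unprimed and weakly left of it if primed, so none occurs in the row or column entered
  next.\<close>

lemma pending_next:
  assumes p: "pending T t x pre b (p1 @ (b, y) # p2)"
  defines "S \<equiv> insert b (set (map fst (pre @ p1)))"
  shows "pending (set_ent T b x) (fst (route b y)) (snd (route b y)) (pre @ (b, x) # p1)
      (nxt S b (primed y)) p2" (is ?P)
    and "snd (route b y) = bumped b y"
proof -
  show yb: "snd (route b y) = bumped b y" by (simp add: route_def bumped_def)
  define S0 where "S0 = set (map fst pre)"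
  define S1 where "S1 = set (map fst (pre @ p1))"
  have ad: "addable S0 b" and R: "rep T (set (pre @ p1 @ (b, y) # p2))"
    and chE: "chain {} (map fst (pre @ p1 @ (b, y) # p2))"
    and low: "\<And>e. e \<in> set pre \<Longrightarrow> xkey (snd e) \<le> xkey x"
    and g: "sorted_wrt good (p1 @ (b, y) # p2)" and u: "\<forall>e\<in>set (p1 @ (b, y) # p2). undiag e"
    using p by (auto simp: pending_def S0_def)
  have xy: "xkey x < xkey y" using p by (auto simp: pending_def)
  have ch: "chain {} (map fst pre)" "chain S0 (map fst p1)" "addable S1 b" "chain S (map fst p2)"
    using chE by (auto simp: chain_append S0_def S1_def S_def insert_commute)
  have S: "S = insert b S1" by (simp add: S_def S1_def)
  have d: "distinct (map fst (pre @ p1 @ (b, y) # p2))" using chain_distinct[OF chE] by simp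
  have b1: "b \<notin> set (map fst p1)" using d by auto
  define y' where "y' = bumped b y"
  define q where "q = nxt S b (primed y)"
  have q: "addable S q" unfolding q_def S using ch(3) by (rule addable_nxt)
  have S': "set (map fst (pre @ (b, x) # p1)) = S" by (auto simp: S_def)
  have gy: "good (b, y) e" if "e \<in> set p2" for e using g that by (simp add: sorted_wrt_append)
  have g1: "good e (b, y)" if "e \<in> set p1" for e using g that by (simp add: sorted_wrt_append)
  have uy: "fst b = snd b \<Longrightarrow> \<exists>k. y = UL k" using u by (cases y) (auto simp: undiag_def)
  have c1: "chain {} (map fst ((pre @ (b, x) # p1) @ p2))"
    using ch(1,4) chain_insert[OF ch(2) ad b1] ad by (simp add: chain_append S0_def S_def)
  have c2: "rep (set_ent T b x) (set ((pre @ (b, x) # p1) @ p2))"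
  proof -
    have "b \<in> fst ` set (pre @ p1 @ (b, y) # p2)" by force
    from rep_set_ent[OF R this, of x]
    have "rep (set_ent T b x) (insert (b, x) {e \<in> set (pre @ p1 @ (b, y) # p2). fst e \<noteq> b})" .
    moreover have "insert (b, x) {e \<in> set (pre @ p1 @ (b, y) # p2). fst e \<noteq> b} = set ((pre @ (b, x) # p1) @ p2)"
      using d by (auto simp: image_iff)
    ultimately show ?thesis by simp
  qed
  have c3: "xkey (snd e) \<le> xkey y'" if e: "e \<in> set (pre @ (b, x) # p1)" for e
  proof -
    have k1: "xkey x \<le> xkey y'" using xy xkey_bumped(2)[of y b] by (simp add: y'_def)
    consider "xkey (snd e) \<le> xkey x" | "e \<in> set p1" using e low[of e] by auto
    thus ?thesis
    proof cases
      case 1 thus ?thesis using k1 by simp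
    next
      case 2
      note ge = g1[OF 2]
      show ?thesis
      proof (cases "fst b = snd b")
        case True
        obtain k where k: "y = UL k" using uy True by blast
        have "addable S0 (fst e) \<or> fst (fst e) \<le> snd (fst e)"
          using 2 ideal_le[OF chain_ideal'[OF ch(2)], of "fst (fst e)" "snd (fst e)"] by force
        hence "fst (fst e) \<le> snd (fst e)" using addable_le by blast
        hence "\<not> rightof (fst e) b" using True by (auto simp: rightof_def)
        hence "xkey (snd e) < xkey y" using ge k by (auto simp: good_def split: if_splits)
        thus ?thesis using xkey_bumped(2)[of y b] by (simp add: y'_def)
      next
        case False
        thus ?thesis using good_xkey[OF ge] by (simp add: y'_def bumped_def)
      qed
    qed
  qed
  have c4: "xkey y' \<le> xkey (snd e)" if e: "e \<in> set p2" for e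
    using good_xkey[OF gy[OF e]] xkey_bumped(1)[of b y] by (simp add: y'_def)
  have c5: "fst (route b y) = RowIns (fst q) \<and> (\<forall>e\<in>set p2. fst (fst e) = fst q \<longrightarrow> xkey y' < xkey (snd e)) \<or>
      fst (route b y) = ColIns (snd q) \<and> (\<forall>e\<in>set p2. snd (fst e) = snd q \<longrightarrow> xkey y' < xkey (snd e))"
  proof (cases "primed y \<or> fst b = snd b")
    case True
    have sq: "snd q = Suc (snd b)" using nxt_col(1)[OF ch(3) True] by (simp add: q_def S)
    have "xkey y' < xkey (snd e)" if e: "e \<in> set p2" "snd (fst e) = snd q" for e
    proof (cases "fst b = snd b")
      case True
      obtain k where k: "y = UL k" using uy True by blast
      show ?thesis using good_xkey[OF gy[OF e(1)]] k True by (simp add: y'_def bumped_def)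
    next
      case F: False
      have "\<not> below b (fst e)" using e(2) sq by (simp add: below_def)
      hence "xkey y < xkey (snd e)" using gy[OF e(1)] True F by (auto simp: good_def)
      thus ?thesis using xkey_bumped(1)[of b y] by (simp add: y'_def)
    qed
    thus ?thesis using sq True by (auto simp: route_def)
  next
    case False
    have sq: "fst q = Suc (fst b)" using nxt_row(1)[OF ch(3) False] by (simp add: q_def S)
    have "xkey y' < xkey (snd e)" if e: "e \<in> set p2" "fst (fst e) = fst q" for e
    proof -
      have "\<not> rightof b (fst e)" using e(2) sq by (simp add: rightof_def)
      hence "xkey y < xkey (snd e)" using gy[OF e(1)] False by (auto simp: good_def)
      thus ?thesis using xkey_bumped(1)[of b y] by (simp add: y'_def)
    qed
    thus ?thesis using sq False by (auto simp: route_def)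
  qed
  show ?P
    unfolding pending_def yb S'
    using c1 q c2 c3 c4 c5 g u by (simp add: y'_def q_def sorted_wrt_append)
qed

text \<open>A bumped letter is reinserted among the letters behind it, so each bump shortens
  \<open>post\<close>; termination of the loop and its result come from the same induction.\<close>

lemma while_pending:
  assumes "pending T t x pre b post"
  shows "\<exists>T' x'. while_option (\<lambda>(_, t, _). \<not> is_placed t) ins_step (T, t, x) =
      Some (T', Placed (fst (newbox (set (map fst pre)) b post)), x') \<and>
      rep T' (set (pre @ (b, x) # run (set (map fst pre)) b post))"
  using assms
proof (induction "length post" arbitrary: T t x pre b post rule: less_induct)
  case less
  have np: "\<not> is_placed t" using less.prems by (auto simp: pending_def)
  have w: "while_option (\<lambda>(_, t, _). \<not> is_placed t) ins_step (T, t, x) =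
      while_option (\<lambda>(_, t, _). \<not> is_placed t) ins_step (ins_step (T, t, x))"
    using np by (subst while_option_unfold) simp
  show ?case
  proof (cases "b \<in> fst ` set post")
    case False
    have f: "rep T (set (pre @ post))" "addable (set (map fst pre)) b" "chain {} (map fst (pre @ post))"
      using less.prems by (auto simp: pending_def)
    have "addable (fst ` set (pre @ post)) b"
      using addable_chain[OF chain_split(2)[OF f(3)] f(2)] False by (simp add: image_Un)
    hence "rep (add_at_row T (fst b) x) (set (pre @ (b, x) # post))"
      using rep_add[OF f(1), of "fst b" "snd b" x] by simp
    thus ?thesis using w ins_step_pending(1)[OF less.prems False] run_notin[OF False] newbox_notin[OF False]
      by (simp add: while_option_unfold)
  next
    case True
    then obtain y where "(b, y) \<in> set post" by auto
    then obtain p1 p2 where post: "post = p1 @ (b, y) # p2" by (meson split_list)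
    have "distinct (map fst post)"
      using chain_distinct[of "{}" "map fst (pre @ post)"] less.prems by (auto simp: pending_def)
    hence b1: "b \<notin> fst ` set p1" by (auto simp: post)
    define S where "S = insert b (set (map fst (pre @ p1)))"
    define q where "q = nxt S b (primed y)"
    note pn = pending_next[OF less.prems[unfolded post], folded S_def q_def]
    have S': "set (map fst (pre @ (b, x) # p1)) = S" by (auto simp: S_def)
    have r: "run (set (map fst pre)) b post = p1 @ (q, bumped b y) # run S q p2"
      and nb: "newbox (set (map fst pre)) b post = newbox S q p2"
      by (simp_all add: post run_append newbox_append run_notin[OF b1] newbox_notin[OF b1] S_def q_def image_Un)
    have st: "ins_step (T, t, x) = (set_ent T b x, fst (route b y), snd (route b y))"
      using ins_step_pending(2)[OF less.prems, of y] by (simp add: post)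
    have "length p2 < length post" by (simp add: post)
    from less.hyps[OF this pn(1)] show ?thesis
      unfolding w st r nb S' pn(2) by simp
  qed
qed

lemma mix_insert_rep:
  assumes ok: "state_ok L" and R: "rep T (set L)"
  shows "\<exists>T'. mix_insert T (UL a) = (T', fst (insbox L a)) \<and> rep T' (set (ins L a))"
proof -
  define L1 where "L1 = takeWhile (small a) L"
  define L2 where "L2 = dropWhile (small a) L"
  have L: "L = L1 @ L2" by (simp add: L1_def L2_def)
  have ch: "chain {} (map fst L)" and g: "sorted_wrt good L" and u: "\<forall>e\<in>set L. undiag e"
    using ok by (auto simp: state_ok_def)
  define S where "S = set (map fst L1)"
  define al where "al = row_end S 0"
  note c' = chain_split[OF ch[unfolded L]]
  have st: "startbox L a = al" by (simp add: startbox_def S_def L1_def al_def)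
  have ad: "addable S al" using c'(3) by (simp add: addable_row_end_0 S_def al_def)
  have sm: "\<forall>e\<in>set L1. small a e" by (auto simp: L1_def dest: set_takeWhileD)
  have la: "\<forall>e\<in>set L2. \<not> small a e" using dropWhile_not_small[OF good_xsorted[OF g]] by (auto simp: L2_def)
  have "pending T (RowIns 0) (UL a) L1 al L2"
    unfolding pending_def using ch ad R g u sm la
    by (auto simp: L S_def sorted_wrt_append small_def al_def)
  from while_pending[OF this] obtain T' x' where
    "while_option (\<lambda>(_, t, _). \<not> is_placed t) ins_step (T, RowIns 0, UL a) =
      Some (T', Placed (fst (newbox S al L2)), x')" and r: "rep T' (set (L1 @ (al, UL a) # run S al L2))"
    by (auto simp: S_def)
  hence "mix_insert T (UL a) = (T', fst (newbox S al L2))" by (simp add: mix_insert_def)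
  moreover have "insbox L a = newbox S al L2"
    unfolding insbox_def st L1_def[symmetric] L2_def[symmetric] S_def[symmetric] by (rule refl)
  moreover have "ins L a = L1 @ (al, UL a) # run S al L2"
    unfolding ins_def st L1_def[symmetric] L2_def[symmetric] S_def[symmetric] by (rule refl)
  ultimately show ?thesis using r by simp
qed

section \<open>The boxes added by a word, and its recording tableau\<close>

fun boxes :: "((nat \<times> nat) \<times> xl) list \<Rightarrow> nat list \<Rightarrow> (nat \<times> nat) list" where
  "boxes L [] = []"
| "boxes L (a # w) = insbox L a # boxes (ins L a) w"

lemma boxes_append: "boxes L (u @ v) = boxes L u @ boxes (foldl ins L u) v"
  by (induction u arbitrary: L) auto

lemma length_boxes [simp]: "length (boxes L w) = length w"
  by (induction w arbitrary: L) auto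

lemma chain_boxes:
  assumes "state_ok L"
  shows "chain (set (map fst L)) (boxes L w)"
    and "set (map fst (foldl ins L w)) = set (map fst L) \<union> set (boxes L w)"
proof -
  have "chain (set (map fst L)) (boxes L w) \<and> set (map fst (foldl ins L w)) = set (map fst L) \<union> set (boxes L w)"
    using assms
  proof (induction w arbitrary: L)
    case Nil
    thus ?case using chain_ideal'[of "{}" "map fst L"] by (simp add: state_ok_def)
  next
    case (Cons a w)
    have "chain {} (map fst L)" using Cons.prems by (simp add: state_ok_def)
    note c = chain_ins[OF this, of a]
    note IH = Cons.IH[OF state_ok_ins[OF Cons.prems, of a]]
    have "chain (insert (insbox L a) (set (map fst L))) (boxes (ins L a) w)"
      using IH c(3) by metis
    moreover have "set (map fst (foldl ins (ins L a) w)) =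
        insert (insbox L a) (set (map fst L)) \<union> set (boxes (ins L a) w)"
      using IH c(3) by metis
    ultimately show ?case using c(2) by simp
  qed
  thus "chain (set (map fst L)) (boxes L w)"
    and "set (map fst (foldl ins L w)) = set (map fst L) \<union> set (boxes L w)" by auto
qed

text \<open>Times start at 1, like the entries of a recording tableau.\<close>

definition timed :: "'a list \<Rightarrow> ('a \<times> nat) set" where
  "timed xs = set (zip xs [1..<Suc (length xs)])"

lemma timed_snoc: "timed (xs @ [x]) = insert (x, Suc (length xs)) (timed xs)"
proof -
  have "[1..<Suc (length (xs @ [x]))] = [1..<Suc (length xs)] @ [Suc (length xs)]" by simp
  thus ?thesis unfolding timed_def by (simp add: zip_append del: upt_Suc)
qed

lemma fst_timed: "fst ` timed xs = set xs"
proof -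
  have "fst ` timed xs = set (map fst (zip xs [1..<Suc (length xs)]))" by (simp add: timed_def del: map_fst_zip upt_Suc)
  thus ?thesis by (simp del: upt_Suc)
qed

lemma timed_iff: "(x, t) \<in> timed xs \<longleftrightarrow> (\<exists>i<length xs. x = xs ! i \<and> t = Suc i)"
  by (auto simp: timed_def in_set_zip simp del: upt_Suc)

lemma card_cells: "card (cells T) = length (concat T)"
proof -
  have "cells T = Sigma {..<length T} (\<lambda>r. {r..<r + length (T ! r)})" by (auto simp: cells_def)
  hence "card (cells T) = (\<Sum>r<length T. length (T ! r))" by simp
  also have "\<dots> = sum_list (map length T)" by (simp add: sum_list_sum_nth atLeast0LessThan)
  finally show ?thesis by (simp add: length_concat)
qed

lemma mix_rep: "rep (P_mix w) (set (foldl ins [] w)) \<and> rep (Q_mix w) (timed (boxes [] w))"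
proof (induction w rule: rev_induct)
  case Nil
  show ?case by (simp add: P_mix_def Q_mix_def mix_def rep_def cells_def timed_def)
next
  case (snoc a w)
  define L where "L = foldl ins [] w"
  have ok: "state_ok L" unfolding L_def by (rule state_ok_foldl[OF state_ok_Nil])
  obtain T' where T': "mix_insert (P_mix w) (UL a) = (T', fst (insbox L a))" "rep T' (set (ins L a))"
    using mix_insert_rep[OF ok] snoc.IH by (auto simp: L_def)
  have chb: "chain {} (boxes [] w)" "set (map fst L) = set (boxes [] w)"
    using chain_boxes[OF state_ok_Nil, of w] by (auto simp: L_def)
  have "length (concat (Q_mix w)) = card (set (boxes [] w))"
    using snoc.IH by (simp add: rep_def fst_timed flip: card_cells)
  hence len: "length (concat (Q_mix w)) = length w"
    using chain_distinct[OF chb(1)] by (simp add: distinct_card)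
  have s: "mix (w @ [a]) = mix_step (P_mix w, Q_mix w) a"
    by (simp add: mix_def P_mix_def Q_mix_def)
  have P: "P_mix (w @ [a]) = T'" and Q: "Q_mix (w @ [a]) = add_at_row (Q_mix w) (fst (insbox L a)) (Suc (length w))"
    using s T'(1) len by (simp_all add: P_mix_def[of "w @ [a]"] Q_mix_def[of "w @ [a]"] mix_step_def)
  have "addable (set (boxes [] w)) (insbox L a)"
    using chain_ins(2)[of L a] ok chb(2) by (simp add: state_ok_def)
  hence "rep (Q_mix (w @ [a])) (timed (boxes [] (w @ [a])))"
    using rep_add[of "Q_mix w" "timed (boxes [] w)" "fst (insbox L a)" "snd (insbox L a)"] snoc.IH
    by (simp add: Q boxes_append timed_snoc fst_timed L_def)
  thus ?case using T'(2) by (simp add: P L_def)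
qed

section \<open>The largest letter of a word\<close>

text \<open>The effect on the recording tableau of inserting a letter that is larger than all others at
  time \<open>t\<close>: a Sagan-Worley insertion of \<open>t\<close>, seen box by box.\<close>

fun sw :: "(nat \<times> nat) set \<Rightarrow> nat \<times> nat \<Rightarrow> bool \<Rightarrow> (nat \<times> nat \<times> nat) list \<Rightarrow> (nat \<times> nat \<times> nat) list" where
  "sw S b m [] = []"
| "sw S b m ((t, c) # X) =
    (if c = b then (t, nxt (insert b S) b m) # sw (insert b S) (nxt (insert b S) b m) (m \<or> fst b = snd b) X
     else (t, c) # sw (insert c S) b m X)"

lemma not_small_xidx: "a < xidx x \<Longrightarrow> \<not> small a (b, x)"
  by (cases x) (auto simp: small_def)

text \<open>The last letter of the list is met when the pass over all others is complete, so it does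
  not influence them; it moves exactly if the box they would have gained is its own.\<close>

lemma ins_snoc:
  fixes L :: "((nat \<times> nat) \<times> xl) list"
  assumes "a < xidx x"
  defines "c \<equiv> insbox L a" and "S \<equiv> set (map fst L)"
  shows "ins (L @ [(b, x)]) a = ins L a @ [if b = c then (nxt (insert c S) c (primed x), bumped c x) else (b, x)]"
    and "insbox (L @ [(b, x)]) a = (if b = c then nxt (insert c S) c (primed x) else c)"
proof -
  define L1 where "L1 = takeWhile (small a) L"
  define L2 where "L2 = dropWhile (small a) L"
  have L: "L = L1 @ L2" by (simp add: L1_def L2_def)
  have t: "takeWhile (small a) (L @ [(b, x)]) = L1"
    using not_small_xidx[OF assms(1)] by (simp add: L1_def takeWhile_append) (metis takeWhile_eq_all_conv)
  have d: "dropWhile (small a) (L @ [(b, x)]) = L2 @ [(b, x)]"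
  proof -
    have "L1 @ dropWhile (small a) (L @ [(b, x)]) = L @ [(b, x)]" using t takeWhile_dropWhile_id by metis
    thus ?thesis using L by simp
  qed
  have s: "startbox (L @ [(b, x)]) a = startbox L a" unfolding startbox_def t L1_def by (rule refl)
  have SS: "set (map fst L1) \<union> set (map fst L2) = S" unfolding S_def L by simp
  have c: "newbox (set (map fst L1)) (startbox L a) L2 = c"
    unfolding c_def insbox_def L1_def L2_def by (rule refl)
  show "ins (L @ [(b, x)]) a = ins L a @ [if b = c then (nxt (insert c S) c (primed x), bumped c x) else (b, x)]"
    unfolding ins_def t d s run_append SS c by (simp add: L1_def L2_def)
  show "insbox (L @ [(b, x)]) a = (if b = c then nxt (insert c S) c (primed x) else c)"
    unfolding insbox_def t d s newbox_append SS c by simp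
qed

text \<open>When the new box of some time is the one held by the largest letter, that letter moves
  on, and the box gained at this time is the one it moves to. So \<open>sw\<close> reroutes the new
  boxes computed without the letter into those computed with it.\<close>

lemma boxes_snoc:
  assumes "state_ok L" "\<forall>a\<in>set w. a < xidx x" "length ts = length w"
  shows "zip ts (boxes (L @ [(b, x)]) w) = sw (set (map fst L)) b (primed x) (zip ts (boxes L w))"
  using assms
proof (induction w arbitrary: L b x ts)
  case (Cons a w)
  obtain t ts' where ts: "ts = t # ts'" "length ts' = length w" using Cons.prems(3) by (cases ts) auto
  define c where "c = insbox L a"
  define S where "S = set (map fst L)"
  have a: "a < xidx x" using Cons.prems by simp
  have ch: "chain {} (map fst L)" using Cons.prems(1) by (simp add: state_ok_def)
  have s: "set (map fst (ins L a)) = insert c S" using chain_ins(3)[OF ch] by (simp add: c_def S_def)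
  note i = ins_snoc[OF a, where L = L, folded c_def]
  note ok = state_ok_ins[OF Cons.prems(1), of a]
  show ?case
  proof (cases "b = c")
    case True
    have "\<forall>a\<in>set w. a < xidx (bumped c x)" using Cons.prems(2) by (simp add: xkey_bumped)
    from Cons.IH[OF ok this ts(2), unfolded s]
    show ?thesis using True by (simp add: ts i primed_bumped_diag S_def flip: c_def)
  next
    case False
    have "\<forall>a\<in>set w. a < xidx x" using Cons.prems(2) by simp
    from Cons.IH[OF ok this ts(2), unfolded s]
    show ?thesis using False by (simp add: ts i S_def flip: c_def)
  qed
qed simp

lemma foldl_ins_xidx_le:
  "\<forall>e\<in>set L. xidx (snd e) \<le> k \<Longrightarrow> \<forall>a\<in>set w. a \<le> k \<Longrightarrow> \<forall>e\<in>set (foldl ins L w). xidx (snd e) \<le> k"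
proof (induction w arbitrary: L)
  case (Cons a w)
  have r: "\<forall>e\<in>set M. xidx (snd e) \<le> k \<Longrightarrow> \<forall>e\<in>set (run S b M). xidx (snd e) \<le> k" for S b M
    by (induction S b M rule: run.induct) (auto simp: xkey_bumped)
  have "\<forall>e\<in>set (dropWhile (small a) L). xidx (snd e) \<le> k" using Cons.prems(1) by (auto dest: set_dropWhileD)
  note r' = r[OF this]
  have tw: "\<forall>e\<in>set (takeWhile (small a) L). xidx (snd e) \<le> k" using Cons.prems(1) by (auto dest: set_takeWhileD)
  have "\<forall>e\<in>set (ins L a). xidx (snd e) \<le> k"
    unfolding ins_def using tw r' Cons.prems(2) by (simp add: ball_Un)
  thus ?case using Cons.IH[of "ins L a"] Cons.prems by simp
qed simp

text \<open>The last occurrence of the maximum is taken: equal letters before it are not displaced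
  by its insertion, and everything after it is strictly smaller.\<close>

lemma boxes_max:
  assumes w1: "\<forall>x\<in>set w1. x \<le> a" and w2: "\<forall>x\<in>set w2. x < a" and ts: "length ts = length w2"
  defines "S \<equiv> set (boxes [] w1)"
  shows "boxes [] (w1 @ a # w2) = boxes [] w1 @ row_end S 0 #
    map snd (sw S (row_end S 0) False (zip ts (boxes (foldl ins [] w1) w2)))"
proof -
  define L where "L = foldl ins [] w1"
  have ok: "state_ok L" unfolding L_def by (rule state_ok_foldl[OF state_ok_Nil])
  have SL: "set (map fst L) = S" using chain_boxes(2)[OF state_ok_Nil, of w1] by (simp add: L_def S_def)
  have "\<forall>e\<in>set L. xidx (snd e) \<le> a" unfolding L_def using w1 by (intro foldl_ins_xidx_le) auto
  moreover have "xkey x \<le> 2 * xidx x + 1" for x by (cases x) auto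
  ultimately have sm: "small a e" if "e \<in> set L" for e
    using that unfolding small_def
    by (metis (no_types) add_le_mono1 mult_le_mono2 order_trans)
  hence t: "takeWhile (small a) L = L" "dropWhile (small a) L = []"
    by (auto simp: takeWhile_eq_all_conv dropWhile_eq_Nil_conv)
  have st: "startbox L a = row_end S 0" by (simp only: startbox_def t SL)
  have i: "ins L a = L @ [(row_end S 0, UL a)]" by (simp add: ins_def t st)
  have ib: "insbox L a = row_end S 0" by (simp add: insbox_def t st)
  have "zip ts (boxes (L @ [(row_end S 0, UL a)]) w2) = sw S (row_end S 0) False (zip ts (boxes L w2))"
    using boxes_snoc[OF ok, of w2 "UL a" ts] w2 ts SL by simp
  hence "map snd (sw S (row_end S 0) False (zip ts (boxes L w2))) = boxes (L @ [(row_end S 0, UL a)]) w2"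
    using ts by (metis length_boxes map_snd_zip)
  thus ?thesis by (simp add: boxes_append ib i flip: L_def)
qed

section \<open>Hook statistics and Knuth relations\<close>

text \<open>A hook subword of \<open>w\<close> becomes, in the word of positions of the letters of \<open>w\<close> in increasing
  order, a decreasing subsequence together with an increasing one above it. The interval
  \<open>(a, b)\<close> restricts to a factor of \<open>w\<close>.\<close>

definition hkpair :: "nat \<Rightarrow> nat \<Rightarrow> nat list \<Rightarrow> nat list \<Rightarrow> nat list \<Rightarrow> bool" where
  "hkpair a b v ds us \<longleftrightarrow> subseq ds v \<and> subseq us v \<and> sorted_wrt (>) ds \<and> sorted_wrt (<) us \<and>
     (\<forall>d\<in>set ds. \<forall>u\<in>set us. d < u) \<and> (\<forall>e\<in>set ds \<union> set us. a < e \<and> e < b)"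

definition hk :: "nat \<Rightarrow> nat \<Rightarrow> nat list \<Rightarrow> nat \<Rightarrow> bool" where
  "hk a b v m \<longleftrightarrow> (\<exists>ds us. hkpair a b v ds us \<and> length ds + length us = m)"

definition heq :: "nat list \<Rightarrow> nat list \<Rightarrow> bool" where
  "heq u v \<longleftrightarrow> (\<forall>a b m. hk a b u m \<longleftrightarrow> hk a b v m)"

definition keq :: "nat list \<Rightarrow> nat list \<Rightarrow> bool" where
  "keq u v \<longleftrightarrow> (\<forall>p s. heq (p @ u @ s) (p @ v @ s))"

lemma heq_refl [simp]: "heq u u" and heq_sym: "heq u v \<Longrightarrow> heq v u"
  and heq_trans [trans]: "heq u v \<Longrightarrow> heq v w \<Longrightarrow> heq u w"
  by (auto simp: heq_def)

lemma keq_refl [simp]: "keq u u" and keq_sym: "keq u v \<Longrightarrow> keq v u"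
  and keq_trans [trans]: "keq u v \<Longrightarrow> keq v w \<Longrightarrow> keq u w"
  unfolding keq_def by (blast intro: heq_refl heq_sym heq_trans)+

lemma keq_heq: "keq u v \<Longrightarrow> heq (p @ u @ s) (p @ v @ s)"
  by (simp add: keq_def)

lemma keq_heq': "keq u v \<Longrightarrow> heq u v"
  using keq_heq[of u v "[]" "[]"] by simp

lemma keq_cong: "keq u v \<Longrightarrow> keq (p @ u @ s) (p @ v @ s)"
  unfolding keq_def by (metis append.assoc)

lemma keq_left: "keq u v \<Longrightarrow> keq (p @ u) (p @ v)"
  using keq_cong[of u v p "[]"] by simp

lemma keq_right: "keq u v \<Longrightarrow> keq (u @ s) (v @ s)"
  using keq_cong[of u v "[]" s] by simp

lemma subseq_split3:
  "subseq d (p @ t @ s) \<Longrightarrow> \<exists>d1 d2 d3. d = d1 @ d2 @ d3 \<and> subseq d1 p \<and> subseq d2 t \<and> subseq d3 s"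
  by (metis subseq_appendE)

lemma subseq_join3: "subseq d1 p \<Longrightarrow> subseq d2 t \<Longrightarrow> subseq d3 s \<Longrightarrow> subseq (d1 @ d2 @ d3) (p @ t @ s)"
  by (simp add: list_emb_append_mono)

text \<open>The entries of \<open>d'\<close> stay between entries of \<open>d\<close>, so replacing
  \<open>d\<close> by \<open>d'\<close> inside a longer sequence violates neither monotonicity nor a
  bound.\<close>

definition within :: "nat list \<Rightarrow> nat list \<Rightarrow> bool" where
  "within d' d \<longleftrightarrow> length d' = length d \<and> (\<forall>x\<in>set d'. (\<exists>y\<in>set d. x \<le> y) \<and> (\<exists>y\<in>set d. y \<le> x))"

lemma within_refl: "within d d"
  by (auto simp: within_def)

text \<open>The decreasing and the increasing part may be changed independently of each other: their
  new entries stay within the old ranges, so the two parts remain separated.\<close>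

lemma hk_replace:
  assumes "hk a b (p @ t @ s) m"
    and stepd: "\<And>d. subseq d t \<Longrightarrow> sorted_wrt (>) d \<Longrightarrow> \<exists>d'. subseq d' t' \<and> sorted_wrt (>) d' \<and> within d' d"
    and stepu: "\<And>u. subseq u t \<Longrightarrow> sorted_wrt (<) u \<Longrightarrow> \<exists>u'. subseq u' t' \<and> sorted_wrt (<) u' \<and> within u' u"
  shows "hk a b (p @ t' @ s) m"
proof -
  obtain ds us where P: "hkpair a b (p @ t @ s) ds us" "length ds + length us = m"
    using assms(1) by (auto simp: hk_def)
  obtain d1 d2 d3 where d: "ds = d1 @ d2 @ d3" "subseq d1 p" "subseq d2 t" "subseq d3 s"
    using P(1) subseq_split3 unfolding hkpair_def by meson
  obtain u1 u2 u3 where u: "us = u1 @ u2 @ u3" "subseq u1 p" "subseq u2 t" "subseq u3 s"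
    using P(1) subseq_split3 unfolding hkpair_def by meson
  have sd: "sorted_wrt (>) d2" "sorted_wrt (<) u2"
    using P(1) by (auto simp: hkpair_def d u sorted_wrt_append)
  obtain d' where nd0: "subseq d' t'" "sorted_wrt (>) d'" "within d' d2" using stepd[OF d(3) sd(1)] by blast
  obtain u' where nu0: "subseq u' t'" "sorted_wrt (<) u'" "within u' u2" using stepu[OF u(3) sd(2)] by blast
  have n: "subseq d' t'" "subseq u' t'" "sorted_wrt (>) d'" "sorted_wrt (<) u'"
      "length d' = length d2" "length u' = length u2" using nd0 nu0 by (simp_all add: within_def)
  have nd: "\<exists>y\<in>set d2. x \<le> y" "\<exists>y\<in>set d2. y \<le> x" if "x \<in> set d'" for x
    using nd0(3) that by (simp_all add: within_def)
  have nu: "\<exists>y\<in>set u2. x \<le> y" "\<exists>y\<in>set u2. y \<le> x" if "x \<in> set u'" for x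
    using nu0(3) that by (simp_all add: within_def)
  have P1: "sorted_wrt (>) (d1 @ d2 @ d3)" "sorted_wrt (<) (u1 @ u2 @ u3)"
    "\<And>x y. x \<in> set (d1 @ d2 @ d3) \<Longrightarrow> y \<in> set (u1 @ u2 @ u3) \<Longrightarrow> x < y"
    "\<And>x. x \<in> set (d1 @ d2 @ d3) \<Longrightarrow> a < x \<and> x < b" "\<And>x. x \<in> set (u1 @ u2 @ u3) \<Longrightarrow> a < x \<and> x < b"
    using P(1) unfolding hkpair_def d u by auto
  have D: "\<exists>y\<in>set (d1 @ d2 @ d3). x \<le> y" "\<exists>y\<in>set (d1 @ d2 @ d3). y \<le> x" if "x \<in> set (d1 @ d' @ d3)" for x
    using that nd[of x] by auto
  have U: "\<exists>y\<in>set (u1 @ u2 @ u3). x \<le> y" "\<exists>y\<in>set (u1 @ u2 @ u3). y \<le> x" if "x \<in> set (u1 @ u' @ u3)" for x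
    using that nu[of x] by auto
  have S: "\<forall>x\<in>set d1. \<forall>y\<in>set d2. y < x" "\<forall>x\<in>set d2. \<forall>y\<in>set d3. y < x"
      "\<forall>x\<in>set d1. \<forall>y\<in>set d3. y < x" "sorted_wrt (>) d1" "sorted_wrt (>) d3"
      "\<forall>x\<in>set u1. \<forall>y\<in>set u2. x < y" "\<forall>x\<in>set u2. \<forall>y\<in>set u3. x < y"
      "\<forall>x\<in>set u1. \<forall>y\<in>set u3. x < y" "sorted_wrt (<) u1" "sorted_wrt (<) u3"
    using P1(1,2) by (simp_all add: sorted_wrt_append)
  have 1: "y < x" if "x \<in> set d1" "y \<in> set d'" for x y
    using nd(1)[OF that(2)] S(1) that(1) by (meson le_less_trans)
  have 2: "y < x" if "x \<in> set d'" "y \<in> set d3" for x y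
    using nd(2)[OF that(1)] S(2) that(2) by (meson less_le_trans)
  have 3: "x < y" if "x \<in> set u1" "y \<in> set u'" for x y
    using nu(2)[OF that(2)] S(6) that(1) by (meson less_le_trans)
  have 4: "x < y" if "x \<in> set u'" "y \<in> set u3" for x y
    using nu(1)[OF that(1)] S(7) that(2) by (meson le_less_trans)
  have "sorted_wrt (>) (d1 @ d' @ d3)"
    using S(3,4,5) n(3) 1 2 by (simp add: sorted_wrt_append ball_Un)
  moreover have "sorted_wrt (<) (u1 @ u' @ u3)"
    using S(8,9,10) n(4) 3 4 by (simp add: sorted_wrt_append ball_Un)
  moreover have "x < y" if dx: "x \<in> set (d1 @ d' @ d3)" and uy: "y \<in> set (u1 @ u' @ u3)" for x y
  proof -
    obtain x' y' where "x' \<in> set (d1 @ d2 @ d3)" "x \<le> x'" "y' \<in> set (u1 @ u2 @ u3)" "y' \<le> y"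
      using D(1)[OF dx] U(2)[OF uy] by blast
    thus ?thesis using P1(3)[of x' y'] by linarith
  qed
  moreover have "a < x \<and> x < b" if "x \<in> set (d1 @ d' @ d3) \<union> set (u1 @ u' @ u3)" for x
  proof -
    have "\<exists>y z. (a < y \<and> y < b) \<and> (a < z \<and> z < b) \<and> y \<le> x \<and> x \<le> z"
    proof (cases "x \<in> set (d1 @ d' @ d3)")
      case True
      thus ?thesis using D[OF True] P1(4) by blast
    next
      case False
      hence "x \<in> set (u1 @ u' @ u3)" using that by blast
      thus ?thesis using U[of x] P1(5) by blast
    qed
    thus ?thesis by (meson le_less_trans less_le_trans)
  qed
  ultimately have "hkpair a b (p @ t' @ s) (d1 @ d' @ d3) (u1 @ u' @ u3)"
    using subseq_join3 d u n(1,2) unfolding hkpair_def by blast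
  moreover have "length (d1 @ d' @ d3) + length (u1 @ u' @ u3) = m" using P(2) d(1) u(1) n(5,6) by simp
  ultimately show ?thesis unfolding hk_def by blast
qed

lemma subseq_3_iff:
  "subseq d [x, y, z] \<longleftrightarrow> d \<in> {[], [x], [y], [z], [x, y], [x, z], [y, z], [x, y, z]}"
  unfolding in_set_subseqs[symmetric] by (auto simp: Let_def)

lemma keqI:
  assumes "\<And>d. subseq d t \<Longrightarrow> sorted_wrt (>) d \<Longrightarrow> \<exists>d'. subseq d' t' \<and> sorted_wrt (>) d' \<and> within d' d"
    and "\<And>u. subseq u t \<Longrightarrow> sorted_wrt (<) u \<Longrightarrow> \<exists>u'. subseq u' t' \<and> sorted_wrt (<) u' \<and> within u' u"
    and "\<And>d. subseq d t' \<Longrightarrow> sorted_wrt (>) d \<Longrightarrow> \<exists>d'. subseq d' t \<and> sorted_wrt (>) d' \<and> within d' d"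
    and "\<And>u. subseq u t' \<Longrightarrow> sorted_wrt (<) u \<Longrightarrow> \<exists>u'. subseq u' t \<and> sorted_wrt (<) u' \<and> within u' u"
  shows "keq t t'"
  unfolding keq_def heq_def using hk_replace[of _ _ _ t _ _ t', OF _ assms(1,2)]
    hk_replace[of _ _ _ t' _ _ t, OF _ assms(3,4)] by blast

lemma subseq_3_cases:
  assumes "subseq d [x, y, z]"
  obtains "d = []" | "d = [x]" | "d = [y]" | "d = [z]" | "d = [x, y]" | "d = [x, z]" | "d = [y, z]" | "d = [x, y, z]"
  using assms unfolding subseq_3_iff by blast

text \<open>Only a pair formed by the exchanged letters \<open>x\<close> and \<open>z\<close> needs
  a substitute, and \<open>y\<close> supplies it: \<open>[x, y]\<close> for \<open>[x, z]\<close>,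
  and \<open>[z, y]\<close> for \<open>[z, x]\<close>.\<close>

lemma knuth1:
  assumes "x < y" "y < z"
  shows "keq [x, z, y] [z, x, y]"
proof (rule keqI)
  fix d assume d: "subseq d [x, z, y]" "sorted_wrt (>) d"
  show "\<exists>d'. subseq d' [z, x, y] \<and> sorted_wrt (>) d' \<and> within d' d"
    using d(1) by (rule subseq_3_cases)
      (intro exI[of _ d]; use d(2) assms in \<open>simp add: within_refl\<close>)+
next
  fix u assume u: "subseq u [x, z, y]" "sorted_wrt (<) u"
  show "\<exists>u'. subseq u' [z, x, y] \<and> sorted_wrt (<) u' \<and> within u' u"
  proof (cases "u = [x, z]")
    case True
    thus ?thesis using assms by (intro exI[of _ "[x, y]"]) (auto simp: within_def)
  next
    case False
    show ?thesis using u(1) by (rule subseq_3_cases)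
      (intro exI[of _ u]; use u(2) assms False in \<open>simp add: within_refl\<close>)+
  qed
next
  fix d assume d: "subseq d [z, x, y]" "sorted_wrt (>) d"
  show "\<exists>d'. subseq d' [x, z, y] \<and> sorted_wrt (>) d' \<and> within d' d"
  proof (cases "d = [z, x]")
    case True
    thus ?thesis using assms by (intro exI[of _ "[z, y]"]) (auto simp: within_def)
  next
    case False
    show ?thesis using d(1) by (rule subseq_3_cases)
      (intro exI[of _ d]; use d(2) assms False in \<open>simp add: within_refl\<close>)+
  qed
next
  fix u assume u: "subseq u [z, x, y]" "sorted_wrt (<) u"
  show "\<exists>u'. subseq u' [x, z, y] \<and> sorted_wrt (<) u' \<and> within u' u"
    using u(1) by (rule subseq_3_cases)
      (intro exI[of _ u]; use u(2) assms in \<open>simp add: within_refl\<close>)+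
qed

lemma knuth2:
  assumes "x < y" "y < z"
  shows "keq [y, x, z] [y, z, x]"
proof (rule keqI)
  fix d assume d: "subseq d [y, x, z]" "sorted_wrt (>) d"
  show "\<exists>d'. subseq d' [y, z, x] \<and> sorted_wrt (>) d' \<and> within d' d"
    using d(1) by (rule subseq_3_cases)
      (intro exI[of _ d]; use d(2) assms in \<open>simp add: within_refl\<close>)+
next
  fix u assume u: "subseq u [y, x, z]" "sorted_wrt (<) u"
  show "\<exists>u'. subseq u' [y, z, x] \<and> sorted_wrt (<) u' \<and> within u' u"
  proof (cases "u = [x, z]")
    case True
    thus ?thesis using assms by (intro exI[of _ "[y, z]"]) (auto simp: within_def)
  next
    case False
    show ?thesis using u(1) by (rule subseq_3_cases)
      (intro exI[of _ u]; use u(2) assms False in \<open>simp add: within_refl\<close>)+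
  qed
next
  fix d assume d: "subseq d [y, z, x]" "sorted_wrt (>) d"
  show "\<exists>d'. subseq d' [y, x, z] \<and> sorted_wrt (>) d' \<and> within d' d"
  proof (cases "d = [z, x]")
    case True
    thus ?thesis using assms by (intro exI[of _ "[y, x]"]) (auto simp: within_def)
  next
    case False
    show ?thesis using d(1) by (rule subseq_3_cases)
      (intro exI[of _ d]; use d(2) assms False in \<open>simp add: within_refl\<close>)+
  qed
next
  fix u assume u: "subseq u [y, z, x]" "sorted_wrt (<) u"
  show "\<exists>u'. subseq u' [y, x, z] \<and> sorted_wrt (<) u' \<and> within u' u"
    using u(1) by (rule subseq_3_cases)
      (intro exI[of _ u]; use u(2) assms in \<open>simp add: within_refl\<close>)+
qed

text \<open>The last letter \<open>t\<close> can only end one of the two parts. At the end of the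
  increasing part it is the maximum of the selection, at the end of the decreasing part the minimum;
  the others then lie in \<open>(a, t)\<close> or in \<open>(t, b)\<close>.\<close>

lemma hk_snoc:
  "hk a b (v @ [t]) m \<longleftrightarrow> hk a b v m \<or>
     a < t \<and> t < b \<and> (\<exists>m'. m = Suc m' \<and> (hk a t v m' \<or> hk t b v m'))"
proof
  assume "hk a b (v @ [t]) m"
  then obtain ds us where P: "hkpair a b (v @ [t]) ds us" "length ds + length us = m" by (auto simp: hk_def)
  obtain d1 d2 where d: "ds = d1 @ d2" "subseq d1 v" "subseq d2 [t]"
    using P(1) subseq_appendE unfolding hkpair_def by metis
  obtain u1 u2 where u: "us = u1 @ u2" "subseq u1 v" "subseq u2 [t]"
    using P(1) subseq_appendE unfolding hkpair_def by metis
  have one: "d2 = [] \<or> d2 = [t]" "u2 = [] \<or> u2 = [t]"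
    using d(3) u(3) unfolding in_set_subseqs[symmetric] by auto
  have no: "\<not> (d2 = [t] \<and> u2 = [t])" using P(1) by (auto simp: hkpair_def d u)
  consider "d2 = []" "u2 = []" | "d2 = [t]" "u2 = []" | "d2 = []" "u2 = [t]" using one no by blast
  thus "hk a b v m \<or> a < t \<and> t < b \<and> (\<exists>m'. m = Suc m' \<and> (hk a t v m' \<or> hk t b v m'))"
  proof cases
    case 1
    hence "hkpair a b v ds us" using P(1) d u by (simp add: hkpair_def)
    thus ?thesis using P(2) unfolding hk_def by blast
  next
    case 2
    have "hkpair t b v d1 u1" using P(1) d u 2 by (auto simp: hkpair_def sorted_wrt_append)
    moreover have "a < t \<and> t < b" using P(1) d 2 by (auto simp: hkpair_def)
    moreover have "m = Suc (length d1 + length u1)" using P(2) d u 2 by simp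
    ultimately show ?thesis unfolding hk_def by blast
  next
    case 3
    have "hkpair a t v d1 u1" using P(1) d u 3 by (auto simp: hkpair_def sorted_wrt_append)
    moreover have "a < t \<and> t < b" using P(1) u 3 by (auto simp: hkpair_def)
    moreover have "m = Suc (length d1 + length u1)" using P(2) d u 3 by simp
    ultimately show ?thesis unfolding hk_def by blast
  qed
next
  have sub: "subseq x v \<Longrightarrow> subseq x (v @ [t])" for x by (rule list_emb_prefix)
  have sub2: "subseq x v \<Longrightarrow> subseq (x @ [t]) (v @ [t])" for x by simp
  assume "hk a b v m \<or> a < t \<and> t < b \<and> (\<exists>m'. m = Suc m' \<and> (hk a t v m' \<or> hk t b v m'))"
  then consider ds us where "hkpair a b v ds us" "length ds + length us = m"
    | ds us where "a < t" "t < b" "hkpair a t v ds us" "m = Suc (length ds + length us)"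
    | ds us where "a < t" "t < b" "hkpair t b v ds us" "m = Suc (length ds + length us)"
    unfolding hk_def by blast
  thus "hk a b (v @ [t]) m"
  proof cases
    case 1
    hence "hkpair a b (v @ [t]) ds us" by (auto simp: hkpair_def sub)
    thus ?thesis using 1 unfolding hk_def by blast
  next
    case 2
    hence "hkpair a b (v @ [t]) ds (us @ [t])"
      by (auto simp: hkpair_def sub sub2 sorted_wrt_append intro: less_trans)
    moreover have "length ds + length (us @ [t]) = m" using 2 by simp
    ultimately show ?thesis unfolding hk_def by blast
  next
    case 3
    hence "hkpair a b (v @ [t]) (ds @ [t]) us"
      by (auto simp: hkpair_def sub sub2 sorted_wrt_append intro: less_trans)
    moreover have "length (ds @ [t]) + length us = m" using 3 by simp
    ultimately show ?thesis unfolding hk_def by blast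
  qed
qed

lemma heq_snoc: "heq u v \<Longrightarrow> heq (u @ [t]) (v @ [t])"
  by (simp add: heq_def hk_snoc)

text \<open>By \<open>hk_snoc\<close>, the statistics of \<open>v @ [t]\<close> are determined by
  those of \<open>v\<close>.\<close>

lemma heq_append: "heq u v \<Longrightarrow> heq (u @ s) (v @ s)"
proof (induction s arbitrary: u v)
  case (Cons t s)
  from Cons.IH[OF heq_snoc[OF Cons.prems, of t]] show ?case by simp
qed simp

section \<open>Row and column bumping as consequences of the Knuth relations\<close>

lemma keq_sink_left:
  assumes "sorted_wrt (<) (y # Z)" "x < y"
  shows "keq (y # Z @ [x]) (y # x # Z)"
  using assms
proof (induction Z arbitrary: y)
  case (Cons z Z)
  have yz: "y < z" using Cons.prems(1) by simp
  have "keq (z # Z @ [x]) (z # x # Z)" using Cons.IH[of z] Cons.prems yz by simp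
  hence "keq (y # z # Z @ [x]) (y # z # x # Z)" using keq_left[of _ _ "[y]"] by simp
  also have "keq (y # z # x # Z) (y # x # z # Z)"
    using keq_right[OF keq_sym[OF knuth2[OF Cons.prems(2) yz]], of Z] by simp
  finally show ?case by simp
qed simp

lemma keq_rise_left:
  assumes "sorted_wrt (<) (A @ [x])" "x < y"
  shows "keq (A @ [y, x]) (y # A @ [x])"
  using assms
proof (induction A arbitrary: x rule: rev_induct)
  case (snoc a A)
  have ax: "a < x" using snoc.prems by (simp add: sorted_wrt_append)
  have sa: "sorted_wrt (<) (A @ [a])" "a < y" using snoc.prems ax by (auto simp: sorted_wrt_append)
  have k1: "keq (A @ [a, y, x]) (A @ [y, a, x])" by (rule keq_left[OF knuth1[OF ax snoc.prems(2)]])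
  have k2: "keq (A @ [y, a, x]) (y # A @ [a, x])" using keq_right[OF snoc.IH[OF sa], of "[x]"] by simp
  show ?case using keq_trans[OF k1 k2] by simp
qed simp

text \<open>Row insertion enters from the right: \<open>x\<close> moves left past the larger entries
  \<open>Z\<close> and stops behind \<open>y\<close>, then \<open>y\<close> leaves to the left past
  \<open>A\<close>.\<close>

lemma keq_row_bump:
  assumes "sorted_wrt (<) (A @ [x, y] @ Z)"
  shows "keq (A @ y # Z @ [x]) (y # A @ x # Z)"
proof -
  have s: "sorted_wrt (<) (y # Z)" "x < y" "sorted_wrt (<) (A @ [x])"
    using assms by (auto simp: sorted_wrt_append)
  have "keq (A @ y # Z @ [x]) (A @ y # x # Z)" using keq_left[OF keq_sink_left[OF s(1,2)], of A] by simp
  also have "keq (A @ y # x # Z) (y # A @ x # Z)" using keq_right[OF keq_rise_left[OF s(3,2)], of Z] by simp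
  finally show ?thesis .
qed

lemma keq_sink_right:
  assumes "sorted_wrt (<) (x # y # Z')" "sorted_wrt (<) (y # Z)"
  shows "keq (x # rev Z @ [y]) (rev Z @ [x, y])"
  using assms
proof (induction Z arbitrary: y Z')
  case (Cons z Z)
  have xy: "x < y" "y < z" using Cons.prems by auto
  have "keq (x # rev Z @ [z]) (rev Z @ [x, z])"
    using Cons.IH[of z "[]"] Cons.prems xy by simp
  from keq_right[OF this, of "[y]"] have "keq (x # rev Z @ [z, y]) (rev Z @ [x, z, y])" by simp
  also have "keq (rev Z @ [x, z, y]) (rev Z @ [z, x, y])" using keq_left[OF knuth1[OF xy]] .
  finally show ?case by simp
qed simp

lemma keq_rise_right:
  assumes "sorted_wrt (<) (A @ [x])" "x < y"
  shows "keq (x # y # rev A) (x # rev A @ [y])"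
  using assms
proof (induction A arbitrary: x rule: rev_induct)
  case (snoc a A)
  have ax: "a < x" using snoc.prems by (simp add: sorted_wrt_append)
  have sa: "sorted_wrt (<) (A @ [a])" "a < y" using snoc.prems ax by (auto simp: sorted_wrt_append)
  have k1: "keq (x # y # a # rev A) (x # a # y # rev A)"
    using keq_right[OF keq_sym[OF knuth2[OF ax snoc.prems(2)]], of "rev A"] by simp
  have k2: "keq (x # a # y # rev A) (x # a # rev A @ [y])"
    using keq_left[OF snoc.IH[OF sa], of "[x]"] by simp
  show ?case using keq_trans[OF k1 k2] by simp
qed simp

text \<open>Column insertion enters from the left, the column being read upwards: \<open>x\<close>
  moves right past the larger entries \<open>Z\<close>, then \<open>y\<close> leaves to the right
  past the smaller entries \<open>A\<close>.\<close>

lemma keq_col_bump: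
  assumes "sorted_wrt (<) (A @ [x, y] @ Z)"
  shows "keq (x # rev (A @ y # Z)) (rev (A @ x # Z) @ [y])"
proof -
  have s: "sorted_wrt (<) [x, y]" "sorted_wrt (<) (y # Z)" "sorted_wrt (<) (A @ [x])" "x < y"
    using assms by (auto simp: sorted_wrt_append)
  have "keq (x # rev Z @ [y] @ rev A) (rev Z @ [x, y] @ rev A)"
    using keq_right[OF keq_sink_right[OF s(1,2)], of "rev A"] by simp
  also have "keq (rev Z @ [x, y] @ rev A) (rev Z @ x # rev A @ [y])"
    using keq_left[OF keq_rise_right[OF s(3,4)], of "rev Z"] by simp
  finally show ?thesis by simp
qed

text \<open>The large letter \<open>c\<close> passes \<open>f\<close> because the next entry
  \<open>g\<close> of the row stands behind it, with \<open>f < g < c\<close>. The last entry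
  \<open>q\<close> has no successor to permit this, so \<open>c\<close> stops in front of
  it.\<close>

lemma keq_pass_row:
  assumes "sorted_wrt (<) (E @ [q])" "\<forall>x\<in>set (E @ [q]). x < c"
  shows "keq (c # E @ [q]) (E @ [c, q])"
  using assms
proof (induction E)
  case (Cons f E)
  obtain g R where g: "E @ [q] = g # R" by (cases E) auto
  have gm: "g \<in> set (E @ [q])" unfolding g by simp
  have fg: "f < g" "g < c" using Cons.prems gm by auto
  have "keq [c, f, g] [f, c, g]" using keq_sym[OF knuth1[OF fg]] .
  from keq_right[OF this, of R] have "keq (c # f # E @ [q]) (f # c # E @ [q])" by (simp add: g)
  also have "keq (f # c # E @ [q]) (f # E @ [c, q])"
    using keq_left[OF Cons.IH, of "[f]"] Cons.prems by simp
  finally show ?case by simp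
qed simp

lemma keq_col_pass_row:
  assumes "sorted_wrt (<) (E @ [q])" "sorted_wrt (>) C" "\<forall>x\<in>set (E @ [q]). \<forall>c\<in>set C. x < c"
  shows "keq (C @ E @ [q]) (E @ C @ [q])"
  using assms
proof (induction C arbitrary: q rule: rev_induct)
  case (snoc c C)
  have "keq (c # E @ [q]) (E @ [c, q])" using snoc.prems by (intro keq_pass_row) auto
  from keq_left[OF this, of C] have "keq ((C @ [c]) @ E @ [q]) ((C @ E @ [c]) @ [q])" by simp
  also have "keq ((C @ E @ [c]) @ [q]) ((E @ C @ [c]) @ [q])"
    using snoc.prems by (intro keq_right snoc.IH) (auto simp: sorted_wrt_append)
  finally show ?case by simp
qed simp

section \<open>Row and column reading words\<close>

type_synonym tlist = "(nat \<times> nat \<times> nat) list"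

text \<open>A \<open>valid\<close> list is ordered by time, so a row is obtained from left to right;
  a column is reversed, as column words are read upwards.\<close>

definition rowf :: "tlist \<Rightarrow> nat \<Rightarrow> nat list" where
  "rowf Q r = map fst (filter (\<lambda>p. fst (snd p) = r) Q)"

definition colf :: "tlist \<Rightarrow> nat \<Rightarrow> nat list" where
  "colf Q c = rev (map fst (filter (\<lambda>p. snd (snd p) = c) Q))"

text \<open>The lowest row comes first, as in the usual row word. Ranges of rows and columns are
  needed because a letter in transit stands between two of them.\<close>

definition rows :: "tlist \<Rightarrow> nat \<Rightarrow> nat \<Rightarrow> nat list" where
  "rows Q i j = concat (map (rowf Q) (rev [i..<j]))"

definition cols :: "tlist \<Rightarrow> nat \<Rightarrow> nat \<Rightarrow> nat list" where
  "cols Q i j = concat (map (colf Q) [i..<j])"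

definition valid :: "tlist \<Rightarrow> bool" where
  "valid Q \<longleftrightarrow> chain {} (map snd Q) \<and> sorted_wrt (<) (map fst Q)"

definition bounded :: "nat \<Rightarrow> tlist \<Rightarrow> bool" where
  "bounded N Q \<longleftrightarrow> (\<forall>p\<in>set Q. fst (snd p) < N \<and> snd (snd p) < N)"

lemma rows_split: "i \<le> j \<Longrightarrow> j \<le> k \<Longrightarrow> rows Q i k = rows Q j k @ rows Q i j"
  unfolding rows_def by (metis concat_append le_add_diff_inverse map_append rev_append upt_add_eq_append)

lemma rows_1: "rows Q i (Suc i) = rowf Q i"
  by (simp add: rows_def)

lemma rows_first: "i < k \<Longrightarrow> rows Q i k = rows Q (Suc i) k @ rowf Q i"
  using rows_split[of i "Suc i" k Q] by (simp add: rows_1)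

lemma rows_last: "i \<le> k \<Longrightarrow> rows Q i (Suc k) = rowf Q k @ rows Q i k"
  using rows_split[of i k "Suc k" Q] by (simp add: rows_1)

lemma cols_split: "i \<le> j \<Longrightarrow> j \<le> k \<Longrightarrow> cols Q i k = cols Q i j @ cols Q j k"
  unfolding cols_def by (metis concat_append le_add_diff_inverse map_append upt_add_eq_append)

lemma cols_1: "cols Q i (Suc i) = colf Q i"
  by (simp add: cols_def)

lemma cols_first: "i < k \<Longrightarrow> cols Q i k = colf Q i @ cols Q (Suc i) k"
  using cols_split[of i "Suc i" k Q] by (simp add: cols_1)

lemma cols_last: "i \<le> k \<Longrightarrow> cols Q i (Suc k) = cols Q i k @ colf Q k"
  using cols_split[of i k "Suc k" Q] by (simp add: cols_1)

lemma set_rowf: "set (rowf Q r) = {t. \<exists>c. (t, r, c) \<in> set Q}"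
  by (force simp: rowf_def)

lemma set_colf: "set (colf Q c) = {t. \<exists>r. (t, r, c) \<in> set Q}"
  by (force simp: colf_def)

lemma set_rows: "set (rows Q i j) = {t. \<exists>r c. (t, r, c) \<in> set Q \<and> i \<le> r \<and> r < j}"
proof -
  have "set (rows Q i j) = (\<Union>r\<in>{i..<j}. {t. \<exists>c. (t, r, c) \<in> set Q})" by (simp add: rows_def set_rowf)
  thus ?thesis by fastforce
qed

lemma set_cols: "set (cols Q i j) = {t. \<exists>r c. (t, r, c) \<in> set Q \<and> i \<le> c \<and> c < j}"
proof -
  have "set (cols Q i j) = (\<Union>c\<in>{i..<j}. {t. \<exists>r. (t, r, c) \<in> set Q})" by (simp add: cols_def set_colf)
  thus ?thesis by fastforce
qed

lemma valid_append: "valid (Q @ R) \<Longrightarrow> valid Q"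
  by (auto simp: valid_def chain_append sorted_wrt_append)

lemma valid_ideal: "valid Q \<Longrightarrow> ideal (snd ` set Q)"
  using chain_ideal'[of "{}" "map snd Q"] by (simp add: valid_def)

lemma valid_distinct: "valid Q \<Longrightarrow> distinct (map fst Q) \<and> distinct (map snd Q)"
  using chain_distinct[of "{}" "map snd Q"] strict_sorted_iff[of "map fst Q"] by (auto simp: valid_def)

lemma valid_functional: "valid Q \<Longrightarrow> (t, b) \<in> set Q \<Longrightarrow> (t, b') \<in> set Q \<Longrightarrow> b = b'"
  using valid_distinct[of Q] by (meson eq_key_imp_eq_value)

lemma valid_le: "valid Q \<Longrightarrow> (t, r, c) \<in> set Q \<Longrightarrow> r \<le> c"
  using ideal_le[OF valid_ideal] by force

lemma valid_less:
  assumes v: "valid Q" and m: "(t, r, c) \<in> set Q" "(t', r', c') \<in> set Q" and lt: "t < t'"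
  shows "\<not> (r' \<le> r \<and> c' \<le> c)"
proof
  assume le: "r' \<le> r \<and> c' \<le> c"
  obtain Q1 Q2 where Q: "Q = Q1 @ (t, r, c) # Q2" using m(1) by (meson split_list)
  have "sorted_wrt (<) (map fst Q)" using v by (simp add: valid_def)
  hence "(t', r', c') \<in> set Q2" using m(2) lt by (auto simp: Q sorted_wrt_append)
  hence b': "(r', c') \<in> set (map snd Q2)" by force
  have ch: "chain (insert (r, c) (set (map snd Q1))) (map snd Q2)"
    using v by (simp add: valid_def Q chain_append)
  have "(r', c') \<in> insert (r, c) (set (map snd Q1))"
    using ideal_down[OF chain_ideal[OF ch], of r c r' c'] le valid_le[OF v m(2)] by simp
  thus False using chain_distinct[OF ch] b' by blast
qed

lemma valid_down:
  assumes v: "valid Q" and m: "(t, r, c) \<in> set Q" and le: "r' \<le> r" "c' \<le> c" "r' \<le> c'"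
  obtains t' where "(t', r', c') \<in> set Q" "t' \<le> t"
proof -
  have "(r, c) \<in> snd ` set Q" using m by force
  hence "(r', c') \<in> snd ` set Q" using ideal_down[OF valid_ideal[OF v]] le by blast
  then obtain t' where t': "(t', r', c') \<in> set Q" by auto
  hence "t' \<le> t" using valid_less[OF v m t'] le by force
  thus ?thesis using that t' by blast
qed

lemma sorted_rowf: "valid Q \<Longrightarrow> sorted_wrt (<) (rowf Q r)"
  unfolding valid_def rowf_def sorted_wrt_map by (auto intro: sorted_wrt_filter)

lemma sorted_colf: "valid Q \<Longrightarrow> sorted_wrt (>) (colf Q c)"
  unfolding valid_def colf_def sorted_wrt_map sorted_wrt_rev by (auto intro: sorted_wrt_filter)

section \<open>Knuth equivalence of the row word and the column word\<close>

definition cell :: "tlist \<Rightarrow> nat \<Rightarrow> nat \<Rightarrow> nat list" where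
  "cell Q r c = map fst (filter (\<lambda>p. snd p = (r, c)) Q)"

lemma set_cell: "set (cell Q r c) = {t. (t, r, c) \<in> set Q}"
  by (force simp: cell_def)

lemma cell_length:
  assumes "valid Q" shows "cell Q r c = [] \<or> (\<exists>t. cell Q r c = [t])"
proof (rule ccontr)
  assume n: "\<not> ?thesis"
  have d: "distinct (map snd (filter (\<lambda>p. snd p = (r, c)) Q))"
    using valid_distinct[OF assms] by (simp add: distinct_map_filter)
  have "\<forall>x\<in>set (map snd (filter (\<lambda>p. snd p = (r, c)) Q)). x = (r, c)" by auto
  hence "set (map snd (filter (\<lambda>p. snd p = (r, c)) Q)) \<subseteq> {(r, c)}" by blast
  hence "card (set (map snd (filter (\<lambda>p. snd p = (r, c)) Q))) \<le> card {(r, c)}" by (intro card_mono) auto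
  hence "length (filter (\<lambda>p. snd p = (r, c)) Q) \<le> 1" using distinct_card[OF d] by simp
  hence "length (cell Q r c) \<le> 1" by (simp add: cell_def)
  thus False using n by (cases "cell Q r c") auto
qed

lemma cell_snoc: "cell (Q @ [(t, b)]) r c = cell Q r c @ (if b = (r, c) then [t] else [])"
  by (simp add: cell_def)

lemma valid_snocD: "valid (Q @ [(t, b)]) \<Longrightarrow> valid Q \<and> addable (snd ` set Q) b"
  using valid_append[of Q "[(t, b)]"] by (auto simp: valid_def chain_append)

lemma rowf_cells:
  "valid Q \<Longrightarrow> bounded N Q \<Longrightarrow> rowf Q r = concat (map (cell Q r) [0..<N])"
proof (induction Q rule: rev_induct)
  case Nil
  show ?case by (simp add: rowf_def cell_def)
next
  case (snoc e Q)
  obtain t r' c where e: "e = (t, r', c)" by (cases e)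
  have v: "valid Q" and ad: "addable (snd ` set Q) (r', c)" using valid_snocD snoc.prems(1) e by blast+
  have bd: "bounded N Q" "c < N" using snoc.prems(2) by (auto simp: bounded_def e)
  note IH = snoc.IH[OF v bd(1)]
  show ?case
  proof (cases "r' = r")
    case False
    hence "cell (Q @ [e]) r c'' = cell Q r c''" for c'' by (simp add: e cell_snoc)
    hence "cell (Q @ [e]) r = cell Q r" by blast
    thus ?thesis using IH False by (simp add: rowf_def e)
  next
    case True
    have up: "cell Q r c'' = []" if "c \<le> c''" for c''
    proof (rule ccontr)
      assume "cell Q r c'' \<noteq> []"
      then obtain t' where "(t', r, c'') \<in> set Q" using set_cell[of Q r c''] by (metis ex_in_conv mem_Collect_eq set_empty)
      hence "(r, c'') \<in> snd ` set Q" by force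
      thus False using addable_above[OF ad, of r c''] True that by simp
    qed
    have N: "[0..<N] = [0..<c] @ c # [Suc c..<N]"
      using bd(2) by (metis append_Cons append_Nil le_add_diff_inverse less_imp_le plus_nat.add_0 upt_add_eq_append upt_conv_Cons zero_le)
    have 1: "map (cell (Q @ [e]) r) [0..<c] = map (cell Q r) [0..<c]" by (auto simp: e cell_snoc)
    have 2: "concat (map (cell (Q @ [e]) r) [Suc c..<N]) = []" using up by (auto simp: e cell_snoc)
    have 3: "concat (map (cell Q r) [Suc c..<N]) = []" using up by auto
    have 4: "cell (Q @ [e]) r c = [t]" using up[of c] True by (simp add: e cell_snoc)
    have "rowf (Q @ [e]) r = rowf Q r @ [t]" using True by (simp add: rowf_def e)
    thus ?thesis using IH up[of c] by (simp add: N 1 2 3 4)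
  qed
qed

text \<open>Columns cut off above row \<open>k\<close>: the intermediate stages between the row word
  and, for \<open>k = 0\<close>, the column word.\<close>

definition colge :: "tlist \<Rightarrow> nat \<Rightarrow> nat \<Rightarrow> nat list" where
  "colge Q k c = rev (map fst (filter (\<lambda>p. snd (snd p) = c \<and> k \<le> fst (snd p)) Q))"

lemma colge_step:
  "valid Q \<Longrightarrow> colge Q k c = colge Q (Suc k) c @ cell Q k c"
proof (induction Q rule: rev_induct)
  case Nil
  show ?case by (simp add: colge_def cell_def)
next
  case (snoc e Q)
  obtain t r c' where e: "e = (t, r, c')" by (cases e)
  have v: "valid Q" and ad: "addable (snd ` set Q) (r, c')" using valid_snocD snoc.prems(1) e by blast+
  note IH = snoc.IH[OF v]
  have cs: "colge (Q @ [e]) i c = (if c' = c \<and> i \<le> r then [t] else []) @ colge Q i c" for i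
    by (simp add: colge_def e)
  show ?case
  proof (cases "c' = c \<and> r = k")
    case True
    have "p \<notin> set Q" if "snd (snd p) = c \<and> Suc k \<le> fst (snd p)" for p
    proof
      assume "p \<in> set Q"
      hence "(fst (snd p), c) \<in> snd ` set Q" using that by (metis image_eqI prod.collapse)
      thus False using addable_above[OF ad, of "fst (snd p)" c] True that by simp
    qed
    hence 1: "colge Q (Suc k) c = []" unfolding colge_def by (auto simp: filter_empty_conv)
    have "p \<notin> set Q" if "snd p = (k, c)" for p
      using addable_notin[OF ad] True that by force
    hence "cell Q k c = []" unfolding cell_def by (auto simp: filter_empty_conv)
    thus ?thesis using IH 1 True unfolding cs by (simp add: e cell_snoc)
  next
    case False
    thus ?thesis using IH unfolding cs by (auto simp: e cell_snoc)
  qed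
qed

lemma keq_zip_cols:
  assumes "\<forall>c<n. sorted_wrt (>) (C c)" "\<forall>c<n. C c \<noteq> [] \<longrightarrow> (\<exists>q. e c = [q])"
    "sorted_wrt (<) (concat (map e [0..<n]))"
    "\<forall>c<n. \<forall>c'\<le>c. \<forall>x\<in>set (e c'). \<forall>y\<in>set (C c). x < y"
  shows "keq (concat (map C [0..<n]) @ concat (map e [0..<n])) (concat (map (\<lambda>c. C c @ e c) [0..<n]))"
  using assms
proof (induction n)
  case (Suc n)
  define E where "E = concat (map e [0..<n])"
  have IH: "keq (concat (map C [0..<n]) @ E) (concat (map (\<lambda>c. C c @ e c) [0..<n]))"
    unfolding E_def
  proof (rule Suc.IH)
    show "\<forall>c<n. sorted_wrt (>) (C c)" using Suc.prems(1) less_SucI by blast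
    show "\<forall>c<n. C c \<noteq> [] \<longrightarrow> (\<exists>q. e c = [q])" using Suc.prems(2) less_SucI by blast
    show "sorted_wrt (<) (concat (map e [0..<n]))" using Suc.prems(3) by (simp add: sorted_wrt_append)
    show "\<forall>c<n. \<forall>c'\<le>c. \<forall>x\<in>set (e c'). \<forall>y\<in>set (C c). x < y" using Suc.prems(4) less_SucI by blast
  qed
  have "keq (C n @ E @ e n) (E @ C n @ e n)"
  proof (cases "C n = []")
    case False
    then obtain q where q: "e n = [q]" using Suc.prems(2) lessI by metis
    have 1: "sorted_wrt (<) (E @ [q])" using Suc.prems(3) q by (simp add: E_def)
    have "x < y" if "x \<in> set (E @ [q])" "y \<in> set (C n)" for x y
    proof -
      have "\<exists>c'\<le>n. x \<in> set (e c')"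
      proof (cases "x = q")
        case True
        thus ?thesis using q by auto
      next
        case False
        hence "x \<in> set E" using that(1) by simp
        then obtain c' where "c' < n" "x \<in> set (e c')" unfolding E_def by auto
        thus ?thesis using less_imp_le by blast
      qed
      thus ?thesis using Suc.prems(4) that(2) lessI by metis
    qed
    thus ?thesis using keq_col_pass_row[OF 1, of "C n"] Suc.prems(1) q by simp
  qed simp
  hence "keq (concat (map C [0..<n]) @ C n @ E @ e n) (concat (map C [0..<n]) @ E @ C n @ e n)"
    by (rule keq_left)
  also have "keq (concat (map C [0..<n]) @ E @ C n @ e n) (concat (map (\<lambda>c. C c @ e c) [0..<n]) @ C n @ e n)"
    using keq_right[OF IH] by simp
  finally show ?case by (simp add: E_def)
qed simp

text \<open>Rows are absorbed from the bottom upwards. When the rows below \<open>k\<close> are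
  already gathered into columns, each column moves right over the entries of row \<open>k\<close>
  until it meets the entry on top of it. This entry exists because a shifted shape contains
  everything above its boxes.\<close>

lemma rows_keq_cols:
  assumes v: "valid Q" and bd: "bounded N Q"
  shows "keq (rows Q 0 N) (cols Q 0 N)"
proof -
  have "keq (rows Q (N - j) N) (concat (map (colge Q (N - j)) [0..<N]))" if "j \<le> N" for j
    using that
  proof (induction j)
    case 0
    have "colge Q N c = []" for c using bd unfolding colge_def bounded_def by (fastforce simp: filter_empty_conv)
    hence z: "concat (map (colge Q N) [0..<N]) = []" by (simp add: concat_eq_Nil_conv)
    show ?case unfolding diff_zero z by (simp add: rows_def)
  next
    case (Suc j)
    define k where "k = N - Suc j"
    have k: "N - j = Suc k" "k < N" using Suc.prems by (auto simp: k_def)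
    have IH: "keq (rows Q (Suc k) N) (concat (map (colge Q (Suc k)) [0..<N]))" using Suc k by simp
    have "rows Q k N = rows Q (Suc k) N @ concat (map (cell Q k) [0..<N])"
      using rows_first[OF k(2)] rowf_cells[OF v bd] by simp
    hence 1: "keq (rows Q k N) (concat (map (colge Q (Suc k)) [0..<N]) @ concat (map (cell Q k) [0..<N]))"
      using keq_right[OF IH] by simp
    have 2: "keq (concat (map (colge Q (Suc k)) [0..<N]) @ concat (map (cell Q k) [0..<N]))
        (concat (map (\<lambda>c. colge Q (Suc k) c @ cell Q k c) [0..<N]))"
    proof (rule keq_zip_cols)
      show "\<forall>c<N. sorted_wrt (>) (colge Q (Suc k) c)"
        using v unfolding valid_def colge_def sorted_wrt_map sorted_wrt_rev by (auto intro: sorted_wrt_filter)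
      show "sorted_wrt (<) (concat (map (cell Q k) [0..<N]))"
        using sorted_rowf[OF v, of k] rowf_cells[OF v bd] by simp
      show "\<forall>c<N. colge Q (Suc k) c \<noteq> [] \<longrightarrow> (\<exists>q. cell Q k c = [q])"
      proof (intro allI impI)
        fix c assume "colge Q (Suc k) c \<noteq> []"
        then obtain p where p: "p \<in> set Q" "snd (snd p) = c" "Suc k \<le> fst (snd p)"
          unfolding colge_def by (auto simp: filter_empty_conv)
        hence "(fst p, fst (snd p), c) \<in> set Q" by auto
        moreover have "k \<le> c" using p valid_le[OF v, of "fst p" "fst (snd p)" c] by auto
        ultimately obtain t' where "(t', k, c) \<in> set Q"
          using valid_down[OF v, of "fst p" "fst (snd p)" c k c] p(3) by auto
        hence "cell Q k c \<noteq> []" using set_cell[of Q k c] by fastforce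
        thus "\<exists>q. cell Q k c = [q]" using cell_length[OF v, of k c] by blast
      qed
      show "\<forall>c<N. \<forall>c'\<le>c. \<forall>x\<in>set (cell Q k c'). \<forall>y\<in>set (colge Q (Suc k) c). x < y"
      proof (intro allI impI ballI)
        fix c c' x y assume *: "c' \<le> c" "x \<in> set (cell Q k c')" "y \<in> set (colge Q (Suc k) c)"
        have x: "(x, k, c') \<in> set Q" using * by (simp add: set_cell)
        obtain r where y: "(y, r, c) \<in> set Q" "Suc k \<le> r" using *(3) by (auto simp: colge_def)
        have "\<not> y < x" using valid_less[OF v y(1) x] y(2) *(1) by auto
        moreover have "x \<noteq> y" using valid_functional[OF v x, of "(r, c)"] y by auto
        ultimately show "x < y" by simp
      qed
    qed
    have 3: "colge Q k = (\<lambda>c. colge Q (Suc k) c @ cell Q k c)" using colge_step[OF v] by blast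
    show ?case using keq_trans[OF 1 2] unfolding 3[symmetric] by (simp add: k_def)
  qed
  from this[of N] have "keq (rows Q 0 N) (concat (map (colge Q 0) [0..<N]))" by simp
  moreover have "colge Q 0 = colf Q" by (rule ext) (simp add: colge_def colf_def)
  ultimately show ?thesis by (simp add: cols_def)
qed

section \<open>Hook statistics of reading words\<close>

lemma hk_mono: "subseq v v' \<Longrightarrow> hk a b v m \<Longrightarrow> hk a b v' m"
proof -
  assume s: "subseq v v'" and "hk a b v m"
  then obtain ds us where P: "hkpair a b v ds us" "length ds + length us = m" by (auto simp: hk_def)
  have "subseq ds v'" "subseq us v'" using P(1) subseq_order.trans[OF _ s] by (auto simp: hkpair_def)
  hence "hkpair a b v' ds us" using P(1) by (simp add: hkpair_def)
  thus "hk a b v' m" using P(2) unfolding hk_def by blast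
qed

lemma sorted_wrt_subseq: "subseq xs ys \<Longrightarrow> sorted_wrt P ys \<Longrightarrow> sorted_wrt P xs"
proof (induction rule: list_emb.induct)
  case (list_emb_Cons2 x y xs ys)
  have "set xs \<subseteq> set ys" using list_emb_Cons2.hyps(2) by (auto elim: list_emb_set)
  thus ?case using list_emb_Cons2 by auto
qed auto

lemma subseq_set: "subseq xs ys \<Longrightarrow> set xs \<subseteq> set ys"
  by (auto elim: list_emb_set)

lemma subseq_ConsD: "subseq xs (y # v) \<Longrightarrow> subseq xs v \<or> (\<exists>xs'. xs = y # xs' \<and> subseq xs' v)"
  by (cases xs) (auto split: if_splits)

text \<open>Expresses the order of letters in the row word through their boxes, so that monotone
  subsequences can be located in the tableau.\<close>

lemma sorted_rows: "valid Q \<Longrightarrow> k \<le> n \<Longrightarrow>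
  sorted_wrt (\<lambda>u v. \<forall>r c r' c'. (u, r, c) \<in> set Q \<longrightarrow> (v, r', c') \<in> set Q \<longrightarrow> r' < r \<or> r' = r \<and> u < v) (rows Q k n)"
proof (induction n)
  case (Suc n)
  show ?case
  proof (cases "k = Suc n")
    case False
    hence k: "k \<le> n" using Suc.prems by simp
    have 1: "sorted_wrt (\<lambda>u v. \<forall>r c r' c'. (u, r, c) \<in> set Q \<longrightarrow> (v, r', c') \<in> set Q \<longrightarrow> r' < r \<or> r' = r \<and> u < v) (rowf Q n)"
    proof (rule sorted_wrt_mono_rel[OF _ sorted_rowf[OF Suc.prems(1)]])
      fix u v assume uv: "u \<in> set (rowf Q n)" "v \<in> set (rowf Q n)" "u < v"
      obtain c0 c0' where "(u, n, c0) \<in> set Q" "(v, n, c0') \<in> set Q" using uv by (auto simp: set_rowf)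
      thus "\<forall>r c r' c'. (u, r, c) \<in> set Q \<longrightarrow> (v, r', c') \<in> set Q \<longrightarrow> r' < r \<or> r' = r \<and> u < v"
        using valid_functional[OF Suc.prems(1)] uv(3) by blast
    qed
    have 2: "\<forall>r c r' c'. (u, r, c) \<in> set Q \<longrightarrow> (v, r', c') \<in> set Q \<longrightarrow> r' < r \<or> r' = r \<and> u < v"
      if uQ: "u \<in> set (rowf Q n)" and vQ: "v \<in> set (rows Q k n)" for u v
    proof -
      obtain c0 where "(u, n, c0) \<in> set Q" using uQ by (auto simp: set_rowf)
      moreover obtain r0 c0' where "(v, r0, c0') \<in> set Q" "r0 < n" using vQ by (auto simp: set_rows)
      ultimately show ?thesis using valid_functional[OF Suc.prems(1)] by blast
    qed
    show ?thesis using Suc.IH[OF Suc.prems(1) k] 1 2 by (simp add: rows_last[OF k] sorted_wrt_append)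
  qed (simp add: rows_def)
qed (simp add: rows_def)

lemma sorted_cols: "valid Q \<Longrightarrow>
  sorted_wrt (\<lambda>u v. \<forall>r c r' c'. (u, r, c) \<in> set Q \<longrightarrow> (v, r', c') \<in> set Q \<longrightarrow> c < c' \<or> c' = c \<and> v < u) (cols Q 0 n)"
proof (induction n)
  case (Suc n)
  have 1: "sorted_wrt (\<lambda>u v. \<forall>r c r' c'. (u, r, c) \<in> set Q \<longrightarrow> (v, r', c') \<in> set Q \<longrightarrow> c < c' \<or> c' = c \<and> v < u) (colf Q n)"
  proof (rule sorted_wrt_mono_rel[OF _ sorted_colf[OF Suc.prems]])
    fix u v assume uv: "u \<in> set (colf Q n)" "v \<in> set (colf Q n)" "v < u"
    obtain c0 c0' where "(u, c0, n) \<in> set Q" "(v, c0', n) \<in> set Q" using uv by (auto simp: set_colf)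
    thus "\<forall>r c r' c'. (u, r, c) \<in> set Q \<longrightarrow> (v, r', c') \<in> set Q \<longrightarrow> c < c' \<or> c' = c \<and> v < u"
      using valid_functional[OF Suc.prems] uv(3) by blast
  qed
  have 2: "\<forall>r c r' c'. (u, r, c) \<in> set Q \<longrightarrow> (v, r', c') \<in> set Q \<longrightarrow> c < c' \<or> c' = c \<and> v < u"
    if vQ: "v \<in> set (colf Q n)" and uQ: "u \<in> set (cols Q 0 n)" for u v
  proof -
    obtain c0 where "(v, c0, n) \<in> set Q" using vQ by (auto simp: set_colf)
    moreover obtain r0 c0' where "(u, r0, c0') \<in> set Q" "c0' < n" using uQ by (auto simp: set_cols)
    ultimately show ?thesis using valid_functional[OF Suc.prems] by blast
  qed
  show ?case using Suc.IH[OF Suc.prems] 1 2 by (simp add: cols_last sorted_wrt_append)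
qed (simp add: cols_def)

lemma sorted_wrt_conj: "sorted_wrt P xs \<Longrightarrow> sorted_wrt Q xs \<Longrightarrow> sorted_wrt (\<lambda>x y. P x y \<and> Q x y) xs"
  by (induction xs) auto

text \<open>Unspecified unless \<open>t\<close> occurs in \<open>Q\<close>.\<close>

definition rowof :: "tlist \<Rightarrow> nat \<Rightarrow> nat" where "rowof Q t = fst (the (map_of Q t))"
definition colof :: "tlist \<Rightarrow> nat \<Rightarrow> nat" where "colof Q t = snd (the (map_of Q t))"

lemma rowof_colof: "valid Q \<Longrightarrow> (t, r, c) \<in> set Q \<Longrightarrow> rowof Q t = r \<and> colof Q t = c"
  using map_of_is_SomeI[of Q t "(r, c)"] valid_distinct[of Q] by (simp add: rowof_def colof_def)

lemma card_strict_map: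
  fixes f :: "nat \<Rightarrow> nat"
  shows "sorted_wrt (\<lambda>x y. f x < f y) xs \<Longrightarrow> card (f ` set xs) = length xs"
    and "sorted_wrt (\<lambda>x y. f y < f x) xs \<Longrightarrow> card (f ` set xs) = length xs"
proof -
  assume "sorted_wrt (\<lambda>x y. f x < f y) xs"
  hence "distinct (map f xs)" by (induction xs) auto
  thus "card (f ` set xs) = length xs" by (metis distinct_card length_map set_map)
next
  assume "sorted_wrt (\<lambda>x y. f y < f x) xs"
  hence "distinct (map f xs)" by (induction xs) auto
  thus "card (f ` set xs) = length xs" by (metis distinct_card length_map set_map)
qed

text \<open>A decreasing subsequence of the row word has its entries in distinct rows, an increasing
  one in distinct columns, and all lie in the columns where row \<open>k\<close> has an entry less
  than \<open>b\<close>. Moreover, the increasing entries avoid the first \<open>length ds\<close>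
  of these columns, so that both parts together fit into the count.\<close>

lemma hk_rows_le:
  assumes v: "valid Q" and P: "hkpair a b (rows Q k n) ds us" and kn: "k \<le> n"
  shows "length ds + length us \<le> length (filter (\<lambda>t. t < b) (rowf Q k))"
proof -
  define F where "F = filter (\<lambda>t. t < b) (rowf Q k)"
  define A where "A = colof Q ` set F"
  have F: "t \<in> set F \<longleftrightarrow> (\<exists>c. (t, k, c) \<in> set Q) \<and> t < b" for t by (auto simp: F_def set_rowf)
  have Fin: "(t, k, colof Q t) \<in> set Q" if tF: "t \<in> set F" for t
  proof -
    obtain c0 where "(t, k, c0) \<in> set Q" using F tF by blast
    thus ?thesis using rowof_colof[OF v, of t k c0] by simp
  qed
  have Ain: "c \<in> A \<longleftrightarrow> (\<exists>t. (t, k, c) \<in> set Q \<and> t < b)" for c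
  proof
    assume "c \<in> A"
    thus "\<exists>t. (t, k, c) \<in> set Q \<and> t < b" using Fin F unfolding A_def by blast
  next
    assume "\<exists>t. (t, k, c) \<in> set Q \<and> t < b"
    then obtain t where t: "(t, k, c) \<in> set Q" "t < b" by blast
    have "t \<in> set F" using F t by blast
    moreover have "colof Q t = c" using rowof_colof[OF v t(1)] by simp
    ultimately show "c \<in> A" unfolding A_def by blast
  qed
  have "inj_on (colof Q) (set F)"
  proof (rule inj_onI)
    fix x y assume xy: "x \<in> set F" "y \<in> set F" "colof Q x = colof Q y"
    then obtain c where c: "(x, k, c) \<in> set Q" "(y, k, c) \<in> set Q" using Fin by metis
    thus "x = y" using valid_less[OF v c] valid_less[OF v c(2,1)] by force
  qed
  moreover have "distinct F" using sorted_rowf[OF v, of k] by (simp add: F_def strict_sorted_iff)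
  ultimately have cA: "card A = length F" by (simp add: A_def card_image distinct_card)
  have dn: "\<forall>c\<in>A. \<forall>c'. k \<le> c' \<and> c' \<le> c \<longrightarrow> c' \<in> A"
  proof (intro ballI allI impI)
    fix c c' assume cA: "c \<in> A" and kc: "k \<le> c' \<and> c' \<le> c"
    obtain t where t: "(t, k, c) \<in> set Q" "t < b" using cA unfolding Ain by blast
    obtain t' where "(t', k, c') \<in> set Q" "t' \<le> t" using valid_down[OF v t(1), of k c'] kc by auto
    thus "c' \<in> A" unfolding Ain using t by (meson le_less_trans)
  qed
  have "finite A" by (simp add: A_def)
  have Alt: "c < k + length F" if "c \<in> A" for c
  proof -
    have "k \<le> c" using that valid_le[OF v] unfolding Ain by blast
    have "{k..c} \<subseteq> A" using dn that by auto
    hence "card {k..c} \<le> card A" using \<open>finite A\<close> by (rule card_mono[rotated])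
    thus ?thesis using cA \<open>k \<le> c\<close> by simp
  qed
  have inQ: "\<exists>r c. (t, r, c) \<in> set Q \<and> k \<le> r \<and> r \<le> c \<and> c < k + length F \<and> rowof Q t = r \<and> colof Q t = c"
    if "t \<in> set ds \<union> set us" for t
  proof -
    have "t \<in> set (rows Q k n)" "t < b" using P that subseq_set unfolding hkpair_def by blast+
    then obtain r c where t: "(t, r, c) \<in> set Q" "k \<le> r" by (auto simp: set_rows)
    have rc: "r \<le> c" using valid_le[OF v t(1)] .
    obtain t' where "(t', k, c) \<in> set Q" "t' \<le> t" using valid_down[OF v t(1), of k c] t(2) rc by auto
    hence "c \<in> A" unfolding Ain using \<open>t < b\<close> by (meson le_less_trans)
    thus ?thesis using Alt t rc rowof_colof[OF v t(1)] by blast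
  qed
  note SR = sorted_rows[OF v kn]
  have "sorted_wrt (\<lambda>x y. rowof Q y < rowof Q x) ds"
  proof (rule sorted_wrt_mono_rel)
    show "sorted_wrt (\<lambda>u v. (\<forall>r c r' c'. (u, r, c) \<in> set Q \<longrightarrow> (v, r', c') \<in> set Q \<longrightarrow> r' < r \<or> r' = r \<and> u < v) \<and> u > v) ds"
      using P SR unfolding hkpair_def by (intro sorted_wrt_conj) (auto intro: sorted_wrt_subseq)
    fix x y assume *: "x \<in> set ds" "y \<in> set ds"
      "(\<forall>r c r' c'. (x, r, c) \<in> set Q \<longrightarrow> (y, r', c') \<in> set Q \<longrightarrow> r' < r \<or> r' = r \<and> x < y) \<and> x > y"
    thus "rowof Q y < rowof Q x" using inQ[of x] inQ[of y] by (metis UnI1 less_asym)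
  qed
  hence cd: "card (rowof Q ` set ds) = length ds" by (rule card_strict_map)
  have "sorted_wrt (\<lambda>x y. colof Q x < colof Q y) us"
  proof (rule sorted_wrt_mono_rel)
    show "sorted_wrt (\<lambda>u v. (\<forall>r c r' c'. (u, r, c) \<in> set Q \<longrightarrow> (v, r', c') \<in> set Q \<longrightarrow> r' < r \<or> r' = r \<and> u < v) \<and> u < v) us"
      using P SR unfolding hkpair_def by (intro sorted_wrt_conj) (auto intro: sorted_wrt_subseq)
    fix x y assume *: "x \<in> set us" "y \<in> set us"
      "(\<forall>r c r' c'. (x, r, c) \<in> set Q \<longrightarrow> (y, r', c') \<in> set Q \<longrightarrow> r' < r \<or> r' = r \<and> x < y) \<and> x < y"
    obtain r c r' c' where x: "(x, r, c) \<in> set Q" "colof Q x = c" and y: "(y, r', c') \<in> set Q" "colof Q y = c'"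
      using inQ[of x] inQ[of y] * by blast
    hence "r' \<le> r" using * by force
    thus "colof Q x < colof Q y" using valid_less[OF v x(1) y(1)] * x(2) y(2) by auto
  qed
  hence cu: "card (colof Q ` set us) = length us" by (rule card_strict_map)
  have "rowof Q ` set ds \<subseteq> {k..<k + length F}" using inQ by fastforce
  hence "card (rowof Q ` set ds) \<le> card {k..<k + length F}" by (intro card_mono) auto
  hence ld: "length ds \<le> length F" using cd by simp
  have "colof Q ` set us \<subseteq> {k + length ds..<k + length F}"
  proof
    fix c assume "c \<in> colof Q ` set us"
    then obtain u where u: "u \<in> set us" "c = colof Q u" by blast
    then obtain r where r: "(u, r, c) \<in> set Q" "r \<le> c" "c < k + length F" "k \<le> r" using inQ[of u] by blast
    \<comment> \<open>Otherwise the distinct rows of \<open>ds\<close> do not all fit between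
      \<open>k\<close> and \<open>c\<close>. An entry of \<open>ds\<close> in row \<open>c\<close>
      or lower is also in column \<open>c\<close> or further right, hence weakly below and right of
      \<open>u\<close>, and cannot be smaller than \<open>u\<close>.\<close>
    have "k + length ds \<le> c"
    proof (rule ccontr)
      assume lt: "\<not> k + length ds \<le> c"
      have "\<not> rowof Q ` set ds \<subseteq> {k..<c}"
      proof
        assume "rowof Q ` set ds \<subseteq> {k..<c}"
        hence "card (rowof Q ` set ds) \<le> card {k..<c}" by (intro card_mono) auto
        thus False using cd lt r(2,4) by simp
      qed
      then obtain d where d: "d \<in> set ds" "\<not> (k \<le> rowof Q d \<and> rowof Q d < c)"
        unfolding image_subset_iff atLeastLessThan_iff by blast
      then obtain r' c' where d': "(d, r', c') \<in> set Q" "k \<le> r'" "r' \<le> c'" "rowof Q d = r'" using inQ[of d] by blast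
      hence "c \<le> r'" using d by auto
      moreover have "d < u" using P d(1) u(1) by (simp add: hkpair_def)
      ultimately show False using valid_less[OF v d'(1) r(1)] r(2) d'(3) by auto
    qed
    thus "c \<in> {k + length ds..<k + length F}" using r by simp
  qed
  hence "card (colof Q ` set us) \<le> card {k + length ds..<k + length F}" by (intro card_mono) auto
  hence "length us \<le> length F - length ds" using cu by simp
  thus ?thesis using ld by (simp add: F_def)
qed

text \<open>Since the diagonal box \<open>(d, d)\<close> is filled, column \<open>d\<close> has all
  rows from \<open>0\<close> to \<open>d\<close>, and its entries greater than \<open>a\<close> fill
  the lowest \<open>s\<close> of them. If \<open>c\<close> is the column of the first increasing
  entry, the columns of the increasing part lie in \<open>{c..d}\<close> and the rows of the
  decreasing part in \<open>{Suc d - s..<c}\<close>, which adds up to at most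
  \<open>s\<close>.\<close>

lemma hk_cols_le:
  assumes v: "valid Q" and td: "(td, d, d) \<in> set Q" and P: "hkpair a b (cols Q 0 (Suc d)) ds us"
  shows "length ds + length us \<le> length (filter (\<lambda>t. a < t) (colf Q d))"
proof -
  define F where "F = filter (\<lambda>t. a < t) (colf Q d)"
  define s where "s = length F"
  define A where "A = rowof Q ` set F"
  have F: "t \<in> set F \<longleftrightarrow> (\<exists>r. (t, r, d) \<in> set Q) \<and> a < t" for t by (auto simp: F_def set_colf)
  have Fin: "(t, rowof Q t, d) \<in> set Q" if tF: "t \<in> set F" for t
  proof -
    obtain c0 where "(t, c0, d) \<in> set Q" using F tF by blast
    thus ?thesis using rowof_colof[OF v, of t c0 d] by simp
  qed
  have Ain: "r \<in> A \<longleftrightarrow> (\<exists>t. (t, r, d) \<in> set Q \<and> a < t)" for r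
  proof
    assume "r \<in> A"
    thus "\<exists>t. (t, r, d) \<in> set Q \<and> a < t" using Fin F unfolding A_def by blast
  next
    assume "\<exists>t. (t, r, d) \<in> set Q \<and> a < t"
    then obtain t where t: "(t, r, d) \<in> set Q" "a < t" by blast
    have "t \<in> set F" using F t by blast
    moreover have "rowof Q t = r" using rowof_colof[OF v t(1)] by simp
    ultimately show "r \<in> A" unfolding A_def by blast
  qed
  have "inj_on (rowof Q) (set F)"
  proof (rule inj_onI)
    fix x y assume xy: "x \<in> set F" "y \<in> set F" "rowof Q x = rowof Q y"
    then obtain c where c: "(x, c, d) \<in> set Q" "(y, c, d) \<in> set Q" using Fin by metis
    thus "x = y" using valid_less[OF v c] valid_less[OF v c(2,1)] by force
  qed
  moreover have "distinct F" using valid_distinct[OF v] by (simp add: F_def colf_def distinct_map_filter)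
  ultimately have cA: "card A = s" by (simp add: A_def card_image distinct_card s_def)
  have "finite A" by (simp add: A_def)
  have up: "r' \<in> A" if rA: "r \<in> A" and rr: "r \<le> r'" "r' \<le> d" for r r'
  proof -
    obtain t where t: "(t, r, d) \<in> set Q" "a < t" using rA unfolding Ain by blast
    obtain t' where t': "(t', r', d) \<in> set Q" using valid_down[OF v td, of r' d] rr(2) by auto
    have "\<not> t' < t" using valid_less[OF v t' t(1)] rr(1) by auto
    thus ?thesis unfolding Ain using t t' by (meson less_le_trans not_le)
  qed
  have Ale: "r \<le> d \<and> Suc d \<le> r + s" if "r \<in> A" for r
  proof -
    have rd: "r \<le> d" using that valid_le[OF v] unfolding Ain by blast
    have "{r..d} \<subseteq> A" using up that by auto
    hence "card {r..d} \<le> card A" using \<open>finite A\<close> by (rule card_mono[rotated])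
    thus ?thesis using cA rd by simp
  qed
  have inQ: "\<exists>r c. (t, r, c) \<in> set Q \<and> r \<le> c \<and> c \<le> d \<and> r \<in> A \<and> rowof Q t = r \<and> colof Q t = c"
    if "t \<in> set ds \<union> set us" for t
  proof -
    have "t \<in> set (cols Q 0 (Suc d))" "a < t" using P that subseq_set unfolding hkpair_def by blast+
    then obtain r c where t: "(t, r, c) \<in> set Q" "c \<le> d" by (auto simp: set_cols)
    have rc: "r \<le> c" using valid_le[OF v t(1)] .
    obtain t' where t': "(t', r, d) \<in> set Q" using valid_down[OF v td, of r d] t(2) rc by auto
    have "\<not> t' < t" using valid_less[OF v t' t(1)] t(2) by auto
    hence "r \<in> A" unfolding Ain using \<open>a < t\<close> t' by (meson less_le_trans not_le)
    thus ?thesis using t rc rowof_colof[OF v t(1)] by blast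
  qed
  note SC = sorted_cols[OF v, of "Suc d"]
  have "sorted_wrt (\<lambda>x y. rowof Q y < rowof Q x) ds"
  proof (rule sorted_wrt_mono_rel)
    show "sorted_wrt (\<lambda>u v. (\<forall>r c r' c'. (u, r, c) \<in> set Q \<longrightarrow> (v, r', c') \<in> set Q \<longrightarrow> c < c' \<or> c' = c \<and> v < u) \<and> u > v) ds"
      using P SC unfolding hkpair_def by (intro sorted_wrt_conj) (auto intro: sorted_wrt_subseq)
    fix x y assume *: "x \<in> set ds" "y \<in> set ds"
      "(\<forall>r c r' c'. (x, r, c) \<in> set Q \<longrightarrow> (y, r', c') \<in> set Q \<longrightarrow> c < c' \<or> c' = c \<and> y < x) \<and> x > y"
    obtain r c r' c' where x: "(x, r, c) \<in> set Q" "rowof Q x = r" and y: "(y, r', c') \<in> set Q" "rowof Q y = r'"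
      using inQ[of x] inQ[of y] * by blast
    hence "c \<le> c'" using * by force
    thus "rowof Q y < rowof Q x" using valid_less[OF v y(1) x(1)] * x(2) y(2) by auto
  qed
  hence cd: "card (rowof Q ` set ds) = length ds" by (rule card_strict_map)
  have su: "sorted_wrt (\<lambda>x y. colof Q x < colof Q y) us"
  proof (rule sorted_wrt_mono_rel)
    show "sorted_wrt (\<lambda>u v. (\<forall>r c r' c'. (u, r, c) \<in> set Q \<longrightarrow> (v, r', c') \<in> set Q \<longrightarrow> c < c' \<or> c' = c \<and> v < u) \<and> u < v) us"
      using P SC unfolding hkpair_def by (intro sorted_wrt_conj) (auto intro: sorted_wrt_subseq)
    fix x y assume *: "x \<in> set us" "y \<in> set us"
      "(\<forall>r c r' c'. (x, r, c) \<in> set Q \<longrightarrow> (y, r', c') \<in> set Q \<longrightarrow> c < c' \<or> c' = c \<and> y < x) \<and> x < y"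
    thus "colof Q x < colof Q y" using inQ[of x] inQ[of y] by (metis UnI2 less_asym)
  qed
  hence cu: "card (colof Q ` set us) = length us" by (rule card_strict_map)
  show ?thesis
  proof (cases us)
    case Nil
    have "rowof Q ` set ds \<subseteq> A" using inQ by fastforce
    hence "card (rowof Q ` set ds) \<le> card A" using \<open>finite A\<close> by (intro card_mono) auto
    thus ?thesis using cd cA Nil by (simp add: s_def F_def)
  next
    case (Cons i us')
    obtain r c where i: "(i, r, c) \<in> set Q" "r \<le> c" "c \<le> d" "r \<in> A" "colof Q i = c"
      using inQ[of i] Cons by auto
    have "colof Q ` set us \<subseteq> {c..d}"
    proof
      fix x assume "x \<in> colof Q ` set us"
      then obtain u where u: "u \<in> set us" "x = colof Q u" by blast
      have "c \<le> x" using su u i(5) Cons by auto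
      moreover have "x \<le> d" using inQ[of u] u by auto
      ultimately show "x \<in> {c..d}" by simp
    qed
    hence "card (colof Q ` set us) \<le> card {c..d}" by (intro card_mono) auto
    hence lu: "length us \<le> Suc d - c" using cu by simp
    have "rowof Q ` set ds \<subseteq> {Suc d - s..<c}"
    proof
      fix x assume "x \<in> rowof Q ` set ds"
      then obtain e where e: "e \<in> set ds" "x = rowof Q e" by blast
      then obtain c' where c': "(e, x, c') \<in> set Q" "x \<le> c'" "x \<in> A" using inQ[of e] by blast
      have "e < i" using P e Cons by (simp add: hkpair_def)
      hence "\<not> (c \<le> x)" using valid_less[OF v c'(1) i(1)] i(2) c'(2) by auto
      moreover have "Suc d - s \<le> x" using Ale[OF c'(3)] by (simp add: le_diff_conv)
      ultimately show "x \<in> {Suc d - s..<c}" by simp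
    qed
    hence "card (rowof Q ` set ds) \<le> card {Suc d - s..<c}" by (intro card_mono) auto
    hence ld: "length ds \<le> c - (Suc d - s)" using cd by simp
    have "Suc d - s \<le> c" using Ale[OF i(4)] i(2) unfolding le_diff_conv by linarith
    hence "length ds + length us \<le> s" using lu ld i(3) by linarith
    thus ?thesis by (simp add: s_def F_def)
  qed
qed

section \<open>Cyclic moves of an extreme letter\<close>

lemma hkI: "hkpair a b v ds us \<Longrightarrow> hk a b v (length ds + length us)"
  unfolding hk_def by blast

lemma hk_1: "a < y \<Longrightarrow> y < b \<Longrightarrow> y \<in> set v \<Longrightarrow> hk a b v (Suc 0)"
  unfolding hk_def hkpair_def
  by (rule exI[of _ "[y]"], rule exI[of _ "[]"]) (simp add: subseq_singleton_left)

lemma subseq_take: "subseq (take m xs) xs"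
  by (metis append_take_drop_id list_emb_prefix subseq_order.order_refl)

lemma hkE:
  assumes "hk a b v m"
  obtains ds us where "hkpair a b v ds us" "length ds + length us = m"
  using assms by (auto simp: hk_def)

lemma subseq_filter: "subseq (filter P xs) xs"
  by (induction xs) auto

text \<open>At the end of the word, the minimum \<open>y\<close> may complete a decreasing part that
  has an increasing part above it; at the front it can only be followed by an increasing sequence.
  No length is lost: by \<open>hk_rows_le\<close>, row \<open>k\<close> has at least as many entries
  less than \<open>b\<close> as the rest of the selection, and they form an increasing sequence
  behind \<open>y\<close>.\<close>

lemma heq_cycle_min:
  assumes v: "valid Q" and k: "k < n" and y: "\<forall>x\<in>set (rows Q k n). y < x"
  shows "heq (rows Q k n @ [y]) (y # rows Q k n)"
proof -
  define B where "B = rows Q k n"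
  have yB: "\<And>x. x \<in> set B \<Longrightarrow> y < x" using y by (simp add: B_def)
  have subB: "subseq B (y # B)" by auto
  have row: "subseq (rowf Q k) B" unfolding B_def rows_first[OF k] by (simp add: list_emb_append2)
  have "hk a b (y # B) m" if h: "hk a b (B @ [y]) m" for a b m
  proof -
    consider "hk a b B m" | m' where "a < y" "y < b" "m = Suc m'" "hk a y B m'"
      | m' where "a < y" "y < b" "m = Suc m'" "hk y b B m'"
      using h unfolding hk_snoc by blast
    thus ?thesis
    proof cases
      case 1
      thus ?thesis by (rule hk_mono[OF subB])
    next
      case 2
      obtain ds us where P: "hkpair a y B ds us" "length ds + length us = m'" using 2(4) by (rule hkE)
      have "e < y" "y < e" if "e \<in> set ds \<union> set us" for e
        using P(1) that yB subseq_set unfolding hkpair_def by blast+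
      hence "ds = [] \<and> us = []" by (cases ds; cases us; force)
      hence "m' = 0" using P(2) by simp
      thus ?thesis using 2 hk_1[of a y b "y # B"] by simp
    next
      case 3
      define R where "R = filter (\<lambda>t. t < b) (rowf Q k)"
      obtain ds us where "hkpair y b (rows Q k n) ds us" "length ds + length us = m'"
        using 3(4) unfolding B_def by (rule hkE)
      hence m': "m' \<le> length R" using hk_rows_le[OF v] k unfolding R_def by fastforce
      have sR: "subseq (take m' R) B" using subseq_take subseq_filter row unfolding R_def
        by (meson subseq_order.order_trans)
      have "sorted_wrt (<) R" unfolding R_def using sorted_rowf[OF v] by (rule sorted_wrt_filter)
      hence "sorted_wrt (<) (take m' R)" by (rule sorted_wrt_take)
      moreover have "\<forall>x\<in>set (take m' R). y < x" using subseq_set[OF sR] yB by blast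
      moreover have "\<forall>x\<in>set (take m' R). x < b" by (auto simp: R_def dest: in_set_takeD)
      ultimately have "hkpair a b (y # B) [] (y # take m' R)"
        using sR 3(1,2) by (auto simp: hkpair_def intro: less_trans)
      moreover have "length [] + length (y # take m' R) = m" using 3(3) m' by simp
      ultimately show ?thesis unfolding hk_def by blast
    qed
  qed
  moreover have "hk a b (B @ [y]) m" if h: "hk a b (y # B) m" for a b m
  proof -
    obtain ds us where P: "hkpair a b (y # B) ds us" "length ds + length us = m" using h by (rule hkE)
    have ge: "y \<le> e" if "e \<in> set ds \<union> set us" for e
    proof -
      have "set ds \<subseteq> set (y # B)" "set us \<subseteq> set (y # B)"
        using P(1) subseq_set[of ds "y # B"] subseq_set[of us "y # B"] by (simp_all add: hkpair_def)
      hence "e = y \<or> e \<in> set B" using that by auto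
      thus ?thesis using yB less_imp_le by blast
    qed
    have sub: "subseq ds (y # B)" "subseq us (y # B)" using P(1) by (simp_all add: hkpair_def)
    note D = subseq_ConsD[OF sub(1)] and U = subseq_ConsD[OF sub(2)]
    consider "subseq ds B" "subseq us B" | ds' where "ds = y # ds'" | us' where "us = y # us'" "subseq us' B"
      using D U by blast
    thus ?thesis
    proof cases
      case 1
      hence "hkpair a b B ds us" using P(1) by (simp add: hkpair_def)
      hence "hk a b B m" using P(2) unfolding hk_def by blast
      thus ?thesis by (simp add: hk_snoc)
    next
      case 2
      have ay: "a < y \<and> y < b" using P(1) 2 by (simp add: hkpair_def)
      have "ds' = []"
      proof (rule ccontr)
        assume "ds' \<noteq> []"
        then obtain e where e: "e \<in> set ds'" by (cases ds') auto
        hence "e < y" using P(1) 2 by (simp add: hkpair_def)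
        thus False using ge[of e] e 2 by simp
      qed
      moreover have gu: "\<forall>u\<in>set us. y < u" using P(1) 2 by (simp add: hkpair_def)
      hence "subseq us B" using U by (metis less_irrefl list.set_intros(1))
      hence "hkpair y b B [] us" using P(1) gu by (simp add: hkpair_def)
      hence "hk y b B (length us)" using hkI by fastforce
      moreover have "m = Suc (length us)" using P(2) 2 calculation(1) by simp
      ultimately show ?thesis unfolding hk_snoc using ay by blast
    next
      case 3
      have ay: "a < y \<and> y < b" using P(1) 3 by (simp add: hkpair_def)
      have "ds = []"
      proof (rule ccontr)
        assume "ds \<noteq> []"
        then obtain e where e: "e \<in> set ds" by (cases ds) auto
        hence "e < y" using P(1) 3 by (simp add: hkpair_def)
        thus False using ge[of e] e by simp
      qed
      moreover have "hkpair y b B [] us'" using P(1) 3 by (simp add: hkpair_def)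
      hence "hk y b B (length us')" using hkI by fastforce
      moreover have "m = Suc (length us')" using P(2) 3 calculation(1) by simp
      ultimately show ?thesis unfolding hk_snoc using ay by blast
    qed
  qed
  ultimately show ?thesis unfolding heq_def B_def by blast
qed

text \<open>The dual argument: the entries of the last column, read upwards, form a decreasing
  sequence that may follow the maximum \<open>y\<close>, and \<open>hk_cols_le\<close> shows that
  there are enough of them. This is where the column has to reach the diagonal.\<close>

lemma heq_cycle_max:
  assumes v: "valid Q" and td: "(td, d, d) \<in> set Q" and y: "\<forall>x\<in>set (cols Q 0 (Suc d)). x < y"
  shows "heq (y # cols Q 0 (Suc d)) (cols Q 0 (Suc d) @ [y])"
proof -
  define C where "C = cols Q 0 (Suc d)"
  have yC: "\<And>x. x \<in> set C \<Longrightarrow> x < y" using y by (simp add: C_def)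
  have subC: "subseq C (y # C)" by auto
  have col: "subseq (colf Q d) C" unfolding C_def by (simp add: cols_last list_emb_append2)
  have "hk a b (y # C) m" if h: "hk a b (C @ [y]) m" for a b m
  proof -
    consider "hk a b C m" | m' where "a < y" "y < b" "m = Suc m'" "hk y b C m'"
      | m' where "a < y" "y < b" "m = Suc m'" "hk a y C m'"
      using h unfolding hk_snoc by blast
    thus ?thesis
    proof cases
      case 1
      thus ?thesis by (rule hk_mono[OF subC])
    next
      case 2
      obtain ds us where P: "hkpair y b C ds us" "length ds + length us = m'" using 2(4) by (rule hkE)
      have "e < y" "y < e" if "e \<in> set ds \<union> set us" for e
        using P(1) that yC subseq_set unfolding hkpair_def by blast+
      hence "ds = [] \<and> us = []" by (cases ds; cases us; force)
      hence "m' = 0" using P(2) by simp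
      thus ?thesis using 2 hk_1[of a y b "y # C"] by simp
    next
      case 3
      define R where "R = filter (\<lambda>t. a < t) (colf Q d)"
      obtain ds us where "hkpair a y (cols Q 0 (Suc d)) ds us" "length ds + length us = m'"
        using 3(4) unfolding C_def by (rule hkE)
      hence m': "m' \<le> length R" using hk_cols_le[OF v td] unfolding R_def by fastforce
      have sR: "subseq (take m' R) C" using subseq_take subseq_filter col unfolding R_def
        by (meson subseq_order.order_trans)
      have "sorted_wrt (>) R" unfolding R_def using sorted_colf[OF v] by (rule sorted_wrt_filter)
      hence "sorted_wrt (>) (take m' R)" by (rule sorted_wrt_take)
      moreover have "\<forall>x\<in>set (take m' R). x < y" using subseq_set[OF sR] yC by blast
      moreover have "\<forall>x\<in>set (take m' R). a < x" by (auto simp: R_def dest: in_set_takeD)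
      ultimately have "hkpair a b (y # C) (y # take m' R) []"
        using sR 3(1,2) by (auto simp: hkpair_def intro: less_trans)
      moreover have "length (y # take m' R) + length [] = m" using 3(3) m' by simp
      ultimately show ?thesis unfolding hk_def by blast
    qed
  qed
  moreover have "hk a b (C @ [y]) m" if h: "hk a b (y # C) m" for a b m
  proof -
    obtain ds us where P: "hkpair a b (y # C) ds us" "length ds + length us = m" using h by (rule hkE)
    have ge: "e \<le> y" if "e \<in> set ds \<union> set us" for e
    proof -
      have "set ds \<subseteq> set (y # C)" "set us \<subseteq> set (y # C)"
        using P(1) subseq_set[of ds "y # C"] subseq_set[of us "y # C"] by (simp_all add: hkpair_def)
      hence "e = y \<or> e \<in> set C" using that by auto
      thus ?thesis using yC less_imp_le by blast
    qed
    have sub: "subseq ds (y # C)" "subseq us (y # C)" using P(1) by (simp_all add: hkpair_def)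
    note D = subseq_ConsD[OF sub(1)] and U = subseq_ConsD[OF sub(2)]
    consider "subseq ds C" "subseq us C" | us' where "us = y # us'" | ds' where "ds = y # ds'" "subseq ds' C"
      using D U by blast
    thus ?thesis
    proof cases
      case 1
      hence "hkpair a b C ds us" using P(1) by (simp add: hkpair_def)
      hence "hk a b C m" using P(2) unfolding hk_def by blast
      thus ?thesis by (simp add: hk_snoc)
    next
      case 2
      have ay: "a < y \<and> y < b" using P(1) 2 by (simp add: hkpair_def)
      have "us' = []"
      proof (rule ccontr)
        assume "us' \<noteq> []"
        then obtain e where e: "e \<in> set us'" by (cases us') auto
        hence "y < e" using P(1) 2 by (simp add: hkpair_def)
        thus False using ge[of e] e 2 by simp
      qed
      moreover have gu: "\<forall>u\<in>set ds. u < y" using P(1) 2 by (simp add: hkpair_def)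
      hence "subseq ds C" using D by (metis less_irrefl list.set_intros(1))
      hence "hkpair a y C ds []" using P(1) gu by (simp add: hkpair_def)
      hence "hk a y C (length ds)" using hkI by fastforce
      moreover have "m = Suc (length ds)" using P(2) 2 calculation(1) by simp
      ultimately show ?thesis unfolding hk_snoc using ay by blast
    next
      case 3
      have ay: "a < y \<and> y < b" using P(1) 3 by (simp add: hkpair_def)
      have "us = []"
      proof (rule ccontr)
        assume "us \<noteq> []"
        then obtain e where e: "e \<in> set us" by (cases us) auto
        hence "y < e" using P(1) 3 by (simp add: hkpair_def)
        thus False using ge[of e] e by simp
      qed
      moreover have "hkpair a y C ds' []" using P(1) 3 by (simp add: hkpair_def)
      hence "hk a y C (length ds')" using hkI by fastforce
      moreover have "m = Suc (length ds')" using P(2) 3 calculation(1) by simp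
      ultimately show ?thesis unfolding hk_snoc using ay by blast
    qed
  qed
  ultimately show ?thesis unfolding heq_def C_def by blast
qed

section \<open>Sagan-Worley insertion and reading words\<close>

lemma sw_notin: "b \<notin> snd ` set X \<Longrightarrow> sw S b m X = X"
  by (induction S b m X rule: sw.induct) auto

lemma sw_append:
  assumes "b \<notin> snd ` set X1"
  shows "sw S b m (X1 @ (t, b) # X2) =
    X1 @ (t, nxt (insert b (S \<union> set (map snd X1))) b m) #
    sw (insert b (S \<union> set (map snd X1))) (nxt (insert b (S \<union> set (map snd X1))) b m) (m \<or> fst b = snd b) X2"
  using assms
proof (induction X1 arbitrary: S)
  case (Cons e X1)
  obtain t' c where e: "e = (t', c)" by (cases e)
  have "c \<noteq> b" "b \<notin> snd ` set X1" using Cons.prems e by auto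
  thus ?case using Cons.IH[of "insert c S"] e by simp
qed simp

lemma sw_boxes: "snd ` set X \<subseteq> insert b (snd ` set (sw S b m X))"
  by (induction S b m X rule: sw.induct) auto

text \<open>The entry \<open>x\<close> is to be placed in box \<open>b\<close>; \<open>pre\<close> holds the smaller and \<open>post\<close> the larger entries.\<close>

definition entering :: "tlist \<Rightarrow> nat \<Rightarrow> nat \<times> nat \<Rightarrow> tlist \<Rightarrow> bool" where
  "entering pre x b post \<longleftrightarrow> chain {} (map snd (pre @ post)) \<and>
     sorted_wrt (<) (map fst pre @ x # map fst post) \<and> addable (set (map snd pre)) b"

lemma entering_valid:
  assumes "entering pre x b post"
  shows "valid (pre @ post)" "chain (set (map snd pre)) (map snd post)"
  using assms by (auto simp: entering_def valid_def sorted_wrt_append chain_append)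

lemma entering_stop:
  assumes e: "entering pre x b post" and n: "b \<notin> snd ` set post"
  shows "valid (pre @ (x, b) # post)"
    and "filter (\<lambda>p. fst (snd p) = fst b) post = []"
    and "filter (\<lambda>p. snd (snd p) = snd b) post = []"
proof -
  have ad: "addable (set (map snd pre)) b" using e by (simp add: entering_def)
  note ch = entering_valid(2)[OF e]
  show "valid (pre @ (x, b) # post)"
    using e n chain_insert[OF ch ad] by (auto simp: entering_def valid_def chain_append)
  show "filter (\<lambda>p. fst (snd p) = fst b) post = []"
  proof -
    have "fst b' \<noteq> fst b" if "b' \<in> set (map snd post)" for b'
      using chain_row_first[OF ch ad that] n by auto
    thus ?thesis by (force simp: filter_empty_conv)
  qed
  show "filter (\<lambda>p. snd (snd p) = snd b) post = []"
  proof -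
    have "snd b' \<noteq> snd b" if "b' \<in> set (map snd post)" for b'
      using chain_col_first[OF ch ad that] n by auto
    thus ?thesis by (force simp: filter_empty_conv)
  qed
qed

lemma entering_bump:
  assumes e: "entering pre x b (p1 @ (y, b) # p2)"
  defines "S \<equiv> insert b (set (map snd pre) \<union> set (map snd p1))"
  shows "b \<notin> snd ` set p1" and "entering pre x b p1" "chain {} (map snd ((pre @ (x, b) # p1) @ p2))"
    and "addable (set (map snd pre) \<union> set (map snd p1)) b"
    and "entering (pre @ (x, b) # p1) y (nxt S b m) p2"
    and "set (map snd (pre @ (x, b) # p1)) = S"
    and "valid ((pre @ (x, b) # p1) @ p2)"
proof -
  have ch: "chain {} (map snd (pre @ p1 @ (y, b) # p2))"
    and st: "sorted_wrt (<) (map fst pre @ x # map fst (p1 @ (y, b) # p2))"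
    and ad: "addable (set (map snd pre)) b" using e by (auto simp: entering_def)
  have "distinct (map snd (pre @ p1 @ (y, b) # p2))" using chain_distinct[OF ch] by simp
  thus b1: "b \<notin> snd ` set p1" by auto
  show e1: "entering pre x b p1" using ch st ad by (auto simp: entering_def chain_append sorted_wrt_append)
  show ad1: "addable (set (map snd pre) \<union> set (map snd p1)) b" using ch by (simp add: chain_append Un_commute)
  show S: "set (map snd (pre @ (x, b) # p1)) = S" by (auto simp: S_def)
  have "chain {} (map snd (pre @ (x, b) # p1))" using entering_stop(1)[OF e1 b1] by (simp add: valid_def)
  moreover have "chain S (map snd p2)" using ch by (simp add: chain_append S_def Un_commute)
  ultimately show c: "chain {} (map snd ((pre @ (x, b) # p1) @ p2))"
    using S chain_append[of "{}" "map snd (pre @ (x, b) # p1)" "map snd p2"] by simp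
  have st': "sorted_wrt (<) (map fst (pre @ (x, b) # p1) @ y # map fst p2)"
    using st by simp
  show "entering (pre @ (x, b) # p1) y (nxt S b m) p2"
    unfolding entering_def S using c st' addable_nxt[OF ad1, of m] by (simp add: S_def)
  show "valid ((pre @ (x, b) # p1) @ p2)" using c st' by (auto simp: valid_def sorted_wrt_append)
qed

lemma rowf_append: "rowf (Q @ R) r = rowf Q r @ rowf R r"
  by (simp add: rowf_def)

lemma rowf_Cons: "rowf ((t, b) # R) r = (if fst b = r then t # rowf R r else rowf R r)"
  by (simp add: rowf_def)

lemma colf_append: "colf (Q @ R) c = colf R c @ colf Q c"
  by (simp add: colf_def)

lemma colf_Cons: "colf ((t, b) # R) c = colf R c @ (if snd b = c then [t] else [])"
  by (simp add: colf_def)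

lemma rows_cong: "(\<And>r. i \<le> r \<Longrightarrow> r < j \<Longrightarrow> rowf Q r = rowf R r) \<Longrightarrow> rows Q i j = rows R i j"
proof -
  assume "\<And>r. i \<le> r \<Longrightarrow> r < j \<Longrightarrow> rowf Q r = rowf R r"
  hence "map (rowf Q) (rev [i..<j]) = map (rowf R) (rev [i..<j])" by simp
  thus ?thesis unfolding rows_def by (rule arg_cong)
qed

lemma cols_cong: "(\<And>c. i \<le> c \<Longrightarrow> c < j \<Longrightarrow> colf Q c = colf R c) \<Longrightarrow> cols Q i j = cols R i j"
proof -
  assume "\<And>c. i \<le> c \<Longrightarrow> c < j \<Longrightarrow> colf Q c = colf R c"
  hence "map (colf Q) [i..<j] = map (colf R) [i..<j]" by simp
  thus ?thesis unfolding cols_def by (rule arg_cong)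
qed

lemma rows_at: "i \<le> r \<Longrightarrow> r < j \<Longrightarrow> rows Q i j = rows Q (Suc r) j @ rowf Q r @ rows Q i r"
  using rows_split[of i "Suc r" j Q] rows_last[of i r Q] by simp

lemma cols_at: "i \<le> c \<Longrightarrow> c < j \<Longrightarrow> cols Q i j = cols Q i c @ colf Q c @ cols Q (Suc c) j"
  using cols_split[of i "Suc c" j Q] cols_last[of i c Q] by simp

lemma bounded_mono: "bounded N Q \<Longrightarrow> snd ` set R \<subseteq> snd ` set Q \<Longrightarrow> bounded N R"
proof -
  have b: "bounded N Q \<longleftrightarrow> (\<forall>b\<in>snd ` set Q. fst b < N \<and> snd b < N)" for Q by (auto simp: bounded_def)
  show "bounded N Q \<Longrightarrow> snd ` set R \<subseteq> snd ` set Q \<Longrightarrow> bounded N R" unfolding b by (meson subsetD)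
qed

text \<open>The invariant of column insertion is that the letter in hand stands in the column word
  directly before the column it enters. A bump is \<open>keq_col_bump\<close> in this column and
  leaves \<open>y\<close> before the next one. The result is stated as a row word so that it fits
  \<open>row_phase\<close>.\<close>

lemma col_phase:
  assumes "entering pre x b post" "bounded N (pre @ (x, b) # sw (set (map snd pre)) b True post)"
  shows "keq (cols (pre @ post) 0 (snd b) @ [x] @ cols (pre @ post) (snd b) N)
    (rows (pre @ (x, b) # sw (set (map snd pre)) b True post) 0 N)"
  using assms
proof (induction "length post" arbitrary: pre x b post rule: less_induct)
  case less
  define c where "c = snd b"
  have cN: "c < N" using less.prems(2) by (simp add: bounded_def c_def)
  show ?case
  proof (cases "b \<in> snd ` set post")
    case False
    note st = entering_stop[OF less.prems(1) False]
    define Q where "Q = pre @ (x, b) # post"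
    have sw: "sw (set (map snd pre)) b True post = post" by (rule sw_notin[OF False])
    have pc: "colf post c = []" using st(3) by (simp add: colf_def c_def)
    have 1: "colf Q c = [x] @ colf (pre @ post) c"
      by (simp add: Q_def colf_append colf_Cons pc) (simp add: c_def)
    have 2: "colf Q c' = colf (pre @ post) c'" if "c' \<noteq> c" for c'
      using that by (simp add: Q_def colf_append colf_Cons c_def)
    have "cols Q 0 N = cols Q 0 c @ colf Q c @ cols Q (Suc c) N" using cols_at[of 0 c N] cN by simp
    also have "cols Q 0 c = cols (pre @ post) 0 c" using 2 by (intro cols_cong) simp
    also have "cols Q (Suc c) N = cols (pre @ post) (Suc c) N" using 2 by (intro cols_cong) simp
    finally have "cols Q 0 N = cols (pre @ post) 0 c @ [x] @ cols (pre @ post) c N"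
      using cols_first[OF cN, of "pre @ post"] by (simp add: 1)
    moreover have "keq (cols Q 0 N) (rows Q 0 N)"
      using keq_sym[OF rows_keq_cols[OF st(1)]] less.prems(2) sw by (simp add: Q_def)
    ultimately show ?thesis using sw by (simp add: Q_def c_def)
  next
    case True
    then obtain y where "(y, b) \<in> set post" by force
    then obtain p1 p2 where post: "post = p1 @ (y, b) # p2" by (meson split_list)
    note eb = entering_bump[OF less.prems(1)[unfolded post]]
    define S where "S = insert b (set (map snd pre) \<union> set (map snd p1))"
    define g where "g = nxt S b True"
    define pre2 where "pre2 = pre @ (x, b) # p1"
    have sw: "sw (set (map snd pre)) b True post = p1 @ (y, g) # sw S g True p2"
      unfolding S_def g_def using sw_append[OF eb(1), of "set (map snd pre)" True y p2]
      by (simp only: post simp_thms)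
    have res: "pre @ (x, b) # sw (set (map snd pre)) b True post = pre2 @ (y, g) # sw (set (map snd pre2)) g True p2"
      unfolding sw using eb(6) by (simp add: pre2_def S_def)
    have ent: "entering pre2 y g p2" using eb(5)[of True] by (simp add: pre2_def g_def S_def)
    have sg: "snd g = Suc c" using nxt_col(1)[OF eb(4), of True] by (simp add: g_def S_def c_def)
    have IH: "keq (cols (pre2 @ p2) 0 (Suc c) @ [y] @ cols (pre2 @ p2) (Suc c) N)
        (rows (pre2 @ (y, g) # sw (set (map snd pre2)) g True p2) 0 N)"
      using less.hyps[OF _ ent] less.prems(2) sg res by (simp add: post)
    have p1c: "colf p1 c = []" using entering_stop(3)[OF eb(2,1)] by (simp add: colf_def c_def)
    define A where "A = rev (colf pre c)"
    define Z where "Z = rev (colf p2 c)"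
    have A: "colf pre c = rev A" and Z: "colf p2 c = rev Z" by (simp_all add: A_def Z_def)
    have c1: "colf (pre @ post) c = rev (A @ y # Z)"
      by (simp add: post colf_append colf_Cons p1c A Z) (simp add: c_def)
    have c2: "colf (pre2 @ p2) c = rev (A @ x # Z)"
      by (simp add: pre2_def colf_append colf_Cons p1c A Z) (simp add: c_def)
    have c3: "colf (pre2 @ p2) c' = colf (pre @ post) c'" if "c' \<noteq> c" for c'
      using that by (simp add: pre2_def post colf_append colf_Cons c_def)
    have st: "sorted_wrt (<) (map fst pre @ x # map fst (p1 @ (y, b) # p2))"
      using less.prems(1) by (simp add: entering_def post)
    have sA: "set A \<subseteq> fst ` set pre" "set Z \<subseteq> fst ` set p2" by (auto simp: A_def Z_def colf_def)
    have ss: "sorted_wrt (<) A" "sorted_wrt (<) Z"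
      using st by (auto simp: A_def Z_def colf_def sorted_wrt_append sorted_wrt_map intro: sorted_wrt_filter)
    have xy: "x < y" using st by (simp add: sorted_wrt_append)
    have "t < x" if "t \<in> set A" for t using st sA(1) that by (fastforce simp: sorted_wrt_append)
    moreover have "y < t" if "t \<in> set Z" for t using st sA(2) that by (fastforce simp: sorted_wrt_append)
    ultimately have "sorted_wrt (<) (A @ [x, y] @ Z)"
      using ss xy by (auto simp: sorted_wrt_append) (meson less_trans)+
    note cb = keq_col_bump[OF this]
    have e1: "cols (pre @ post) 0 c = cols (pre2 @ p2) 0 c" using c3 by (intro cols_cong) simp
    have e2: "cols (pre @ post) (Suc c) N = cols (pre2 @ p2) (Suc c) N" using c3 by (intro cols_cong) simp
    have w1: "cols (pre @ post) 0 c @ [x] @ cols (pre @ post) c N =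
        cols (pre2 @ p2) 0 c @ (x # rev (A @ y # Z)) @ cols (pre2 @ p2) (Suc c) N"
      using cols_first[OF cN, of "pre @ post"] c1 e1 e2 by simp
    have w2: "cols (pre2 @ p2) 0 (Suc c) @ [y] @ cols (pre2 @ p2) (Suc c) N =
        cols (pre2 @ p2) 0 c @ (rev (A @ x # Z) @ [y]) @ cols (pre2 @ p2) (Suc c) N"
      using cols_last[of 0 c "pre2 @ p2"] c2 by simp
    have H: "keq (cols (pre @ post) 0 c @ [x] @ cols (pre @ post) c N)
        (cols (pre2 @ p2) 0 (Suc c) @ [y] @ cols (pre2 @ p2) (Suc c) N)"
      unfolding w1 w2 by (rule keq_cong[OF cb])
    show ?thesis using keq_trans[OF H IH] unfolding res c_def .
  qed
qed

text \<open>The letter \<open>y\<close> has been bumped from the diagonal box \<open>(d, d)\<close>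
  and must change from a place between rows to one between columns. Being smaller than all lower
  rows, it moves cyclically to the front; behind it the row word is replaced by the column word;
  being larger than the columns up to \<open>d\<close>, it moves cyclically behind them. Both cyclic
  moves concern a prefix, so \<open>heq_append\<close> carries them over to the whole word.\<close>

lemma diagonal_switch:
  assumes v: "valid Q" and bd: "bounded N Q" and x: "(x, d, d) \<in> set Q" and xy: "x < y"
    and low: "\<forall>t\<in>set (rows Q (Suc d) N). y < t"
  shows "heq (rows Q (Suc d) N @ [y] @ rows Q 0 (Suc d)) (cols Q 0 (Suc d) @ [y] @ cols Q (Suc d) N)"
proof -
  have dN: "d < N" using x bd by (force simp: bounded_def)
  have 1: "heq (rows Q (Suc d) N @ [y]) (y # rows Q (Suc d) N)"
  proof (cases "Suc d < N")
    case True
    thus ?thesis by (rule heq_cycle_min[OF v _ low])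
  next
    case False
    hence "rows Q (Suc d) N = []" by (simp add: rows_def)
    thus ?thesis by simp
  qed
  have "heq ((rows Q (Suc d) N @ [y]) @ rows Q 0 (Suc d)) ((y # rows Q (Suc d) N) @ rows Q 0 (Suc d))"
    by (rule heq_append[OF 1])
  also have "(y # rows Q (Suc d) N) @ rows Q 0 (Suc d) = [y] @ rows Q 0 N"
    using rows_split[of 0 "Suc d" N Q] dN by simp
  also have "heq \<dots> ([y] @ cols Q 0 N)" using keq_heq[OF rows_keq_cols[OF v bd], of "[y]" "[]"] by simp
  also have "[y] @ cols Q 0 N = (y # cols Q 0 (Suc d)) @ cols Q (Suc d) N"
    using cols_split[of 0 "Suc d" N Q] dN by simp
  also have "heq \<dots> ((cols Q 0 (Suc d) @ [y]) @ cols Q (Suc d) N)"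
  proof (rule heq_append, rule heq_cycle_max[OF v x], rule ballI)
    fix t assume "t \<in> set (cols Q 0 (Suc d))"
    then obtain r c where t: "(t, r, c) \<in> set Q" "c \<le> d" by (auto simp: set_cols)
    have "r \<le> d" using valid_le[OF v t(1)] t(2) by simp
    hence "\<not> x < t" using valid_less[OF v x t(1)] t(2) by auto
    thus "t < y" using xy by simp
  qed
  finally show ?thesis by simp
qed

text \<open>The invariant of row insertion is that the letter in hand stands in the row word
  directly behind the row it enters. After a bump from the diagonal, \<open>diagonal_switch\<close>
  hands over to \<open>col_phase\<close>; for this reason the result is only
  \<open>heq\<close>.\<close>

lemma row_phase:
  assumes "entering pre x b post" "bounded N (pre @ (x, b) # sw (set (map snd pre)) b False post)"
  shows "heq (rows (pre @ post) (fst b) N @ [x] @ rows (pre @ post) 0 (fst b))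
    (rows (pre @ (x, b) # sw (set (map snd pre)) b False post) 0 N)"
  using assms
proof (induction "length post" arbitrary: pre x b post rule: less_induct)
  case less
  define r where "r = fst b"
  have rN: "r < N" using less.prems(2) by (simp add: bounded_def r_def)
  show ?case
  proof (cases "b \<in> snd ` set post")
    case False
    note st = entering_stop[OF less.prems(1) False]
    define Q where "Q = pre @ (x, b) # post"
    have sw: "sw (set (map snd pre)) b False post = post" by (rule sw_notin[OF False])
    have pr: "rowf post r = []" using st(2) by (simp add: rowf_def r_def)
    have 1: "rowf Q r = rowf (pre @ post) r @ [x]"
      by (simp add: Q_def rowf_append rowf_Cons pr) (simp add: r_def)
    have 2: "rowf Q r' = rowf (pre @ post) r'" if "r' \<noteq> r" for r'
      using that by (simp add: Q_def rowf_append rowf_Cons r_def)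
    have "rows Q 0 N = rows Q (Suc r) N @ rowf Q r @ rows Q 0 r" using rows_at[of 0 r N] rN by simp
    also have "rows Q 0 r = rows (pre @ post) 0 r" using 2 by (intro rows_cong) simp
    also have "rows Q (Suc r) N = rows (pre @ post) (Suc r) N" using 2 by (intro rows_cong) simp
    finally have "rows Q 0 N = rows (pre @ post) r N @ [x] @ rows (pre @ post) 0 r"
      using rows_first[OF rN, of "pre @ post"] by (simp add: 1)
    thus ?thesis using sw by (simp add: Q_def r_def)
  next
    case True
    then obtain y where "(y, b) \<in> set post" by force
    then obtain p1 p2 where post: "post = p1 @ (y, b) # p2" by (meson split_list)
    note eb = entering_bump[OF less.prems(1)[unfolded post]]
    define S where "S = insert b (set (map snd pre) \<union> set (map snd p1))"
    define g where "g = nxt S b False"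
    define pre2 where "pre2 = pre @ (x, b) # p1"
    have sw: "sw (set (map snd pre)) b False post = p1 @ (y, g) # sw S g (fst b = snd b) p2"
      unfolding S_def g_def using sw_append[OF eb(1), of "set (map snd pre)" False y p2]
      by (simp only: post simp_thms)
    have res: "pre @ (x, b) # sw (set (map snd pre)) b False post =
        pre2 @ (y, g) # sw (set (map snd pre2)) g (fst b = snd b) p2"
      unfolding sw using eb(6) by (simp add: pre2_def S_def)
    have ent: "entering pre2 y g p2" using eb(5)[of False] by (simp add: pre2_def g_def S_def)
    have p1r: "rowf p1 r = []" using entering_stop(2)[OF eb(2,1)] by (simp add: rowf_def r_def)
    define A where "A = rowf pre r"
    define Z where "Z = rowf p2 r"
    have c1: "rowf (pre @ post) r = A @ y # Z"
      by (simp add: post rowf_append rowf_Cons p1r A_def Z_def) (simp add: r_def)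
    have c2: "rowf (pre2 @ p2) r = A @ x # Z"
      by (simp add: pre2_def rowf_append rowf_Cons p1r A_def Z_def) (simp add: r_def)
    have c3: "rowf (pre2 @ p2) r' = rowf (pre @ post) r'" if "r' \<noteq> r" for r'
      using that by (simp add: pre2_def post rowf_append rowf_Cons r_def)
    have st: "sorted_wrt (<) (map fst pre @ x # map fst (p1 @ (y, b) # p2))"
      using less.prems(1) by (simp add: entering_def post)
    have sA: "set A \<subseteq> fst ` set pre" "set Z \<subseteq> fst ` set p2" by (auto simp: A_def Z_def rowf_def)
    have ss: "sorted_wrt (<) A" "sorted_wrt (<) Z"
      using st by (auto simp: A_def Z_def rowf_def sorted_wrt_append sorted_wrt_map intro: sorted_wrt_filter)
    have xy: "x < y" using st by (simp add: sorted_wrt_append)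
    have "t < x" if "t \<in> set A" for t using st sA(1) that by (fastforce simp: sorted_wrt_append)
    moreover have "y < t" if "t \<in> set Z" for t using st sA(2) that by (fastforce simp: sorted_wrt_append)
    ultimately have "sorted_wrt (<) (A @ [x, y] @ Z)"
      using ss xy by (auto simp: sorted_wrt_append) (meson less_trans)+
    note cb = keq_row_bump[OF this]
    have e1: "rows (pre @ post) 0 r = rows (pre2 @ p2) 0 r" using c3 by (intro rows_cong) simp
    have e2: "rows (pre @ post) (Suc r) N = rows (pre2 @ p2) (Suc r) N" using c3 by (intro rows_cong) simp
    have w1: "rows (pre @ post) r N @ [x] @ rows (pre @ post) 0 r =
        rows (pre2 @ p2) (Suc r) N @ (A @ y # Z @ [x]) @ rows (pre2 @ p2) 0 r"
      using rows_first[OF rN, of "pre @ post"] c1 e1 e2 by simp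
    have w2: "rows (pre2 @ p2) (Suc r) N @ [y] @ rows (pre2 @ p2) 0 (Suc r) =
        rows (pre2 @ p2) (Suc r) N @ (y # A @ x # Z) @ rows (pre2 @ p2) 0 r"
      using rows_last[of 0 r "pre2 @ p2"] c2 by simp
    have H: "heq (rows (pre @ post) r N @ [x] @ rows (pre @ post) 0 r)
        (rows (pre2 @ p2) (Suc r) N @ [y] @ rows (pre2 @ p2) 0 (Suc r))"
      unfolding w1 w2 by (rule keq_heq[OF cb])
    show ?thesis
    proof (cases "fst b = snd b")
      case False
      have sg: "fst g = Suc r" using nxt_row(1)[OF eb(4), of False] False by (simp add: g_def S_def r_def)
      have "heq (rows (pre2 @ p2) (Suc r) N @ [y] @ rows (pre2 @ p2) 0 (Suc r))
          (rows (pre2 @ (y, g) # sw (set (map snd pre2)) g False p2) 0 N)"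
        using less.hyps[OF _ ent] less.prems(2) sg res False by (simp add: post)
      thus ?thesis using heq_trans[OF H] res False by (simp add: r_def)
    next
      case True
      have sg: "snd g = Suc r" using nxt_col(1)[OF eb(4), of False] True by (simp add: g_def S_def r_def)
      have v2: "valid (pre2 @ p2)" using eb(7) by (simp add: pre2_def)
      have bx: "b = (r, r)" using True by (simp add: r_def prod_eq_iff)
      have bd: "bounded N (pre2 @ (y, g) # sw (set (map snd pre2)) g True p2)"
        using less.prems(2) res True by simp
      have bd0: "bounded N (pre2 @ p2)"
      proof (rule bounded_mono[OF bd])
        show "snd ` set (pre2 @ p2) \<subseteq> snd ` set (pre2 @ (y, g) # sw (set (map snd pre2)) g True p2)"
          using sw_boxes[of p2 g "set (map snd pre2)" True] by auto
      qed
      \<comment> \<open>\<open>y\<close> was the diagonal entry of row \<open>r\<close>, hence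
        smaller than all entries of the lower rows, and these are unchanged.\<close>
      have low: "\<forall>t\<in>set (rows (pre2 @ p2) (Suc r) N). y < t"
      proof
        fix t assume "t \<in> set (rows (pre2 @ p2) (Suc r) N)"
        then obtain r' c where t: "(t, r', c) \<in> set (pre2 @ p2)" "Suc r \<le> r'" by (auto simp: set_rows)
        have v0: "valid (pre @ post)" using entering_valid(1)[OF less.prems(1)] .
        have t': "(t, r', c) \<in> set (pre @ post)" using t bx by (auto simp: pre2_def post)
        have yb: "(y, r, r) \<in> set (pre @ post)" using bx by (simp add: post)
        have "r' \<le> c" using valid_le[OF v0 t'] .
        hence "\<not> t < y" using valid_less[OF v0 t' yb] t(2) by auto
        moreover have "t \<noteq> y" using valid_functional[OF v0 yb, of "(r', c)"] t' t(2) by auto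
        ultimately show "y < t" by simp
      qed
      have "heq (rows (pre2 @ p2) (Suc r) N @ [y] @ rows (pre2 @ p2) 0 (Suc r))
          (cols (pre2 @ p2) 0 (Suc r) @ [y] @ cols (pre2 @ p2) (Suc r) N)"
        using diagonal_switch[OF v2 bd0 _ xy low] bx by (simp add: pre2_def)
      also have "heq \<dots> (rows (pre2 @ (y, g) # sw (set (map snd pre2)) g True p2) 0 N)"
        using keq_heq'[OF col_phase[OF ent bd]] sg by simp
      finally show ?thesis using heq_trans[OF H] res True by (simp add: r_def)
    qed
  qed
qed

section \<open>Hook subwords and the first row\<close>

text \<open>The same statistic for a word given as a list of (position, letter). No condition relates the
  last letter of the decreasing part to the first letter of the increasing part, as either of
  them can serve as the pivot of the hook.\<close>

definition hw :: "nat \<Rightarrow> nat \<Rightarrow> (nat \<times> nat) list \<Rightarrow> nat \<Rightarrow> bool" where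
  "hw a b W m \<longleftrightarrow> (\<exists>ds us. subseq (ds @ us) W \<and> sorted_wrt (\<lambda>x y. snd y < snd x) ds \<and>
     sorted_wrt (\<lambda>x y. snd x \<le> snd y) us \<and> (\<forall>e\<in>set (ds @ us). a < fst e \<and> fst e < b) \<and>
     length (ds @ us) = m)"

lemma hwI: "subseq (ds @ us) W \<Longrightarrow> sorted_wrt (\<lambda>x y. snd y < snd x) ds \<Longrightarrow>
    sorted_wrt (\<lambda>x y. snd x \<le> snd y) us \<Longrightarrow> (\<And>e. e \<in> set (ds @ us) \<Longrightarrow> a < fst e \<and> fst e < b) \<Longrightarrow>
    length (ds @ us) = m \<Longrightarrow> hw a b W m"
  unfolding hw_def by blast

text \<open>The counterpart of \<open>hk_snoc\<close> with positions for values: the last maximal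
  letter, at position \<open>t\<close>, can only end the increasing part, with all other positions
  before \<open>t\<close>, or begin the decreasing part, with all others after \<open>t\<close>. The
  two recursions agree term by term.\<close>

lemma hw_max:
  assumes st: "sorted_wrt (<) (map fst (W1 @ (t, x) # W2))"
    and l1: "\<And>e. e \<in> set W1 \<Longrightarrow> snd e \<le> x" and l2: "\<And>e. e \<in> set W2 \<Longrightarrow> snd e < x"
  shows "hw a b (W1 @ (t, x) # W2) m \<longleftrightarrow> hw a b (W1 @ W2) m \<or>
     a < t \<and> t < b \<and> (\<exists>m'. m = Suc m' \<and> (hw a t (W1 @ W2) m' \<or> hw t b (W1 @ W2) m'))"
proof
  have t1: "\<And>e. e \<in> set W1 \<Longrightarrow> fst e < t" and t2: "\<And>e. e \<in> set W2 \<Longrightarrow> t < fst e"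
    using st by (auto simp: sorted_wrt_append)
  {
    assume "hw a b (W1 @ (t, x) # W2) m"
    then obtain ds us where s: "subseq (ds @ us) (W1 @ [(t, x)] @ W2)"
      and d: "sorted_wrt (\<lambda>x y. snd y < snd x) ds" and u: "sorted_wrt (\<lambda>x y. snd x \<le> snd y) us"
      and r: "\<And>e. e \<in> set (ds @ us) \<Longrightarrow> a < fst e \<and> fst e < b" and m: "length (ds @ us) = m"
      unfolding hw_def by auto
    obtain v1 v2 v3 where v: "ds @ us = v1 @ v2 @ v3" "subseq v1 W1" "subseq v2 [(t, x)]" "subseq v3 W2"
      using subseq_appendE[OF s] subseq_appendE by metis
    have v2: "v2 = [] \<or> v2 = [(t, x)]" using v(3) unfolding in_set_subseqs[symmetric] by auto
    have in1: "e \<in> set W1" if "e \<in> set v1" for e using subseq_set[OF v(2)] that by blast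
    have in2: "e \<in> set W2" if "e \<in> set v3" for e using subseq_set[OF v(4)] that by blast
    show "hw a b (W1 @ W2) m \<or>
       a < t \<and> t < b \<and> (\<exists>m'. m = Suc m' \<and> (hw a t (W1 @ W2) m' \<or> hw t b (W1 @ W2) m'))"
    proof (cases "v2 = []")
      case True
      hence "subseq (ds @ us) (W1 @ W2)" using v by (simp add: list_emb_append_mono)
      hence "hw a b (W1 @ W2) m" using d u r m by (rule hwI)
      thus ?thesis ..
    next
      case False
      hence eq: "ds @ us = v1 @ (t, x) # v3" using v2 v(1) by simp
      hence tin: "(t, x) \<in> set (ds @ us)" by simp
      have ab: "a < t" "t < b" using r[OF tin] by auto
      from eq consider d' where "ds = v1 @ (t, x) # d'" "v3 = d' @ us" | u' where "v1 = ds @ u'" "us = u' @ (t, x) # v3"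
        unfolding append_eq_append_conv2 by (auto simp: append_eq_Cons_conv Cons_eq_append_conv)
      thus ?thesis
      proof cases
        case 1
        have "v1 = []"
        proof (rule ccontr)
          assume "v1 \<noteq> []"
          then obtain e where e: "e \<in> set v1" by (cases v1) auto
          have "x < snd e" using d e by (auto simp: 1(1) sorted_wrt_append)
          thus False using l1[OF in1[OF e]] by simp
        qed
        have "hw t b (W1 @ W2) (length (d' @ us))"
        proof (rule hwI)
          show "subseq (d' @ us) (W1 @ W2)" using v(4) 1(2) by (simp add: list_emb_append2)
          show "sorted_wrt (\<lambda>x y. snd y < snd x) d'" using d by (simp add: 1(1) sorted_wrt_append)
          show "sorted_wrt (\<lambda>x y. snd x \<le> snd y) us" by (rule u)
          fix e assume e: "e \<in> set (d' @ us)"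
          show "t < fst e \<and> fst e < b" using t2[OF in2, of e] r[of e] e 1 by auto
        qed simp
        moreover have "m = Suc (length (d' @ us))" using m 1(1) \<open>v1 = []\<close> by simp
        ultimately show ?thesis using ab by blast
      next
        case 2
        have "v3 = []"
        proof (rule ccontr)
          assume "v3 \<noteq> []"
          then obtain e where e: "e \<in> set v3" by (cases v3) auto
          have "x \<le> snd e" using u e by (auto simp: 2(2) sorted_wrt_append)
          thus False using l2[OF in2[OF e]] by simp
        qed
        have "hw a t (W1 @ W2) (length (ds @ u'))"
        proof (rule hwI)
          show "subseq (ds @ u') (W1 @ W2)" using v(2) 2(1) by (simp add: list_emb_prefix)
          show "sorted_wrt (\<lambda>x y. snd y < snd x) ds" by (rule d)
          show "sorted_wrt (\<lambda>x y. snd x \<le> snd y) u'" using u by (simp add: 2(2) sorted_wrt_append)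
          fix e assume e: "e \<in> set (ds @ u')"
          show "a < fst e \<and> fst e < t" using t1[OF in1, of e] r[of e] e 2 by auto
        qed simp
        moreover have "m = Suc (length (ds @ u'))" using m 2(2) \<open>v3 = []\<close> by simp
        ultimately show ?thesis using ab by blast
      qed
    qed
  next
    assume "hw a b (W1 @ W2) m \<or>
       a < t \<and> t < b \<and> (\<exists>m'. m = Suc m' \<and> (hw a t (W1 @ W2) m' \<or> hw t b (W1 @ W2) m'))"
    then consider "hw a b (W1 @ W2) m" | m' where "a < t" "t < b" "m = Suc m'" "hw a t (W1 @ W2) m'"
      | m' where "a < t" "t < b" "m = Suc m'" "hw t b (W1 @ W2) m'" by blast
    thus "hw a b (W1 @ (t, x) # W2) m"
    proof cases
      case 1
      then obtain ds us where s: "subseq (ds @ us) (W1 @ W2)"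
        and d: "sorted_wrt (\<lambda>x y. snd y < snd x) ds" and u: "sorted_wrt (\<lambda>x y. snd x \<le> snd y) us"
        and r: "\<And>e. e \<in> set (ds @ us) \<Longrightarrow> a < fst e \<and> fst e < b" and m: "length (ds @ us) = m"
        unfolding hw_def by auto
      have "subseq (W1 @ W2) (W1 @ (t, x) # W2)" by (intro list_emb_append_mono) auto
      hence "subseq (ds @ us) (W1 @ (t, x) # W2)" using s subseq_order.trans by blast
      thus ?thesis using d u r m by (rule hwI)
    next
      case 2
      then obtain ds us where s: "subseq (ds @ us) (W1 @ W2)"
        and d: "sorted_wrt (\<lambda>x y. snd y < snd x) ds" and u: "sorted_wrt (\<lambda>x y. snd x \<le> snd y) us"
        and r: "\<And>e. e \<in> set (ds @ us) \<Longrightarrow> a < fst e \<and> fst e < t" and m: "length (ds @ us) = m'"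
        unfolding hw_def by auto
      obtain v1 v2 where v: "ds @ us = v1 @ v2" "subseq v1 W1" "subseq v2 W2"
        using subseq_appendE[OF s] by metis
      have "v2 = []"
      proof (rule ccontr)
        assume "v2 \<noteq> []"
        then obtain e where e: "e \<in> set v2" by (cases v2) auto
        hence "t < fst e" using t2 subseq_set[OF v(3)] by blast
        moreover have "e \<in> set (ds @ us)" using v(1) e by simp
        ultimately show False using r[of e] by simp
      qed
      hence s1: "subseq (ds @ us) W1" using v by simp
      show ?thesis
      proof (rule hwI)
        have "subseq ((ds @ us) @ [(t, x)] @ []) (W1 @ [(t, x)] @ W2)" using s1 by (intro list_emb_append_mono) auto
        thus "subseq (ds @ us @ [(t, x)]) (W1 @ (t, x) # W2)" by simp
        show "sorted_wrt (\<lambda>x y. snd y < snd x) ds" by (rule d)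
        have "snd e \<le> x" if "e \<in> set us" for e using l1[of e] subseq_set[OF s1] that by auto
        thus "sorted_wrt (\<lambda>x y. snd x \<le> snd y) (us @ [(t, x)])" using u by (simp add: sorted_wrt_append)
        fix e assume e: "e \<in> set (ds @ us @ [(t, x)])"
        show "a < fst e \<and> fst e < b" using r[of e] 2(1,2) e by auto
      qed (use m 2(3) in simp)
    next
      case 3
      then obtain ds us where s: "subseq (ds @ us) (W1 @ W2)"
        and d: "sorted_wrt (\<lambda>x y. snd y < snd x) ds" and u: "sorted_wrt (\<lambda>x y. snd x \<le> snd y) us"
        and r: "\<And>e. e \<in> set (ds @ us) \<Longrightarrow> t < fst e \<and> fst e < b" and m: "length (ds @ us) = m'"
        unfolding hw_def by auto
      obtain v1 v2 where v: "ds @ us = v1 @ v2" "subseq v1 W1" "subseq v2 W2"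
        using subseq_appendE[OF s] by metis
      have "v1 = []"
      proof (rule ccontr)
        assume "v1 \<noteq> []"
        then obtain e where e: "e \<in> set v1" by (cases v1) auto
        hence "fst e < t" using t1 subseq_set[OF v(2)] by blast
        moreover have "e \<in> set (ds @ us)" using v(1) e by simp
        ultimately show False using r[of e] by simp
      qed
      hence s1: "subseq (ds @ us) W2" using v by simp
      show ?thesis
      proof (rule hwI)
        have "subseq ([] @ [(t, x)] @ (ds @ us)) (W1 @ [(t, x)] @ W2)" using s1 by (intro list_emb_append_mono) auto
        thus "subseq (((t, x) # ds) @ us) (W1 @ (t, x) # W2)" by simp
        have "snd e < x" if "e \<in> set ds" for e using l2[of e] subseq_set[OF s1] that by auto
        thus "sorted_wrt (\<lambda>x y. snd y < snd x) ((t, x) # ds)" using d by simp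
        show "sorted_wrt (\<lambda>x y. snd x \<le> snd y) us" by (rule u)
        fix e assume e: "e \<in> set (((t, x) # ds) @ us)"
        show "a < fst e \<and> fst e < b" using r[of e] 3(1,2) e by auto
      qed (use m 3(3) in simp)
    qed
  }
qed

lemma map_fst_sw: "map fst (sw S b m X) = map fst X"
  by (induction S b m X rule: sw.induct) auto

lemma zip_max:
  assumes w: "\<forall>y\<in>set w1. y \<le> x" "\<forall>y\<in>set w2. y < x" and ts: "length ts1 = length w1" "length ts2 = length w2"
    and st: "sorted_wrt (<) (ts1 @ t # ts2)"
  defines "pre \<equiv> zip ts1 (boxes [] w1)" and "post \<equiv> zip ts2 (boxes (foldl ins [] w1) w2)"
  defines "b \<equiv> row_end (set (map snd pre)) 0"
  shows "zip (ts1 @ t # ts2) (boxes [] (w1 @ x # w2)) = pre @ (t, b) # sw (set (map snd pre)) b False post"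
    and "zip (ts1 @ ts2) (boxes [] (w1 @ w2)) = pre @ post"
    and "entering pre t b post"
proof -
  have S: "set (map snd pre) = set (boxes [] w1)" using ts by (simp add: pre_def)
  define X where "X = sw (set (map snd pre)) b False post"
  have "boxes [] (w1 @ x # w2) = boxes [] w1 @ b # map snd X"
    using boxes_max[OF w ts(2)] unfolding X_def b_def post_def S by simp
  moreover have "zip ts2 (map snd X) = X"
  proof -
    have "map fst X = ts2" using ts(2) by (simp add: X_def map_fst_sw post_def)
    thus ?thesis by (metis zip_map_fst_snd)
  qed
  ultimately show "zip (ts1 @ t # ts2) (boxes [] (w1 @ x # w2)) = pre @ (t, b) # X"
    using ts by (simp add: zip_append pre_def)
  show eq: "zip (ts1 @ ts2) (boxes [] (w1 @ w2)) = pre @ post"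
    using ts by (simp add: boxes_append zip_append pre_def post_def)
  have ch: "chain {} (boxes [] (w1 @ w2))" using chain_boxes(1)[OF state_ok_Nil, of "w1 @ w2"] by simp
  have ms: "map snd (pre @ post) = boxes [] (w1 @ w2)" using ts by (simp add: boxes_append pre_def post_def)
  have "ideal (set (map snd pre))" using ch unfolding S boxes_append by (auto simp: chain_append dest: chain_ideal')
  hence "addable (set (map snd pre)) b" unfolding b_def by (rule addable_row_end_0)
  moreover have "map fst pre = ts1" "map fst post = ts2" using ts by (simp_all add: pre_def post_def)
  ultimately show "entering pre t b post" unfolding entering_def ms using ch st by simp
qed

text \<open>The last occurrence of the largest letter is removed in each step. This leaves a gap in
  the positions, so the labels \<open>ts\<close> are arbitrary increasing numbers. On the side of
  the tableau, putting the letter back appends its position \<open>t\<close> to the row word: this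
  is \<open>row_phase\<close> starting in row 0.\<close>

lemma hw_iff_hk:
  assumes "length ts = length w" "sorted_wrt (<) ts" "bounded N (zip ts (boxes [] w))"
  shows "hw a b (zip ts w) m \<longleftrightarrow> hk a b (rows (zip ts (boxes [] w)) 0 N) m"
  using assms
proof (induction "length w" arbitrary: w ts a b m rule: less_induct)
  case less
  show ?case
  proof (cases "w = []")
    case True
    have "rows [] 0 N = []" by (simp add: rows_def rowf_def concat_eq_Nil_conv)
    moreover have "hw a b [] m \<longleftrightarrow> m = 0" by (auto simp: hw_def dest: list_emb_Nil2)
    moreover have "hk a b [] m \<longleftrightarrow> m = 0" by (auto simp: hk_def hkpair_def)
    ultimately show ?thesis using True by simp
  next
    case False
    define x where "x = Max (set w)"
    have "x \<in> set w" using False by (simp add: x_def)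
    then obtain w1 w2 where w: "w = w1 @ x # w2" "x \<notin> set w2" by (meson split_list_last)
    have mx: "\<forall>y\<in>set w. y \<le> x" by (simp add: x_def)
    have w12: "\<forall>y\<in>set w1. y \<le> x" "\<forall>y\<in>set w2. y < x" using mx w by (auto simp: order_le_less)
    define ts1 where "ts1 = take (length w1) ts"
    define t where "t = ts ! length w1"
    define ts2 where "ts2 = drop (Suc (length w1)) ts"
    have tl: "length w1 < length ts" using less.prems(1) w(1) by simp
    have ts: "ts = ts1 @ t # ts2" unfolding ts1_def t_def ts2_def by (rule id_take_nth_drop[OF tl])
    have len: "length ts1 = length w1" "length ts2 = length w2"
      using less.prems(1) w(1) by (simp_all add: ts1_def ts2_def)
    note zm = zip_max[OF w12 len less.prems(2)[unfolded ts]]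
    define pre where "pre = zip ts1 (boxes [] w1)"
    define post where "post = zip ts2 (boxes (foldl ins [] w1) w2)"
    define be where "be = row_end (set (map snd pre)) 0"
    define Q where "Q = zip ts (boxes [] w)"
    have Q: "Q = pre @ (t, be) # sw (set (map snd pre)) be False post"
      using zm(1) by (simp add: Q_def w(1) ts pre_def post_def be_def)
    have Q0: "zip (ts1 @ ts2) (boxes [] (w1 @ w2)) = pre @ post"
      using zm(2) by (simp add: pre_def post_def)
    have ent: "entering pre t be post" using zm(3) by (simp add: pre_def post_def be_def)
    have bdQ: "bounded N (pre @ (t, be) # sw (set (map snd pre)) be False post)"
      using less.prems(3) Q by (simp add: Q_def)
    have be0: "fst be = 0" by (simp add: be_def)
    have "rows (pre @ post) 0 0 = []" by (simp add: rows_def)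
    hence H: "heq (rows (pre @ post) 0 N @ [t]) (rows Q 0 N)"
      using row_phase[OF ent bdQ] be0 Q by simp
    have bd0: "bounded N (pre @ post)"
    proof (rule bounded_mono[OF bdQ])
      show "snd ` set (pre @ post) \<subseteq> snd ` set (pre @ (t, be) # sw (set (map snd pre)) be False post)"
        using sw_boxes[of post be "set (map snd pre)" False] by auto
    qed
    have IH: "hw a' b' (zip (ts1 @ ts2) (w1 @ w2)) m' \<longleftrightarrow> hk a' b' (rows (pre @ post) 0 N) m'" for a' b' m'
    proof -
      have "length (w1 @ w2) < length w" using w(1) by simp
      moreover have "length (ts1 @ ts2) = length (w1 @ w2)" using len by simp
      moreover have "sorted_wrt (<) (ts1 @ ts2)" using less.prems(2) by (simp add: ts sorted_wrt_append)
      ultimately show ?thesis using less.hyps[of "w1 @ w2" "ts1 @ ts2"] bd0 unfolding Q0 by blast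
    qed
    have zW: "zip ts w = zip ts1 w1 @ (t, x) # zip ts2 w2" "zip (ts1 @ ts2) (w1 @ w2) = zip ts1 w1 @ zip ts2 w2"
      using len by (simp_all add: ts w(1) zip_append)
    have stW: "sorted_wrt (<) (map fst (zip ts1 w1 @ (t, x) # zip ts2 w2))"
      using less.prems(2) len by (simp add: ts)
    have "hw a b (zip ts w) m \<longleftrightarrow> hw a b (zip (ts1 @ ts2) (w1 @ w2)) m \<or>
        a < t \<and> t < b \<and> (\<exists>m'. m = Suc m' \<and> (hw a t (zip (ts1 @ ts2) (w1 @ w2)) m' \<or>
          hw t b (zip (ts1 @ ts2) (w1 @ w2)) m'))"
      unfolding zW by (rule hw_max[OF stW]) (use w12 in \<open>auto dest: set_zip_rightD\<close>)
    also have "\<dots> \<longleftrightarrow> hk a b (rows (pre @ post) 0 N @ [t]) m" unfolding IH hk_snoc ..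
    also have "\<dots> \<longleftrightarrow> hk a b (rows Q 0 N) m" using H by (simp add: heq_def)
    finally show ?thesis by (simp add: Q_def)
  qed
qed

lemma hook_word_iff:
  "hook_word u \<longleftrightarrow> u \<noteq> [] \<and> (\<exists>ds us. u = ds @ us \<and> sorted_wrt (>) ds \<and> sorted us)"
proof
  assume "hook_word u"
  then obtain k where k: "1 \<le> k" "k \<le> length u" "sorted_wrt (>) (take k u)" "sorted (drop (k - 1) u)"
    by (auto simp: hook_word_def)
  have "sorted_wrt (>) (take (k - 1) u)"
    using sorted_wrt_take[OF k(3), of "k - 1"] by (simp add: min_def)
  moreover have "u = take (k - 1) u @ drop (k - 1) u" by simp
  ultimately have "\<exists>ds us. u = ds @ us \<and> sorted_wrt (>) ds \<and> sorted us" using k(4) by blast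
  moreover have "u \<noteq> []" using k(1,2) by auto
  ultimately show "u \<noteq> [] \<and> (\<exists>ds us. u = ds @ us \<and> sorted_wrt (>) ds \<and> sorted us)" by simp
next
  assume "u \<noteq> [] \<and> (\<exists>ds us. u = ds @ us \<and> sorted_wrt (>) ds \<and> sorted us)"
  then obtain ds us where u: "u \<noteq> []" "u = ds @ us" "sorted_wrt (>) ds" "sorted us" by auto
  consider "ds = []" | d ds' where "ds = ds' @ [d]" by (cases ds rule: rev_cases) auto
  thus "hook_word u"
  proof cases
    case 1
    then obtain e v where "u = e # v" "sorted (e # v)" using u by (cases us) auto
    thus ?thesis unfolding hook_word_def by (intro exI[of _ 1]) simp
  next
    case 2
    show ?thesis
    proof (cases "us = [] \<or> d \<le> hd us")
      case True
      have "take (length ds) u = ds" "drop (length ds - 1) u = d # us" using u(2) 2 by simp_all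
      moreover have "sorted (d # us)"
      proof (cases us)
        case (Cons a us')
        have "d \<le> a" using True Cons by simp
        thus ?thesis using u(4) Cons by auto
      qed simp
      ultimately show ?thesis unfolding hook_word_def using u 2
        by (intro exI[of _ "length ds"]) simp
    next
      case False
      then obtain e us' where us: "us = e # us'" "e < d" by (cases us) auto
      have "take (Suc (length ds)) u = ds @ [e]" "drop (Suc (length ds) - 1) u = us" using u(2) us by simp_all
      moreover have "sorted_wrt (>) (ds @ [e])" using u(3) us 2 by (auto simp: sorted_wrt_append)
      ultimately show ?thesis unfolding hook_word_def using u us
        by (intro exI[of _ "Suc (length ds)"]) simp
    qed
  qed
qed

lemma subseq_map_lift: "subseq v (map f W) \<Longrightarrow> \<exists>V. subseq V W \<and> map f V = v"
proof (induction W arbitrary: v)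
  case (Cons x W)
  from subseq_ConsD[of v "f x" "map f W"] Cons.prems
  consider "subseq v (map f W)" | v' where "v = f x # v'" "subseq v' (map f W)" by auto
  thus ?case
  proof cases
    case 1
    then obtain V where "subseq V W" "map f V = v" using Cons.IH by blast
    thus ?thesis by (intro exI[of _ V]) auto
  next
    case 2
    then obtain V where "subseq V W" "map f V = v'" using Cons.IH by blast
    thus ?thesis using 2 by (intro exI[of _ "x # V"]) auto
  qed
qed (auto dest: list_emb_Nil2)

lemma hw_iff_subseq:
  defines "W w \<equiv> zip [1..<Suc (length w)] w"
  shows "hw 0 (Suc (length w)) (W w) m \<longleftrightarrow>
    (\<exists>ds us. subseq (ds @ us) w \<and> sorted_wrt (>) ds \<and> sorted us \<and> length (ds @ us) = m)"
proof
  have sn: "map snd (W w) = w" by (simp add: W_def del: upt_Suc)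
  { assume "hw 0 (Suc (length w)) (W w) m"
    then obtain ds us where s: "subseq (ds @ us) (W w)" and d: "sorted_wrt (\<lambda>x y. snd y < snd x) ds"
      and u: "sorted_wrt (\<lambda>x y. snd x \<le> snd y) us" and m: "length (ds @ us) = m"
      unfolding hw_def by auto
    have "subseq (map snd ds @ map snd us) w" using subseq_map[OF s, of snd] sn by simp
    moreover have "sorted_wrt (>) (map snd ds)" using d by (simp add: sorted_wrt_map)
    moreover have "sorted (map snd us)" using u by (simp add: sorted_wrt_map)
    ultimately show "\<exists>ds us. subseq (ds @ us) w \<and> sorted_wrt (>) ds \<and> sorted us \<and> length (ds @ us) = m"
      using m by (metis length_append length_map)
  next
    assume "\<exists>ds us. subseq (ds @ us) w \<and> sorted_wrt (>) ds \<and> sorted us \<and> length (ds @ us) = m"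
    then obtain ds us where **: "subseq (ds @ us) w" "sorted_wrt (>) ds" "sorted us" "length (ds @ us) = m"
      by blast
    hence *: "subseq (ds @ us) (map snd (W w))" "sorted_wrt (>) ds" "sorted us" "length (ds @ us) = m"
      unfolding sn by blast+
    obtain V where V: "subseq V (W w)" "map snd V = ds @ us" using subseq_map_lift[OF *(1)] by blast
    define D where "D = take (length ds) V"
    define U where "U = drop (length ds) V"
    have VD: "V = D @ U" "map snd D = ds" "map snd U = us"
      using V(2) by (simp_all add: D_def U_def flip: take_map drop_map)
    show "hw 0 (Suc (length w)) (W w) m"
    proof (rule hwI)
      show "subseq (D @ U) (W w)" using V VD by simp
      show "sorted_wrt (\<lambda>x y. snd y < snd x) D" using *(2) unfolding VD(2)[symmetric] sorted_wrt_map .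
      show "sorted_wrt (\<lambda>x y. snd x \<le> snd y) U" using *(3) unfolding VD(3)[symmetric] sorted_wrt_map .
      have "length (D @ U) = length (map snd V)" using VD(1) by simp
      thus "length (D @ U) = m" using *(4) V(2) by simp
      fix e assume "e \<in> set (D @ U)"
      hence "e \<in> set (W w)" using subseq_set[OF V(1)] VD(1) by blast
      hence "(fst e, snd e) \<in> set (W w)" by simp
      hence "fst e \<in> set [1..<Suc (length w)]" unfolding W_def by (rule set_zip_leftD)
      thus "0 < fst e \<and> fst e < Suc (length w)" by (simp del: upt_Suc)
    qed }
qed

section \<open>The longest hook subword\<close>

definition row0 :: "nat list \<Rightarrow> nat" where
  "row0 w = card {b \<in> set (boxes [] w). fst b = 0}"

text \<open>The first row is itself an increasing selection and attains the bound of
  \<open>hk_rows_le\<close> for the whole tableau. The interval between \<open>0\<close> and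
  \<open>M\<close> is chosen to contain all positions.\<close>

lemma hook_subword_row0:
  shows "hook_subword u w \<Longrightarrow> length u \<le> row0 w"
    and "w \<noteq> [] \<Longrightarrow> \<exists>u. hook_subword u w \<and> length u = row0 w"
proof -
  define ts where "ts = [1..<Suc (length w)]"
  define Q where "Q = zip ts (boxes [] w)"
  define M where "M = Suc (length w)"
  have lt: "length ts = length w" by (simp add: ts_def del: upt_Suc)
  have st: "sorted_wrt (<) ts" by (simp add: ts_def sorted_wrt_upt del: upt_Suc)
  have ch: "chain {} (boxes [] w)" using chain_boxes(1)[OF state_ok_Nil, of w] by simp
  have v: "valid Q" using ch st lt by (simp add: valid_def Q_def)
  obtain N where N: "0 < N" "\<forall>b\<in>set (boxes [] w). fst b < N \<and> snd b < N"
  proof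
    define N where "N = Suc (Max (insert 0 (fst ` set (boxes [] w) \<union> snd ` set (boxes [] w))))"
    show "0 < N" by (simp add: N_def)
    show "\<forall>b\<in>set (boxes [] w). fst b < N \<and> snd b < N"
      unfolding N_def less_Suc_eq_le by (intro ballI conjI Max_ge) auto
  qed
  have bd: "bounded N Q" unfolding bounded_def
  proof
    fix p assume "p \<in> set Q"
    hence "(fst p, snd p) \<in> set (zip ts (boxes [] w))" by (simp add: Q_def)
    hence "snd p \<in> set (boxes [] w)" by (rule set_zip_rightD)
    thus "fst (snd p) < N \<and> snd (snd p) < N" using N(2) by blast
  qed
  have tQ: "0 < t \<and> t < M" if "(t, b) \<in> set Q" for t b
    using that unfolding Q_def by (auto dest!: set_zip_leftD simp: ts_def M_def simp del: upt_Suc)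
  have len: "length (rowf Q 0) = row0 w"
  proof -
    have "map snd (filter (\<lambda>p. fst (snd p) = 0) Q) = filter (\<lambda>b. fst b = 0) (map snd Q)"
      by (simp add: filter_map o_def)
    moreover have "map snd Q = boxes [] w" using lt by (simp add: Q_def)
    ultimately have "length (rowf Q 0) = length (filter (\<lambda>b. fst b = 0) (boxes [] w))"
      unfolding rowf_def by (metis length_map)
    also have "\<dots> = row0 w"
      using chain_distinct[OF ch] by (simp add: row0_def distinct_card[symmetric] del: distinct_card)
    finally show ?thesis .
  qed
  have E: "(\<exists>ds us. subseq (ds @ us) w \<and> sorted_wrt (>) ds \<and> sorted us \<and> length (ds @ us) = m) \<longleftrightarrow>
      hk 0 M (rows Q 0 N) m" for m
    using hw_iff_subseq[of w m] hw_iff_hk[OF lt st bd[unfolded Q_def], of 0 M m]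
    by (simp add: Q_def M_def ts_def del: upt_Suc)
  have le: "m \<le> row0 w" if h: "hk 0 M (rows Q 0 N) m" for m
  proof -
    obtain ds us where "hkpair 0 M (rows Q 0 N) ds us" "length ds + length us = m" using h by (rule hkE)
    hence "m \<le> length (filter (\<lambda>t. t < M) (rowf Q 0))" using hk_rows_le[OF v] by fastforce
    also have "\<dots> \<le> length (rowf Q 0)" by (rule length_filter_le)
    finally show ?thesis using len by simp
  qed
  show "length u \<le> row0 w" if hs: "hook_subword u w"
  proof -
    obtain ds us where "u = ds @ us" "sorted_wrt (>) ds" "sorted us" "subseq u w"
      using hs unfolding hook_subword_def hook_word_iff by blast
    hence "hk 0 M (rows Q 0 N) (length u)" unfolding E[symmetric] by blast
    thus ?thesis by (rule le)
  qed
  show "\<exists>u. hook_subword u w \<and> length u = row0 w" if w: "w \<noteq> []"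
  proof -
    have "hkpair 0 M (rows Q 0 N) [] (rowf Q 0)"
      unfolding hkpair_def using sorted_rowf[OF v, of 0] tQ
      by (auto simp: rows_first[OF N(1)] set_rowf list_emb_append2)
    hence "hk 0 M (rows Q 0 N) (row0 w)" using hkI[of 0 M _ "[]" "rowf Q 0"] len by simp
    then obtain ds us where *: "subseq (ds @ us) w" "sorted_wrt (>) ds" "sorted us" "length (ds @ us) = row0 w"
      unfolding E[symmetric] by blast
    have "row0 w \<noteq> 0"
    proof -
      have "boxes [] w \<noteq> []" using w by (metis length_boxes length_0_conv)
      then obtain b where "b \<in> set (boxes [] w)" using list.set_sel(1) by blast
      hence "(0, snd b) \<in> set (boxes [] w)"
        using ideal_down[of "set (boxes [] w)" "fst b" "snd b" 0 "snd b"] chain_ideal'[OF ch] by simp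
      hence "{b \<in> set (boxes [] w). fst b = 0} \<noteq> {}" by force
      thus ?thesis by (simp add: row0_def)
    qed
    hence "ds @ us \<noteq> []" using *(4) by auto
    hence "hook_subword (ds @ us) w" unfolding hook_subword_def hook_word_iff using *(1,2,3) by blast
    thus ?thesis using *(4) by blast
  qed
qed

section \<open>Hook words and vees\<close>

text \<open>A vee as the list of its boxes in the order of their entries; \<open>e\<close> carries
  the entry \<open>j\<close> of the definition and belongs to both strips.\<close>

definition vlist :: "(nat \<times> nat) list \<Rightarrow> bool" where
  "vlist ys \<longleftrightarrow> (\<exists>V e H. ys = V @ e # H \<and> sorted_wrt below (V @ [e]) \<and> sorted_wrt rightof (e # H))"

lemma transp_rightof: "transp rightof" and transp_below: "transp below"
  by (auto intro!: transpI dest: rightof_trans below_trans)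

lemma not_below_rightof: "below x y \<Longrightarrow> \<not> rightof x y"
  by (auto simp: below_def rightof_def)

lemma ascent_step:
  "state_ok L \<Longrightarrow> a \<le> b \<Longrightarrow> rightof (insbox L a) (insbox (ins L a) b) \<and> \<not> instouch (ins L a) b"
  using ins_ascent[of L a b] state_ok_xsorted[of L] state_ok_xsorted[OF state_ok_ins, of L a]
  by (simp add: state_ok_def)

lemma descent_step:
  "state_ok L \<Longrightarrow> b < a \<Longrightarrow> if instouch L a then rightof (insbox L a) (insbox (ins L a) b) \<and> instouch (ins L a) b
    else below (insbox L a) (insbox (ins L a) b)"
  using ins_descent[of L b a] state_ok_xsorted[of L] by (simp add: state_ok_def)

lemma boxes_ascending:
  "state_ok L \<Longrightarrow> sorted (a # v) \<Longrightarrow> sorted_wrt rightof (boxes L (a # v))"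
proof (induction v arbitrary: L a)
  case (Cons b v)
  have "sorted_wrt rightof (boxes (ins L a) (b # v))" using Cons by (intro Cons.IH) (auto simp: state_ok_ins)
  moreover have "rightof (insbox L a) (insbox (ins L a) b)" using ascent_step Cons.prems by simp
  ultimately show ?case unfolding boxes.simps sorted_wrt2[OF transp_rightof] by simp
qed simp

text \<open>Once a path has met the diagonal, the path of a smaller letter lies to its right and
  meets the diagonal as well, so descents no longer lead downwards. Thus a decreasing word can
  produce part of a horizontal strip.\<close>

lemma boxes_touching:
  "state_ok L \<Longrightarrow> instouch L a \<Longrightarrow> sorted_wrt (>) (a # ds) \<Longrightarrow> sorted us \<Longrightarrow>
   sorted_wrt rightof (boxes L (a # ds @ us))"
proof (induction ds arbitrary: L a)
  case Nil
  show ?case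
  proof (cases us)
    case (Cons b us')
    have "sorted_wrt rightof (boxes (ins L a) (b # us'))"
      using Nil Cons by (intro boxes_ascending) (auto simp: state_ok_ins)
    moreover have "rightof (insbox L a) (insbox (ins L a) b)"
      using ascent_step[OF Nil.prems(1), of a b] descent_step[OF Nil.prems(1), of b a] Nil.prems(2) by fastforce
    ultimately show ?thesis unfolding Cons append_Nil boxes.simps sorted_wrt2[OF transp_rightof] by simp
  qed simp
next
  case (Cons b ds)
  have ba: "b < a" using Cons.prems(3) by simp
  have d: "rightof (insbox L a) (insbox (ins L a) b)" "instouch (ins L a) b"
    using descent_step[OF Cons.prems(1) ba] Cons.prems(2) by auto
  have "sorted_wrt rightof (boxes (ins L a) (b # ds @ us))"
    using Cons.IH[OF state_ok_ins[OF Cons.prems(1)] d(2)] Cons.prems(3,4) by simp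
  thus ?case using d(1) unfolding append_Cons boxes.simps sorted_wrt2[OF transp_rightof] by simp
qed

lemma vlist_rightof: "sorted_wrt rightof (x # xs) \<Longrightarrow> vlist (x # xs)"
  unfolding vlist_def by (rule exI[of _ "[]"]) auto

lemma vlist_below_Cons:
  assumes "vlist (y # ys)" "below x y"
  shows "vlist (x # y # ys)"
proof -
  obtain V e H where V: "y # ys = V @ e # H" "sorted_wrt below (V @ [e])" "sorted_wrt rightof (e # H)"
    using assms(1) by (auto simp: vlist_def)
  have "sorted_wrt below ((x # V) @ [e])"
  proof (cases V)
    case Nil
    thus ?thesis using V assms(2) by simp
  next
    case (Cons z V')
    hence "z = y" using V(1) by simp
    thus ?thesis using V(2) assms(2) Cons unfolding Cons append_Cons sorted_wrt2[OF transp_below] by simp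
  qed
  moreover have "x # y # ys = (x # V) @ e # H" using V(1) by simp
  ultimately show ?thesis using V(3) unfolding vlist_def by blast
qed

lemma hook_vlist:
  "state_ok L \<Longrightarrow> sorted_wrt (>) (a # ds) \<Longrightarrow> sorted us \<Longrightarrow> vlist (boxes L (a # ds @ us))"
proof (induction ds arbitrary: L a)
  case Nil
  show ?case
  proof (cases us)
    case Nil
    thus ?thesis by (simp add: vlist_rightof)
  next
    case (Cons b us')
    have s: "sorted_wrt rightof (boxes (ins L a) (b # us'))"
      using Nil Cons by (intro boxes_ascending) (auto simp: state_ok_ins)
    consider "a \<le> b \<or> instouch L a" | "b < a" "\<not> instouch L a" by linarith
    thus ?thesis
    proof cases
      case 1
      hence "rightof (insbox L a) (insbox (ins L a) b)"
        using ascent_step[OF Nil(1), of a b] descent_step[OF Nil(1), of b a] by fastforce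
      hence "sorted_wrt rightof (boxes L (a # us))"
        using s unfolding Cons boxes.simps sorted_wrt2[OF transp_rightof] by simp
      thus ?thesis by (simp add: vlist_rightof)
    next
      case 2
      hence "below (insbox L a) (insbox (ins L a) b)" using descent_step[OF Nil(1), of b a] by simp
      thus ?thesis using s vlist_below_Cons vlist_rightof by (simp add: Cons)
    qed
  qed
next
  case (Cons b ds)
  have ba: "b < a" using Cons.prems(2) by simp
  show ?case
  proof (cases "instouch L a")
    case True
    from boxes_touching[OF Cons.prems(1) True Cons.prems(2,3)] show ?thesis by (simp add: vlist_rightof)
  next
    case False
    hence "below (insbox L a) (insbox (ins L a) b)" using descent_step[OF Cons.prems(1) ba] by simp
    moreover have "vlist (boxes (ins L a) (b # ds @ us))"
      using Cons.IH[OF state_ok_ins[OF Cons.prems(1)]] Cons.prems by simp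
    ultimately show ?thesis using vlist_below_Cons by simp
  qed
qed

text \<open>Without contact with the diagonal a descent would put the next box below, so the step is
  an ascent; and after an ascent the new path has no contact either.\<close>

lemma rightof_untouched:
  "state_ok L \<Longrightarrow> sorted_wrt rightof (boxes L (a # v)) \<Longrightarrow> \<not> instouch L a \<Longrightarrow> sorted (a # v)"
proof (induction v arbitrary: L a)
  case (Cons b v)
  have R: "rightof (insbox L a) (insbox (ins L a) b)" using Cons.prems(2) by simp
  have ab: "a \<le> b"
  proof (rule ccontr)
    assume "\<not> a \<le> b"
    hence "below (insbox L a) (insbox (ins L a) b)" using descent_step[OF Cons.prems(1), of b a] Cons.prems(3) by simp
    thus False using not_below_rightof R by blast
  qed
  have "sorted (b # v)"
    using Cons.IH[OF state_ok_ins[OF Cons.prems(1)], of a b] Cons.prems(2) ascent_step[OF Cons.prems(1) ab] by simp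
  thus ?case using ab by auto
qed simp

text \<open>Descents can occur only before the first ascent, since from then on the paths stay away
  from the diagonal.\<close>

lemma rightof_hook:
  "state_ok L \<Longrightarrow> sorted_wrt rightof (boxes L (a # v)) \<Longrightarrow>
   \<exists>ds us. v = ds @ us \<and> sorted_wrt (>) (a # ds) \<and> sorted us"
proof (induction v arbitrary: L a)
  case (Cons b v)
  have s: "sorted_wrt rightof (boxes (ins L a) (b # v))" using Cons.prems(2) by simp
  show ?case
  proof (cases "a \<le> b")
    case True
    have "sorted (b # v)"
      using rightof_untouched[OF state_ok_ins[OF Cons.prems(1)] s] ascent_step[OF Cons.prems(1) True] by simp
    hence "b # v = [] @ (b # v) \<and> sorted_wrt (>) [a] \<and> sorted (b # v)" by simp
    thus ?thesis by blast
  next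
    case False
    obtain ds us where *: "v = ds @ us" "sorted_wrt (>) (b # ds)" "sorted us"
      using Cons.IH[OF state_ok_ins[OF Cons.prems(1)] s] by blast
    have "sorted_wrt (>) (a # b # ds)" using *(2) False by auto
    hence "b # v = (b # ds) @ us \<and> sorted_wrt (>) (a # b # ds) \<and> sorted us" using * by simp
    thus ?thesis by blast
  qed
qed simp

lemma vlist_hook:
  "state_ok L \<Longrightarrow> vlist (boxes L (a # v)) \<Longrightarrow> \<exists>ds us. v = ds @ us \<and> sorted_wrt (>) (a # ds) \<and> sorted us"
proof (induction v arbitrary: L a)
  case Nil
  show ?case by simp
next
  case (Cons b v)
  obtain V e H where V: "boxes L (a # b # v) = V @ e # H" "sorted_wrt below (V @ [e])" "sorted_wrt rightof (e # H)"
    using Cons.prems(2) unfolding vlist_def by blast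
  show ?case
  proof (cases V)
    case Nil
    hence "sorted_wrt rightof (boxes L (a # b # v))" using V by simp
    thus ?thesis using rightof_hook[OF Cons.prems(1)] by blast
  next
    case C: (Cons x V')
    have B: "boxes (ins L a) (b # v) = V' @ e # H" "x = insbox L a" using V(1) C by simp_all
    have "insbox (ins L a) b \<in> set (V' @ [e])" using B(1) by (cases V') auto
    hence "below (insbox L a) (insbox (ins L a) b)" using V(2) C B(2) by auto
    hence ba: "b < a" using ascent_step[OF Cons.prems(1), of a b] not_below_rightof by (meson not_le)
    have "sorted_wrt below (V' @ [e])" using V(2) C by simp
    hence "vlist (boxes (ins L a) (b # v))" unfolding vlist_def B(1) using V(3) by blast
    then obtain ds us where *: "v = ds @ us" "sorted_wrt (>) (b # ds)" "sorted us"
      using Cons.IH[OF state_ok_ins[OF Cons.prems(1)]] by blast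
    have "sorted_wrt (>) (a # b # ds)" using *(2) ba by auto
    hence "b # v = (b # ds) @ us \<and> sorted_wrt (>) (a # b # ds) \<and> sorted us" using * by simp
    thus ?thesis by blast
  qed
qed

lemma hook_word_Cons: "hook_word (a # v) \<longleftrightarrow> (\<exists>ds us. v = ds @ us \<and> sorted_wrt (>) (a # ds) \<and> sorted us)"
proof
  assume "hook_word (a # v)"
  then obtain ds us where h: "a # v = ds @ us" "sorted_wrt (>) ds" "sorted us" unfolding hook_word_iff by blast
  show "\<exists>ds us. v = ds @ us \<and> sorted_wrt (>) (a # ds) \<and> sorted us"
  proof (cases ds)
    case Nil
    hence "v = [] @ v \<and> sorted_wrt (>) [a] \<and> sorted v" using h by auto
    thus ?thesis by blast
  next
    case (Cons d ds')
    hence "v = ds' @ us \<and> sorted_wrt (>) (a # ds') \<and> sorted us" using h by simp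
    thus ?thesis by blast
  qed
next
  assume "\<exists>ds us. v = ds @ us \<and> sorted_wrt (>) (a # ds) \<and> sorted us"
  then obtain ds us where "v = ds @ us" "sorted_wrt (>) (a # ds)" "sorted us" by blast
  hence "a # v = (a # ds) @ us \<and> sorted_wrt (>) (a # ds) \<and> sorted us" by simp
  thus "hook_word (a # v)" unfolding hook_word_iff by blast
qed

lemma hook_word_iff_vlist:
  assumes "state_ok L"
  shows "hook_word v \<longleftrightarrow> vlist (boxes L v)"
proof (cases v)
  case Nil
  thus ?thesis by (simp add: hook_word_iff vlist_def)
next
  case (Cons a v')
  show ?thesis
    unfolding Cons hook_word_Cons using hook_vlist[OF assms] vlist_hook[OF assms] by blast
qed

section \<open>The insertion tableau is a shifted Young tableau\<close>

lemma shape_strict: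
  assumes "rep T E" "ideal (fst ` E)"
  shows "strict_partition (shape T)"
proof -
  have ne: "[] \<notin> set T" and c: "cells T = fst ` E" using assms(1) by (auto simp: rep_def)
  have "length (T ! j) < length (T ! i)" if ij: "i < j" "j < length T" for i j
  proof -
    have "T ! j \<noteq> []" using ne ij(2) nth_mem by metis
    hence "(j, j + (length (T ! j) - 1)) \<in> cells T" using ij by (simp add: cells_iff)
    hence "(i, j + (length (T ! j) - 1)) \<in> cells T" using ideal_down[OF assms(2)] ij unfolding c by simp
    thus ?thesis using ij \<open>T ! j \<noteq> []\<close> by (auto simp: cells_iff)
  qed
  hence "sorted_wrt (>) (shape T)" by (simp add: shape_def sorted_wrt_iff_nth_less)
  thus ?thesis using ne by (auto simp: strict_partition_def shape_def)
qed

text \<open>The chain of shapes adds the upper left box of the two first, and the list is sorted by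
  \<open>good\<close>.\<close>

lemma state_ok_order:
  assumes ok: "state_ok L" and m: "((r, c), x) \<in> set L" "((r', c'), y) \<in> set L"
    and le: "r \<le> r'" "c \<le> c'" "(r, c) \<noteq> (r', c')"
  shows "good ((r, c), x) ((r', c'), y)"
proof -
  have ch: "chain {} (map fst L)" and g: "sorted_wrt good L" using ok by (auto simp: state_ok_def)
  obtain L1 L2 where L: "L = L1 @ ((r', c'), y) # L2" using m(2) by (meson split_list)
  have c1: "chain {} (map fst L1)" "addable (set (map fst L1)) (r', c')"
    using ch by (auto simp: L chain_append)
  have "r \<le> c" using ideal_le[OF chain_ideal'[OF ch], of r c] m(1) by force
  hence "(r, c) \<in> set (map fst L1)" using addable_below[OF c1(2), of r c] le by simp
  then obtain x' where x': "((r, c), x') \<in> set L1" by auto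
  have "distinct (map fst L)" using chain_distinct[OF ch] by simp
  moreover have "((r, c), x') \<in> set L" using x' L by simp
  ultimately have "x' = x" using m(1) by (meson eq_key_imp_eq_value)
  thus ?thesis using g x' by (auto simp: L sorted_wrt_append)
qed

lemma syt_P_mix:
  assumes "\<forall>a\<in>set w. 1 \<le> a"
  shows "shifted_young_tableau (P_mix w)"
proof -
  define L where "L = foldl ins [] w"
  define T where "T = P_mix w"
  have ok: "state_ok L" unfolding L_def by (rule state_ok_foldl[OF state_ok_Nil])
  have R: "rep T (set L)" using mix_rep[of w] by (simp add: L_def T_def)
  have ch: "chain {} (map fst L)" and u: "\<forall>e\<in>set L. undiag e" using ok by (auto simp: state_ok_def)
  have id: "ideal (fst ` set L)" using chain_ideal'[OF ch] by simp
  have idx: "\<forall>e\<in>set L. 1 \<le> xidx (snd e)"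
  proof -
    have "\<forall>e\<in>set M. 1 \<le> xidx (snd e) \<Longrightarrow> \<forall>a\<in>set w. 1 \<le> a \<Longrightarrow> \<forall>e\<in>set (foldl ins M w). 1 \<le> xidx (snd e)" for M
    proof (induction w arbitrary: M)
      case (Cons a w)
      have "\<forall>e\<in>set (ins M a). 1 \<le> xidx (snd e)" using Cons.prems by (intro ins_xidx) auto
      from Cons.IH[OF this] show ?case using Cons.prems(2) by simp
    qed simp
    from this[of "[]"] show ?thesis using assms by (simp add: L_def)
  qed
  have en: "(b, ent T b) \<in> set L" if b: "b \<in> cells T" for b
  proof -
    obtain x where "(b, x) \<in> set L" using R b by (auto simp: rep_def)
    thus ?thesis using R by (auto simp: rep_def)
  qed
  have G: "good ((r, c), ent T (r, c)) ((r', c'), ent T (r', c'))"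
    if "(r, c) \<in> cells T" "(r', c') \<in> cells T" "r \<le> r'" "c \<le> c'" "(r, c) \<noteq> (r', c')" for r c r' c'
    using state_ok_order[OF ok en en] that by blast
  have sp: "strict_partition (shape T)" using shape_strict[OF R id] .
  have 1: "xidx (ent T b) \<ge> 1" if "b \<in> cells T" for b using idx en[OF that] by force
  have 2: "xkey (ent T (r, c)) \<le> xkey (ent T (r, c'))" if "(r, c) \<in> cells T" "(r, c') \<in> cells T" "c < c'" for r c c'
    using good_xkey[OF G[OF that(1,2)]] that(3) by simp
  have 3: "xkey (ent T (r, c)) \<le> xkey (ent T (r', c))" if "(r, c) \<in> cells T" "(r', c) \<in> cells T" "r < r'" for r r' c
    using good_xkey[OF G[OF that(1,2)]] that(3) by simp
  have 4: "primed (ent T (r, c))" if "(r, c) \<in> cells T" "(r', c) \<in> cells T" "r < r'" "ent T (r, c) = ent T (r', c)" for r r' c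
    using G[OF that(1,2)] that(3,4) by (auto simp: good_def rightof_def split: if_splits)
  have 5: "\<not> primed (ent T (r, c))" if "(r, c) \<in> cells T" "(r, c') \<in> cells T" "c < c'" "ent T (r, c) = ent T (r, c')" for r c c'
    using G[OF that(1,2)] that(3,4) by (auto simp: good_def below_def split: if_splits)
  have 6: "\<not> primed (ent T (r, r))" if "(r, r) \<in> cells T" for r
    using u en[OF that] by (force simp: undiag_def)
  show ?thesis unfolding shifted_young_tableau_def T_def[symmetric] using sp 1 2 3 4 5 6 by blast
qed

section \<open>Special recording tableaux\<close>

definition content :: "nat \<times> nat \<Rightarrow> nat" where
  "content b = snd b - fst b"

lemma chain_order:
  assumes "chain S (A @ B)" "x \<in> set B" "y \<in> set A"
  shows "\<not> (fst x \<le> fst y \<and> snd x \<le> snd y)"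
proof
  assume le: "fst x \<le> fst y \<and> snd x \<le> snd y"
  have i: "ideal (S \<union> set A)" "ideal (S \<union> set A \<union> set B)"
    using assms(1) chain_ideal' by (auto simp: chain_append)
  have "fst x \<le> snd x" using ideal_le[OF i(2), of "fst x" "snd x"] assms(2) by simp
  hence "(fst x, snd x) \<in> S \<union> set A" using ideal_down[OF i(1), of "fst y" "snd y" "fst x" "snd x"] le assms(3) by simp
  moreover have "set B \<inter> (S \<union> set A) = {}" using assms(1) chain_distinct by (auto simp: chain_append)
  ultimately show False using assms(2) by auto
qed

lemma below_row_inj: "sorted_wrt below xs \<Longrightarrow> x \<in> set xs \<Longrightarrow> y \<in> set xs \<Longrightarrow> fst x = fst y \<Longrightarrow> x = y"
  by (induction xs) (auto simp: below_def)

lemma rightof_col_inj: "sorted_wrt rightof xs \<Longrightarrow> x \<in> set xs \<Longrightarrow> y \<in> set xs \<Longrightarrow> snd x = snd y \<Longrightarrow> x = y"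
  by (induction xs) (auto simp: rightof_def)

text \<open>Two boxes \<open>p\<close> and \<open>q\<close> on one diagonal span a rectangle whose
  upper right corner \<open>m\<close> also belongs to the list. If \<open>m\<close> is in the
  vertical part, then \<open>p\<close>, in the same row, must come after \<open>m\<close> although
  it lies to its left; if \<open>m\<close> is in the horizontal part, then \<open>q\<close>, in the
  same column, must come before \<open>m\<close> although it lies underneath. Both contradict the
  order of a chain.\<close>

lemma vlist_content_inj:
  assumes ch: "chain S ys" and v: "vlist ys"
  shows "inj_on content (set ys)"
proof -
  obtain V e H where ys: "ys = V @ e # H" and sV: "sorted_wrt below (V @ [e])" and sH: "sorted_wrt rightof (e # H)"
    using v by (auto simp: vlist_def)
  have i: "ideal (S \<union> set ys)" using chain_ideal'[OF ch] .
  have iS: "ideal S" using chain_ideal[OF ch] .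
  have dj: "set ys \<inter> S = {}" using chain_distinct[OF ch] by simp
  have le: "fst b \<le> snd b" if "b \<in> set ys" for b using ideal_le[OF i, of "fst b" "snd b"] that by simp
  have *: False if p: "p \<in> set ys" and q: "q \<in> set ys" and lt: "fst p < fst q" "snd p < snd q" for p q
  proof -
    define m where "m = (fst p, snd q)"
    have "fst p \<le> snd q" using le[OF p] lt by simp
    hence mi: "m \<in> S \<union> set ys" using ideal_down[OF i, of "fst q" "snd q" "fst p" "snd q"] q lt by (simp add: m_def)
    have "m \<notin> S"
    proof
      assume "m \<in> S"
      hence "(fst p, snd p) \<in> S" using ideal_down[OF iS, of "fst p" "snd q" "fst p" "snd p"] lt le[OF p] by (simp add: m_def)
      thus False using p dj by auto
    qed
    hence m: "m \<in> set ys" using mi by simp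
    show False
    proof (cases "m \<in> set (V @ [e])")
      case True
      have "p \<noteq> m" using lt by (auto simp: m_def prod_eq_iff)
      hence "p \<notin> set (V @ [e])" using below_row_inj[OF sV True, of p] by (auto simp: m_def)
      hence "p \<in> set H" using p by (auto simp: ys)
      moreover have "chain S ((V @ [e]) @ H)" using ch by (simp add: ys)
      ultimately show False using chain_order[OF _ _ True, of S H p] lt by (simp add: m_def)
    next
      case False
      hence mH: "m \<in> set (e # H)" using m by (auto simp: ys)
      have "q \<noteq> m" using lt by (auto simp: m_def prod_eq_iff)
      hence "q \<notin> set (e # H)" using rightof_col_inj[OF sH mH, of q] by (auto simp: m_def)
      hence "q \<in> set V" using q by (auto simp: ys)
      moreover have "chain S (V @ (e # H))" using ch by (simp add: ys)
      ultimately show False using chain_order[OF _ mH, of S V q] lt by (simp add: m_def)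
    qed
  qed
  show ?thesis
  proof (rule inj_onI)
    fix p q assume pq: "p \<in> set ys" "q \<in> set ys" "content p = content q"
    have "snd p = content p + fst p" "snd q = content q + fst q"
      using le[OF pq(1)] le[OF pq(2)] by (simp_all add: content_def)
    hence eq: "snd p + fst q = snd q + fst p" using pq(3) by simp
    consider "fst p = fst q" | "fst p < fst q" | "fst q < fst p" by linarith
    thus "p = q"
    proof cases
      case 1 thus ?thesis using eq by (simp add: prod_eq_iff)
    next
      case 2
      hence "snd p < snd q" using eq by linarith
      thus ?thesis using *[OF pq(1,2) 2] by simp
    next
      case 3
      hence "snd q < snd p" using eq by linarith
      thus ?thesis using *[OF pq(2,1) 3] by simp
    qed
  qed
qed

text \<open>Moving up along its diagonal, every box reaches the first row; hence the length of that
  row bounds all contents.\<close>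

lemma content_ideal:
  assumes "ideal N" "b \<in> N" shows "(0, content b) \<in> N"
  using ideal_down[OF assms(1), of "fst b" "snd b" 0 "content b"] assms(2) by (simp add: content_def)

definition push :: "nat \<Rightarrow> (nat \<times> nat) set \<Rightarrow> (nat \<times> nat) set" where
  "push n M = {(0, c) | c. c < n} \<union> {(Suc r, Suc c) | r c. (r, c) \<in> M}"

lemma push_0: "(0, c) \<in> push n M \<longleftrightarrow> c < n"
  and push_Suc: "(Suc r, Suc c) \<in> push n M \<longleftrightarrow> (r, c) \<in> M"
  and push_Suc_0: "(Suc r, 0) \<notin> push n M"
  by (auto simp: push_def)

text \<open>Boxes of contents \<open>0, \<dots>, n - 1\<close>, each occurring once, extend each of the first \<open>n\<close> diagonals by one box.\<close>

lemma push_full: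
  assumes ch: "chain M ys" and inj: "inj_on content (set ys)" and im: "content ` set ys = {0..<n}"
    and M0: "\<And>c. (0, c) \<in> M \<Longrightarrow> c < n"
  shows "M \<union> set ys = push n M"
proof -
  define N where "N = M \<union> set ys"
  have iM: "ideal M" and iN: "ideal N" using chain_ideal[OF ch] chain_ideal'[OF ch] by (simp_all add: N_def)
  have dj: "set ys \<inter> M = {}" using chain_distinct[OF ch] by simp
  have N0: "c < n" if "(0, c) \<in> N" for c
  proof (cases "(0, c) \<in> M")
    case False
    hence "content (0, c) \<in> {0..<n}" using that im by (auto simp: N_def)
    thus ?thesis by (simp add: content_def)
  qed (rule M0)
  have big: "k < n" if "(r, r + k) \<in> N" for r k
    using N0[of k] content_ideal[OF iN that] by (simp add: content_def)
  \<comment> \<open>On the diagonal of content \<open>k\<close>, the number \<open>s\<close> counts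
    the old boxes, and the new box is \<open>(s, s + k)\<close>.\<close>
  have diag: "\<exists>s. (\<forall>r. ((r, r + k) \<in> M \<longleftrightarrow> r < s) \<and> ((r, r + k) \<in> N \<longleftrightarrow> r \<le> s))" if "k < n" for k
  proof -
    have "k \<in> content ` set ys" using that im by simp
    then obtain y where y: "y \<in> set ys" "content y = k" by auto
    define s where "s = fst y"
    have "fst y \<le> snd y" using ideal_le[OF iN, of "fst y" "snd y"] y by (simp add: N_def)
    hence ys: "y = (s, s + k)" using y(2) by (simp add: s_def content_def prod_eq_iff)
    have sN: "(s, s + k) \<in> N" and sM: "(s, s + k) \<notin> M" using y(1) ys dj by (auto simp: N_def)
    have 1: "(r, r + k) \<in> N" if "r \<le> s" for r using ideal_down[OF iN sN, of r "r + k"] that by simp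
    have 2: "(r, r + k) \<notin> M" if "s \<le> r" for r using ideal_down[OF iM, of r "r + k" s "s + k"] that sM by auto
    have 3: "(r, r + k) \<in> M" if "(r, r + k) \<in> N" "r \<noteq> s" for r
    proof (rule ccontr)
      assume "(r, r + k) \<notin> M"
      hence "(r, r + k) \<in> set ys" using that by (simp add: N_def)
      moreover have "content (r, r + k) = content y" using y(2) by (simp add: content_def)
      ultimately have "(r, r + k) = y" using inj y(1) by (meson inj_onD)
      thus False using that(2) ys by simp
    qed
    have "((r, r + k) \<in> M \<longleftrightarrow> r < s) \<and> ((r, r + k) \<in> N \<longleftrightarrow> r \<le> s)" for r
    proof -
      consider "r < s" | "r = s" | "s < r" by linarith
      thus ?thesis
      proof cases
        case 1 thus ?thesis using 1 \<open>\<And>r. r \<le> s \<Longrightarrow> (r, r + k) \<in> N\<close> 3[of r] by simp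
      next
        case 2 thus ?thesis using sN sM by simp
      next
        case c3: 3 thus ?thesis using 2[of r] 3[of r] by auto
      qed
    qed
    thus ?thesis by blast
  qed
  have S: "(Suc r, Suc r + k) \<in> N \<longleftrightarrow> (r, r + k) \<in> M" for r k
  proof (cases "k < n")
    case True
    then obtain s where "\<forall>r. ((r, r + k) \<in> M \<longleftrightarrow> r < s) \<and> ((r, r + k) \<in> N \<longleftrightarrow> r \<le> s)" using diag by blast
    thus ?thesis by (metis Suc_le_eq)
  next
    case False
    thus ?thesis using big[of "Suc r" k] big[of r k] by (auto simp: N_def)
  qed
  have Z: "(0, c) \<in> N \<longleftrightarrow> c < n" for c
  proof
    assume "c < n"
    then obtain s where "\<forall>r. ((r, r + c) \<in> M \<longleftrightarrow> r < s) \<and> ((r, r + c) \<in> N \<longleftrightarrow> r \<le> s)" using diag by blast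
    hence "(0, 0 + c) \<in> N" by blast
    thus "(0, c) \<in> N" by simp
  qed (rule N0)
  have "b \<in> N \<longleftrightarrow> b \<in> push n M" for b
  proof (cases b)
    case (Pair r c)
    show ?thesis
    proof (cases r)
      case 0
      thus ?thesis using Z Pair push_0 by simp
    next
      case (Suc r')
      show ?thesis
      proof (cases c)
        case 0
        thus ?thesis using Pair Suc push_Suc_0 ideal_le[OF iN, of r c] by auto
      next
        case c: (Suc c')
        show ?thesis
        proof (cases "r' \<le> c'")
          case True
          hence "c' = r' + (c' - r')" "Suc c' = Suc r' + (c' - r')" by simp_all
          thus ?thesis using S[of r' "c' - r'"] Pair Suc c push_Suc by metis
        next
          case False
          hence "(r, c) \<notin> N" "(r', c') \<notin> M" using ideal_le[OF iN, of r c] ideal_le[OF iM, of r' c'] Suc c by auto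
          thus ?thesis using Pair Suc c push_Suc by simp
        qed
      qed
    qed
  qed
  thus ?thesis by (auto simp: N_def)
qed

section \<open>Box lists of special recording tableaux and their uniqueness\<close>

fun diagram :: "nat list \<Rightarrow> (nat \<times> nat) set" where
  "diagram [] = {}"
| "diagram (n # lam) = push n (diagram lam)"

lemma diagram_iff: "(r, c) \<in> diagram lam \<longleftrightarrow> r < length lam \<and> r \<le> c \<and> c < r + lam ! r"
proof (induction lam arbitrary: r c)
  case (Cons n lam)
  show ?case
  proof (cases r)
    case 0
    thus ?thesis by (simp add: push_0)
  next
    case (Suc r')
    thus ?thesis using Cons.IH by (cases c) (simp_all add: push_Suc push_Suc_0)
  qed
qed simp

lemma cells_diagram: "cells T = diagram (shape T)"
proof (rule set_eqI)
  fix b :: "nat \<times> nat"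
  obtain r c where "b = (r, c)" by (cases b)
  thus "b \<in> cells T \<longleftrightarrow> b \<in> diagram (shape T)" by (auto simp: cells_iff diagram_iff shape_def)
qed

text \<open>The boxes of a special recording tableau in the order of their entries. The first part
  of \<open>lam\<close> belongs to the last block, so the recursion removes the end of the list.
  Connectedness of the vee is replaced by the condition that the block completes the
  diagram.\<close>

fun special_list :: "nat list \<Rightarrow> (nat \<times> nat) list \<Rightarrow> bool" where
  "special_list [] zs \<longleftrightarrow> zs = []"
| "special_list (n # lam) zs \<longleftrightarrow> (\<exists>xs ys. zs = xs @ ys \<and> special_list lam xs \<and> length ys = n \<and> vlist ys \<and>
     chain (diagram lam) ys \<and> diagram lam \<union> set ys = diagram (n # lam))"

lemma special_list_chain: "special_list lam zs \<Longrightarrow> set zs = diagram lam \<and> chain {} zs"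
proof (induction lam arbitrary: zs)
  case (Cons n lam)
  then obtain xs ys where "zs = xs @ ys" "special_list lam xs" "chain (diagram lam) ys"
    "diagram lam \<union> set ys = diagram (n # lam)" by auto
  thus ?case using Cons.IH[of xs] by (auto simp: chain_append)
qed simp

lemma special_list_length: "special_list lam zs \<Longrightarrow> length zs = sum_list lam"
proof (induction lam arbitrary: zs)
  case (Cons n lam)
  then obtain xs ys where "zs = xs @ ys" "special_list lam xs" "length ys = n" by auto
  thus ?case using Cons.IH[of xs] by simp
qed simp

lemma sorted_wrt_unique:
  assumes "\<And>x y. P x y \<Longrightarrow> \<not> P y x"
  shows "sorted_wrt P xs \<Longrightarrow> sorted_wrt P ys \<Longrightarrow> set xs = set ys \<Longrightarrow> xs = ys"
proof (induction xs arbitrary: ys)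
  case (Cons x xs)
  obtain y ys' where ys: "ys = y # ys'" using Cons.prems(3) by (cases ys) auto
  have "x = y"
  proof (rule ccontr)
    assume "x \<noteq> y"
    hence "x \<in> set ys'" "y \<in> set xs" using Cons.prems(3) ys by auto
    hence "P y x" "P x y" using Cons.prems(1,2) ys by auto
    thus False using assms by blast
  qed
  moreover have "x \<notin> set xs" "y \<notin> set ys'" using Cons.prems(1,2) ys assms by auto
  ultimately have "set xs = set ys'" using Cons.prems(3) ys by auto
  thus ?case using Cons.IH[of ys'] Cons.prems(1,2) ys \<open>x = y\<close> by simp
qed simp

text \<open>If the left neighbour is an old box, its shift along the diagonal is the lower neighbour
  of \<open>b\<close>, and this one is new because \<open>b\<close> is. So contents descend to 0 in
  single steps inside the block.\<close>

lemma block_neighbour: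
  assumes ch: "chain M ys" and full: "M \<union> set ys = push n M" and b: "b \<in> set ys" "0 < content b"
  shows "(Suc (fst b), snd b) \<in> set ys \<or> (fst b, snd b - 1) \<in> set ys"
proof -
  have iM: "ideal M" and iN: "ideal (push n M)" using chain_ideal[OF ch] chain_ideal'[OF ch] full by simp_all
  have dj: "set ys \<inter> M = {}" using chain_distinct[OF ch] by simp
  have lt: "fst b < snd b" using b(2) by (simp add: content_def)
  show ?thesis
  proof (cases "(fst b, snd b - 1) \<in> M")
    case False
    have "b \<in> push n M" using b(1) full by blast
    hence "(fst b, snd b - 1) \<in> push n M" using ideal_down[OF iN, of "fst b" "snd b" "fst b" "snd b - 1"] lt by simp
    thus ?thesis using False full by blast
  next
    case True
    have "(Suc (fst b), snd b) \<in> push n M" using True lt push_Suc[of "fst b" "snd b - 1" n M] by simp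
    moreover have "(Suc (fst b), snd b) \<notin> M"
    proof
      assume "(Suc (fst b), snd b) \<in> M"
      hence "(fst b, snd b) \<in> M" using ideal_down[OF iM, of "Suc (fst b)" "snd b" "fst b" "snd b"] lt by simp
      thus False using b(1) dj by auto
    qed
    ultimately show ?thesis using full by blast
  qed
qed

text \<open>By the order of the chain, a box whose lower neighbour is in the block belongs to
  \<open>V\<close>, one whose left neighbour is in the block belongs to \<open>H\<close>. Every box
  of positive content has such a neighbour, so the pivot has content 0, and the set of boxes alone
  determines both strips.\<close>

lemma vlist_parts:
  assumes ch: "chain M ys" and full: "M \<union> set ys = push n M"
    and ys: "ys = V @ e # H" and sV: "sorted_wrt below (V @ [e])" and sH: "sorted_wrt rightof (e # H)"
  shows "content e = 0" "set V = {b \<in> set ys. (Suc (fst b), snd b) \<in> set ys}"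
proof -
  have d: "distinct ys" using chain_distinct[OF ch] by simp
  have v: "vlist ys" unfolding vlist_def using ys sV sH by blast
  note inj = vlist_content_inj[OF ch v]
  have lower: "b \<in> set V" if b: "b \<in> set ys" "(Suc (fst b), snd b) \<in> set ys" for b
  proof (rule ccontr)
    assume "b \<notin> set V"
    hence bH: "b \<in> set (e # H)" using b(1) by (auto simp: ys)
    have "chain M (V @ (e # H))" using ch by (simp add: ys)
    hence "(Suc (fst b), snd b) \<notin> set V" using chain_order[OF _ bH, of M V "(Suc (fst b), snd b)"] by auto
    hence "(Suc (fst b), snd b) \<in> set (e # H)" using b(2) by (auto simp: ys)
    from rightof_col_inj[OF sH bH this] have "b = (Suc (fst b), snd b)" unfolding snd_conv by blast
    moreover have "b \<noteq> (Suc (fst b), snd b)" by (cases b) simp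
    ultimately show False by blast
  qed
  have left: "b \<in> set H" if b: "b \<in> set ys" "(fst b, snd b - 1) \<in> set ys" "0 < snd b" for b
  proof (rule ccontr)
    assume "b \<notin> set H"
    hence bV: "b \<in> set (V @ [e])" using b(1) by (auto simp: ys)
    have "chain M ((V @ [e]) @ H)" using ch by (simp add: ys)
    hence "(fst b, snd b - 1) \<notin> set H" using chain_order[OF _ _ bV, of M H "(fst b, snd b - 1)"] by auto
    hence "(fst b, snd b - 1) \<in> set (V @ [e])" using b(2) by (auto simp: ys)
    from below_row_inj[OF sV bV this] have "b = (fst b, snd b - 1)" unfolding fst_conv by blast
    moreover have "b \<noteq> (fst b, snd b - 1)" using b(3) by (cases b) simp
    ultimately show False by blast
  qed
  note nbr = block_neighbour[OF ch full]
  have pos: "0 < snd b" if "0 < content b" for b using that by (simp add: content_def)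
  show e0: "content e = 0"
  proof (rule ccontr)
    assume "content e \<noteq> 0"
    hence c: "0 < content e" by simp
    have eys: "e \<in> set ys" by (simp add: ys)
    have "e \<in> set V \<or> e \<in> set H" using nbr[OF eys c] lower[OF eys] left[OF eys _ pos[OF c]] by blast
    thus False using d by (auto simp: ys)
  qed
  show "set V = {b \<in> set ys. (Suc (fst b), snd b) \<in> set ys}"
  proof (intro set_eqI iffI)
    fix b assume b: "b \<in> set V"
    hence yb: "b \<in> set ys" by (simp add: ys)
    have "b \<noteq> e" "b \<notin> set H" using d b by (auto simp: ys)
    have "content b \<noteq> content e" using inj yb \<open>b \<noteq> e\<close> by (auto simp: ys inj_on_def)
    hence c: "0 < content b" using e0 by simp
    thus "b \<in> {b \<in> set ys. (Suc (fst b), snd b) \<in> set ys}"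
      using yb nbr[OF yb c] left[OF yb] pos[OF c] \<open>b \<notin> set H\<close> by blast
  next
    fix b assume "b \<in> {b \<in> set ys. (Suc (fst b), snd b) \<in> set ys}"
    thus "b \<in> set V" using lower by blast
  qed
qed

text \<open>The boxes determine the pivot and the strips by \<open>vlist_parts\<close>, and each
  strip can be listed in one order only.\<close>

lemma block_unique:
  assumes 1: "chain M ys" "vlist ys" "M \<union> set ys = push n M"
    and 2: "chain M zs" "vlist zs" "M \<union> set zs = push n M"
  shows "ys = zs"
proof -
  have s: "set ys = set zs"
    using chain_distinct[OF 1(1)] chain_distinct[OF 2(1)] 1(3) 2(3) by blast
  obtain V e H where y: "ys = V @ e # H" "sorted_wrt below (V @ [e])" "sorted_wrt rightof (e # H)"
    using 1(2) by (auto simp: vlist_def)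
  obtain V' e' H' where z: "zs = V' @ e' # H'" "sorted_wrt below (V' @ [e'])" "sorted_wrt rightof (e' # H')"
    using 2(2) by (auto simp: vlist_def)
  note py = vlist_parts[OF 1(1,3) y] and pz = vlist_parts[OF 2(1,3) z]
  have "e \<in> set ys" by (simp add: y(1))
  moreover have "e' \<in> set ys" unfolding s by (simp add: z(1))
  ultimately have ee: "e = e'" using vlist_content_inj[OF 1(1,2)] py(1) pz(1) by (metis inj_onD)
  have sV: "set V = set V'" using py(2) pz(2) s by simp
  moreover have "V = V'" using sorted_wrt_unique[of below V V'] y(2) z(2) sV
    by (auto simp: sorted_wrt_append below_def)
  moreover have "set H = set H'"
  proof -
    have "distinct ys" "distinct zs" using chain_distinct 1(1) 2(1) by blast+
    hence "set H = set ys - set V - {e}" "set H' = set zs - set V' - {e'}" by (auto simp: y(1) z(1))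
    thus ?thesis using s sV ee by simp
  qed
  hence "H = H'" using sorted_wrt_unique[of rightof H H'] y(3) z(3) by (auto simp: rightof_def)
  ultimately show ?thesis by (simp add: y(1) z(1) ee)
qed

lemma special_list_unique: "special_list lam zs \<Longrightarrow> special_list lam zs' \<Longrightarrow> zs = zs'"
proof (induction lam arbitrary: zs zs')
  case (Cons n lam)
  obtain xs ys where 1: "zs = xs @ ys" "special_list lam xs" "vlist ys" "chain (diagram lam) ys"
    "diagram lam \<union> set ys = push n (diagram lam)" using Cons.prems(1) by auto
  obtain xs' ys' where 2: "zs' = xs' @ ys'" "special_list lam xs'" "vlist ys'" "chain (diagram lam) ys'"
    "diagram lam \<union> set ys' = push n (diagram lam)" using Cons.prems(2) by auto
  show ?case using Cons.IH[OF 1(2) 2(2)] block_unique[OF 1(4,3,5) 2(4,3,5)] 1(1) 2(1) by simp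
qed simp

section \<open>Existence of special lists\<close>

lemma chain_build:
  assumes "ideal T"
    and "\<And>A b B. ys = A @ b # B \<Longrightarrow> b \<notin> T \<union> set A \<and> fst b \<le> snd b \<and>
      (0 < fst b \<longrightarrow> (fst b - 1, snd b) \<in> T \<union> set A) \<and> (fst b < snd b \<longrightarrow> (fst b, snd b - 1) \<in> T \<union> set A)"
  shows "chain T ys"
  using assms
proof (induction ys arbitrary: T)
  case (Cons b ys)
  obtain r c where b: "b = (r, c)" by (cases b)
  have "addable T (r, c)" using Cons.prems(2)[of "[]" b ys] b by (intro addableI[OF Cons.prems(1)]) auto
  hence ad: "addable T b" by (simp add: b)
  have "chain (insert b T) ys"
  proof (rule Cons.IH[OF addable_ideal'[OF ad]])
    fix A b' B assume "ys = A @ b' # B"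
    hence "b # ys = (b # A) @ b' # B" by simp
    from Cons.prems(2)[OF this] show "b' \<notin> insert b T \<union> set A \<and> fst b' \<le> snd b' \<and>
      (0 < fst b' \<longrightarrow> (fst b' - 1, snd b') \<in> insert b T \<union> set A) \<and>
      (fst b' < snd b' \<longrightarrow> (fst b', snd b' - 1) \<in> insert b T \<union> set A)" by simp
  qed
  thus ?case using ad by simp
qed simp

text \<open>Each row is shorter than the one above it by at least one, while it starts one column
  further right; so the right ends of the rows never move to the right on the way down.\<close>

lemma rowlen_step:
  fixes m :: "nat \<Rightarrow> nat"
  assumes "\<And>r. r < l \<Longrightarrow> m (Suc r) < m r" and "r \<le> r'" "r' \<le> l"
  shows "r' + m r' \<le> r + m r"
  using assms(2,3)
proof (induction r' rule: dec_induct)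
  case (step k)
  have "m (Suc k) < m k" using assms(1) step by simp
  thus ?case using step by simp
qed simp

lemma finite_diagram: "finite (diagram lam)"
proof (induction lam)
  case (Cons n lam)
  have "diagram (n # lam) \<subseteq> Pair 0 ` {..<n} \<union> map_prod Suc Suc ` diagram lam"
    by (auto simp: push_def image_iff)
  thus ?case using Cons finite_subset by blast
qed simp

text \<open>The block is written down explicitly. The first new box of each row, read downwards,
  gives the vertical strip, which ends in the new diagonal box \<open>(l, l)\<close>; the remaining
  new boxes, row by row from the bottom, give the horizontal strip.\<close>

lemma special_block_exists:
  assumes sp: "strict_partition (n # lam)"
  shows "\<exists>ys. length ys = n \<and> vlist ys \<and> chain (diagram lam) ys \<and> diagram lam \<union> set ys = diagram (n # lam)"
proof -
  define l where "l = length lam"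
  \<comment> \<open>\<open>m\<close> and \<open>k\<close> are the row lengths of the old and the new
    diagram: below its first row, the new diagram is the old one shifted along the diagonal.\<close>
  define m where "m r = (if r < l then lam ! r else 0)" for r
  define k where "k r = (if r = 0 then n else m (r - 1))" for r
  define M where "M = diagram lam"
  define N where "N = diagram (n # lam)"
  have mk: "m r < k r" if "r \<le> l" for r
  proof (cases r)
    case 0
    have "0 \<notin> set (n # lam)" "\<forall>x\<in>set lam. x < n" using sp by (auto simp: strict_partition_def)
    thus ?thesis using 0 by (cases lam) (auto simp: k_def m_def l_def)
  next
    case (Suc r')
    have r': "r' < l" using that Suc by simp
    show ?thesis
    proof (cases "r < l")
      case True
      have "sorted_wrt (>) lam" using sp by (simp add: strict_partition_def)
      hence "lam ! r < lam ! r'" using True Suc by (auto simp: sorted_wrt_iff_nth_less l_def)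
      thus ?thesis using True r' Suc by (simp add: k_def m_def)
    next
      case False
      have "lam ! r' \<noteq> 0"
      proof
        assume "lam ! r' = 0"
        hence "0 \<in> set lam" using nth_mem[of r' lam] r' by (simp add: l_def)
        thus False using sp by (simp add: strict_partition_def)
      qed
      thus ?thesis using False r' Suc by (simp add: k_def m_def)
    qed
  qed
  have ms: "m (Suc r) < m r" if "r < l" for r using mk[of "Suc r"] that by (simp add: k_def)
  have mono: "r' + m r' \<le> r + m r" if "r \<le> r'" "r' \<le> l" for r r' by (rule rowlen_step[of l m, OF ms that])
  have ml: "m r = 0" if "l \<le> r" for r using that by (simp add: m_def)
  have inM: "(r, c) \<in> M \<longleftrightarrow> r \<le> c \<and> c < r + m r" for r c
    by (auto simp: M_def diagram_iff m_def l_def)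
  have inN: "(r, c) \<in> N \<longleftrightarrow> r \<le> c \<and> c < r + k r \<and> r \<le> l" for r c
    unfolding N_def diagram_iff by (cases r) (auto simp: k_def m_def l_def)
  have MN: "M \<subseteq> N"
  proof
    fix b assume "b \<in> M"
    hence b: "fst b \<le> snd b" "snd b < fst b + m (fst b)" using inM[of "fst b" "snd b"] by simp_all
    hence "m (fst b) \<noteq> 0" by auto
    hence "fst b \<le> l" using ml[of "fst b"] by (cases "l \<le> fst b") auto
    hence "(fst b, snd b) \<in> N" using b inN[of "fst b" "snd b"] mk[of "fst b"] by simp
    thus "b \<in> N" by simp
  qed
  have finM: "finite M" unfolding M_def by (rule finite_diagram)
  have iM: "ideal M"
    unfolding ideal_def
  proof (intro conjI allI impI)
    show "finite M" by (rule finM)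
  next
    fix r c assume "(r, c) \<in> M" thus "r \<le> c" using inM by simp
  next
    fix r c r' c' assume *: "(r, c) \<in> M" "r' \<le> r" "c' \<le> c" "r' \<le> c'"
    have "r < l" using *(1) ml[of r] inM[of r c] by (cases "l \<le> r") auto
    hence "r + m r \<le> r' + m r'" using mono *(2) by simp
    thus "(r', c') \<in> M" using * inM by auto
  qed
  define V where "V = map (\<lambda>r. (r, r + m r)) [0..<l]"
  define e where "e = (l, l)"
  define Hr where "Hr r = map (Pair r) [Suc (r + m r)..<r + k r]" for r
  define H where "H = concat (map Hr (rev [0..<Suc l]))"
  define ys where "ys = V @ e # H"
  have Ve: "V @ [e] = map (\<lambda>r. (r, r + m r)) [0..<Suc l]" using ml[of l] by (simp add: V_def e_def)
  have inVe: "b \<in> set (V @ [e]) \<longleftrightarrow> fst b \<le> l \<and> snd b = fst b + m (fst b)" for b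
    unfolding Ve by (cases b) (auto simp: image_iff simp del: upt_Suc)
  have inH: "b \<in> set H \<longleftrightarrow> fst b \<le> l \<and> fst b + m (fst b) < snd b \<and> snd b < fst b + k (fst b)" for b
    by (cases b) (auto simp: H_def Hr_def image_iff less_Suc_eq_le simp del: upt_Suc)
  have sV: "sorted_wrt below (V @ [e])"
  proof -
    have "sorted_wrt (\<lambda>r r'. below (r, r + m r) (r', r' + m r')) [0..<Suc l]"
    proof (rule sorted_wrt_mono_rel[OF _ sorted_wrt_upt])
      fix r r' assume "r \<in> set [0..<Suc l]" "r' \<in> set [0..<Suc l]" "r < r'"
      thus "below (r, r + m r) (r', r' + m r')" using mono[of r r'] by (simp add: below_def del: upt_Suc)
    qed
    thus ?thesis unfolding Ve sorted_wrt_map .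
  qed
  have sHj: "sorted_wrt rightof (concat (map Hr (rev [0..<j])))" if "j \<le> Suc l" for j
    using that
  proof (induction j)
    case (Suc j)
    have "sorted_wrt rightof (Hr j)"
    proof -
      have "sorted_wrt (\<lambda>c c'. rightof (j, c) (j, c')) [Suc (j + m j)..<j + k j]"
        by (rule sorted_wrt_mono_rel[OF _ sorted_wrt_upt]) (simp add: rightof_def)
      thus ?thesis unfolding Hr_def sorted_wrt_map .
    qed
    moreover have "rightof x y" if x: "x \<in> set (Hr j)" and y: "y \<in> set (concat (map Hr (rev [0..<j])))" for x y
    proof -
      obtain r' where r': "r' < j" "y \<in> set (Hr r')" using y by auto
      have "fst x = j" "snd x < j + k j" using x by (auto simp: Hr_def)
      moreover have "fst y = r'" "r' + m r' < snd y" using r'(2) by (auto simp: Hr_def)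
      moreover have "j + k j = Suc (j - 1 + m (j - 1))" using r'(1) by (simp add: k_def)
      moreover have "j - 1 + m (j - 1) \<le> r' + m r'" using mono[of r' "j - 1"] r'(1) Suc.prems by simp
      ultimately show ?thesis using r'(1) by (simp add: rightof_def)
    qed
    ultimately show ?case using Suc by (simp add: sorted_wrt_append)
  qed simp
  have sH: "sorted_wrt rightof (e # H)"
  proof -
    have "rightof e x" if "x \<in> set H" for x
      using that mono[of "fst x" l] unfolding inH by (auto simp: rightof_def e_def)
    thus ?thesis using sHj[of "Suc l"] by (simp add: H_def)
  qed
  have v: "vlist ys" unfolding vlist_def ys_def using sV sH by blast
  have setys: "b \<in> set ys \<longleftrightarrow> fst b \<le> l \<and> fst b + m (fst b) \<le> snd b \<and> snd b < fst b + k (fst b)" for b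
  proof -
    have "b \<in> set ys \<longleftrightarrow> b \<in> set (V @ [e]) \<or> b \<in> set H" by (auto simp: ys_def)
    thus ?thesis unfolding inVe inH using mk[of "fst b"] by auto
  qed
  have NM: "N = M \<union> set ys"
  proof (rule set_eqI)
    fix b :: "nat \<times> nat"
    obtain r c where b: "b = (r, c)" by (cases b)
    show "b \<in> N \<longleftrightarrow> b \<in> M \<union> set ys"
      unfolding b Un_iff setys inM inN using MN[THEN subsetD, of "(r, c)", unfolded inM inN] by auto
  qed
  have dj: "set ys \<inter> M = {}"
  proof -
    have "b \<notin> M" if "b \<in> set ys" for b using that inM[of "fst b" "snd b"] unfolding setys by simp
    thus ?thesis by blast
  qed
  \<comment> \<open>Implied by both strip orders: a later box is never weakly above and left of an
    earlier one. This is what makes the list a chain.\<close>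
  define R where "R x y \<longleftrightarrow> \<not> (fst y \<le> fst x \<and> snd y \<le> snd x)" for x y :: "nat \<times> nat"
  have sR: "sorted_wrt R ys"
  proof -
    have "sorted_wrt R (V @ [e])" by (rule sorted_wrt_mono_rel[OF _ sV]) (auto simp: R_def below_def)
    moreover have "sorted_wrt R (e # H)" by (rule sorted_wrt_mono_rel[OF _ sH]) (auto simp: R_def rightof_def)
    moreover have "R x y" if "x \<in> set V" "y \<in> set H" for x y
    proof -
      have x: "fst x \<le> l" "snd x = fst x + m (fst x)" using inVe[of x] that(1) by auto
      have y: "fst y + m (fst y) < snd y" using inH[of y] that(2) by simp
      show ?thesis unfolding R_def using mono[of "fst y" "fst x"] x y by auto
    qed
    ultimately show ?thesis unfolding ys_def by (auto simp: sorted_wrt_append)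
  qed
  have ch: "chain M ys"
  proof (rule chain_build[OF iM])
    fix A b B assume spl: "ys = A @ b # B"
    have bys: "b \<in> set ys" by (simp add: spl)
    have early: "x \<in> M \<union> set A" if "x \<in> N" "fst x \<le> fst b" "snd x \<le> snd b" "x \<noteq> b" for x
    proof (rule ccontr)
      assume "x \<notin> M \<union> set A"
      hence "x \<in> set B" using that(1,4) NM spl by auto
      hence "R b x" using sR by (simp add: spl sorted_wrt_append)
      thus False using that by (simp add: R_def)
    qed
    have b: "fst b \<le> l" "fst b + m (fst b) \<le> snd b" "snd b < fst b + k (fst b)" using bys setys by auto
    have "b \<notin> set A"
    proof
      assume "b \<in> set A"
      hence "R b b" using sR by (simp add: spl sorted_wrt_append)
      thus False by (simp add: R_def)
    qed
    moreover have "(fst b - 1, snd b) \<in> M \<union> set A" if p: "0 < fst b"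
    proof (rule early)
      have "k (fst b) = m (fst b - 1)" using p by (simp add: k_def)
      moreover have "m (fst b - 1) < k (fst b - 1)" by (rule mk) (use b in simp)
      ultimately have "snd b < fst b - 1 + k (fst b - 1)" using b(3) p by linarith
      thus "(fst b - 1, snd b) \<in> N" unfolding inN using b(1,2) by (intro conjI) linarith+
      show "(fst b - 1, snd b) \<noteq> b" using p by (cases b) auto
    qed auto
    moreover have "(fst b, snd b - 1) \<in> M \<union> set A" if p: "fst b < snd b"
    proof (rule early)
      show "(fst b, snd b - 1) \<in> N" unfolding inN using b p by auto
      show "(fst b, snd b - 1) \<noteq> b" using p by (cases b) auto
    qed auto
    ultimately show "b \<notin> M \<union> set A \<and> fst b \<le> snd b \<and>
      (0 < fst b \<longrightarrow> (fst b - 1, snd b) \<in> M \<union> set A) \<and> (fst b < snd b \<longrightarrow> (fst b, snd b - 1) \<in> M \<union> set A)"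
      using bys dj b by auto
  qed
  have "content ` set ys = {0..<n}"
  proof (intro set_eqI iffI)
    fix x assume "x \<in> content ` set ys"
    then obtain b where b: "b \<in> set ys" "x = content b" by blast
    have "(0, x) \<in> N" using content_ideal[OF chain_ideal'[OF ch], of b] b NM by simp
    thus "x \<in> {0..<n}" using inN[of 0 x] by (simp add: k_def)
  next
    fix x assume x: "x \<in> {0..<n}"
    \<comment> \<open>On the diagonal of content \<open>x\<close>, the new box lies in the first row
      whose old length is at most \<open>x\<close>.\<close>
    define r where "r = (LEAST r. m r \<le> x)"
    have r: "m r \<le> x" unfolding r_def by (rule LeastI[of _ l]) (simp add: ml)
    have "r \<le> l" unfolding r_def by (rule Least_le) (simp add: ml)
    moreover have "x < k r"
    proof (cases r)
      case (Suc r')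
      hence "\<not> m r' \<le> x" using not_less_Least[of r' "\<lambda>r. m r \<le> x"] by (simp add: r_def)
      thus ?thesis using Suc by (simp add: k_def)
    qed (use x in \<open>simp add: k_def\<close>)
    ultimately have "(r, r + x) \<in> set ys" unfolding setys using r by simp
    moreover have "content (r, r + x) = x" by (simp add: content_def)
    ultimately show "x \<in> content ` set ys" by force
  qed
  moreover have "card (content ` set ys) = length ys"
    using card_image[OF vlist_content_inj[OF ch v]] chain_distinct[OF ch] by (simp add: distinct_card)
  ultimately have "length ys = n" by simp
  thus ?thesis using v ch NM unfolding M_def N_def by blast
qed

lemma strict_partition_tl: "strict_partition (n # lam) \<Longrightarrow> strict_partition lam"
  by (simp add: strict_partition_def)

lemma special_list_exists: "strict_partition lam \<Longrightarrow> \<exists>zs. special_list lam zs"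
proof (induction lam)
  case (Cons n lam)
  obtain xs where "special_list lam xs" using Cons.IH[OF strict_partition_tl[OF Cons.prems]] by blast
  moreover obtain ys where "length ys = n" "vlist ys" "chain (diagram lam) ys" "diagram lam \<union> set ys = diagram (n # lam)"
    using special_block_exists[OF Cons.prems] by blast
  ultimately have "special_list (n # lam) (xs @ ys)" unfolding special_list.simps by blast
  thus ?case ..
next
  case Nil
  have "special_list [] []" by simp
  thus ?case ..
qed

lemma ideal_diagram: "strict_partition lam \<Longrightarrow> ideal (diagram lam)"
  using special_list_exists special_list_chain chain_ideal'[of "{}"] by fastforce

section \<open>From lists of boxes to tableaux\<close>

lemma diagram_inj:
  assumes "diagram lam = diagram mu" "0 \<notin> set lam" "0 \<notin> set mu"
  shows "lam = mu"
proof -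
  have d: "r < length nu \<longleftrightarrow> (r, r) \<in> diagram nu" if "0 \<notin> set nu" for r nu
  proof -
    have "nu ! r \<noteq> 0" if "r < length nu" using nth_mem[OF that] \<open>0 \<notin> set nu\<close> by metis
    thus ?thesis by (auto simp: diagram_iff)
  qed
  have "r < length lam \<longleftrightarrow> r < length mu" for r using d assms by blast
  hence l: "length lam = length mu" by (meson linorder_neqE_nat nat_neq_iff)
  show ?thesis
  proof (rule nth_equalityI[OF l])
    fix r assume r: "r < length lam"
    have "p < lam ! r \<longleftrightarrow> p < mu ! r" for p
      using diagram_iff[of r "r + p" lam] diagram_iff[of r "r + p" mu] r l assms(1) by simp
    thus "lam ! r = mu ! r" by (meson linorder_neqE_nat nat_neq_iff)
  qed
qed

lemma rep_shape:
  assumes "rep T E" "fst ` E = diagram lam" "0 \<notin> set lam"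
  shows "shape T = lam"
proof -
  have "0 \<notin> set (shape T)" using assms(1) by (auto simp: rep_def shape_def)
  moreover have "diagram (shape T) = diagram lam" using assms(1,2) by (simp add: rep_def flip: cells_diagram)
  ultimately show ?thesis using diagram_inj assms(3) by blast
qed

lemma rep_exists: "chain {} zs \<Longrightarrow> \<exists>Q :: nat list list. rep Q (timed zs)"
proof (induction zs rule: rev_induct)
  case Nil
  have "rep [] (timed [])" by (simp add: rep_def cells_def timed_def)
  thus ?case ..
next
  case (snoc z zs)
  have c: "chain {} zs" "addable (set zs) z" using snoc.prems by (auto simp: chain_append)
  obtain Q :: "nat list list" where "rep Q (timed zs)" using snoc.IH[OF c(1)] by blast
  hence "rep (add_at_row Q (fst z) (Suc (length zs))) (timed (zs @ [z]))"
    using rep_add[of Q "timed zs" "fst z" "snd z"] c(2) by (simp add: fst_timed timed_snoc)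
  thus ?case ..
qed

lemma timed_ent: "rep Q (timed zs) \<Longrightarrow> i < length zs \<Longrightarrow> ent Q (zs ! i) = Suc i"
proof -
  assume r: "rep Q (timed zs)" and "i < length zs"
  hence "(zs ! i, Suc i) \<in> timed zs" by (auto simp: timed_iff)
  thus ?thesis using r by (auto simp: rep_def)
qed

lemma timed_cells: "rep Q (timed zs) \<Longrightarrow> cells Q = set zs"
  by (simp add: rep_def fst_timed)

lemma ent_mono:
  assumes ch: "chain {} zs" and R: "rep Q (timed zs)" and x: "x \<in> set zs" and y: "y \<in> set zs"
    and le: "fst x \<le> fst y" "snd x \<le> snd y" and ne: "x \<noteq> y"
  shows "ent Q x < ent Q y"
proof -
  obtain i where i: "i < length zs" "x = zs ! i" using x by (metis in_set_conv_nth)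
  obtain k where k: "k < length zs" "y = zs ! k" using y by (metis in_set_conv_nth)
  have "\<not> k < i"
  proof
    assume ki: "k < i"
    have "chain {} (take (Suc k) zs @ drop (Suc k) zs)" using ch by simp
    moreover have "y \<in> set (take (Suc k) zs)" using k by (auto simp: in_set_conv_nth)
    moreover have "x \<in> set (drop (Suc k) zs)"
      using i ki by (auto simp: in_set_conv_nth intro!: exI[of _ "i - Suc k"])
    ultimately show False using chain_order le by blast
  qed
  moreover have "i \<noteq> k" using ne i k by auto
  ultimately show ?thesis using timed_ent[OF R] i k by simp
qed

lemma block_cells:
  assumes R: "rep Q (timed zs)" and zs: "zs = xs @ ys @ rest"
  shows "{x \<in> cells Q. length xs + 1 \<le> ent Q x \<and> ent Q x \<le> length xs + length ys} = set ys"
    and "\<And>a. a < length ys \<Longrightarrow> ent Q (ys ! a) = length xs + a + 1"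
proof -
  show e: "ent Q (ys ! a) = length xs + a + 1" if "a < length ys" for a
    using timed_ent[OF R, of "length xs + a"] that by (simp add: zs nth_append)
  show "{x \<in> cells Q. length xs + 1 \<le> ent Q x \<and> ent Q x \<le> length xs + length ys} = set ys"
  proof (intro set_eqI iffI)
    fix x assume x: "x \<in> {x \<in> cells Q. length xs + 1 \<le> ent Q x \<and> ent Q x \<le> length xs + length ys}"
    then obtain i where i: "i < length zs" "x = zs ! i" using timed_cells[OF R] by (metis (no_types, lifting) in_set_conv_nth mem_Collect_eq)
    hence "length xs \<le> i" "i < length xs + length ys" using x timed_ent[OF R i(1)] by auto
    thus "x \<in> set ys" using i by (auto simp: zs nth_append)
  next
    fix x assume "x \<in> set ys"
    then obtain a where "a < length ys" "x = ys ! a" by (metis in_set_conv_nth)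
    thus "x \<in> {x \<in> cells Q. length xs + 1 \<le> ent Q x \<and> ent Q x \<le> length xs + length ys}"
      using e[of a] timed_cells[OF R] by (simp add: zs)
  qed
qed

text \<open>If the upper right corner were an old box, then so would be \<open>x\<close>, which lies
  to its left.\<close>

lemma between_block:
  assumes ch: "chain {} (xs @ ys @ rest)" and x: "x \<in> set ys" and y: "y \<in> set ys"
    and le: "fst x < fst y" "snd x < snd y"
  shows "(fst x, snd y) \<in> set ys"
proof -
  have c: "chain (set xs) ys" using ch by (simp add: chain_append)
  have i: "ideal (set xs)" "ideal (set xs \<union> set ys)" using chain_ideal[OF c] chain_ideal'[OF c] by auto
  have "fst x \<le> snd x" using ideal_le[OF i(2), of "fst x" "snd x"] x by simp
  hence "(fst x, snd y) \<in> set xs \<union> set ys" using ideal_down[OF i(2), of "fst y" "snd y" "fst x" "snd y"] le y by simp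
  moreover have "(fst x, snd y) \<notin> set xs"
  proof
    assume "(fst x, snd y) \<in> set xs"
    hence "(fst x, snd x) \<in> set xs" using ideal_down[OF i(1), of "fst x" "snd y" "fst x" "snd x"] le \<open>fst x \<le> snd x\<close> by simp
    thus False using x chain_distinct[OF c] by auto
  qed
  ultimately show ?thesis by blast
qed

text \<open>A vee is defined by row and column conditions and the order of entries only; that its
  strips go weakly left or weakly up comes from a rectangle argument. If two boxes of a strip were
  in strict southeast position, the upper right corner would be a box of the same strip sharing a
  row, in the vertical case, or a column, in the horizontal case, with one of them. Conversely,
  distinct contents exclude a square.\<close>

lemma is_vee_iff_vlist:
  assumes R: "rep Q (timed zs)" and ch: "chain {} zs" and zs: "zs = xs @ ys @ rest" and ne: "ys \<noteq> []"
  shows "is_vee Q (length xs + 1) (length xs + length ys) \<longleftrightarrow> vlist ys"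
proof
  define p where "p = length xs"
  note S = block_cells(1)[OF R zs, folded p_def] and E = block_cells(2)[OF R zs, folded p_def]
  have chy: "chain (set xs) ys" using ch by (simp add: zs chain_append)
  have mono: "ent Q x < ent Q y" if "x \<in> set ys" "y \<in> set ys" "fst x \<le> fst y" "snd x \<le> snd y" "x \<noteq> y" for x y
    using ent_mono[OF ch R] that by (simp add: zs)
  {
    assume "is_vee Q (length xs + 1) (length xs + length ys)"
    then obtain j where j: "p + 1 \<le> j" "j \<le> p + length ys"
      and V: "\<forall>x\<in>{x \<in> set ys. ent Q x \<le> j}. \<forall>y\<in>{x \<in> set ys. ent Q x \<le> j}. fst x = fst y \<longrightarrow> x = y"
        "\<forall>x\<in>{x \<in> set ys. ent Q x \<le> j}. \<forall>y\<in>{x \<in> set ys. ent Q x \<le> j}. fst x < fst y \<longrightarrow> ent Q x < ent Q y"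
      and H: "\<forall>x\<in>{x \<in> set ys. j \<le> ent Q x}. \<forall>y\<in>{x \<in> set ys. j \<le> ent Q x}. snd x = snd y \<longrightarrow> x = y"
        "\<forall>x\<in>{x \<in> set ys. j \<le> ent Q x}. \<forall>y\<in>{x \<in> set ys. j \<le> ent Q x}. snd x < snd y \<longrightarrow> ent Q x < ent Q y"
      unfolding is_vee_def Let_def p_def[symmetric] S by blast
    have V1: "x = y" if "x \<in> set ys" "ent Q x \<le> j" "y \<in> set ys" "ent Q y \<le> j" "fst x = fst y" for x y
      using V(1) that by blast
    have V2: "ent Q x < ent Q y" if "x \<in> set ys" "ent Q x \<le> j" "y \<in> set ys" "ent Q y \<le> j" "fst x < fst y" for x y
      using V(2) that by blast
    have H1: "x = y" if "x \<in> set ys" "j \<le> ent Q x" "y \<in> set ys" "j \<le> ent Q y" "snd x = snd y" for x y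
      using H(1) that by blast
    have H2: "ent Q x < ent Q y" if "x \<in> set ys" "j \<le> ent Q x" "y \<in> set ys" "j \<le> ent Q y" "snd x < snd y" for x y
      using H(2) that by blast
    \<comment> \<open>The entries of the block start at \<open>p + 1\<close>, so the entry
      \<open>j\<close> sits at index \<open>k\<close> of the block.\<close>
    define k where "k = j - p - 1"
    have k: "k < length ys" "j = p + k + 1" using j by (simp_all add: k_def)
    have a: "sorted_wrt below (take (Suc k) ys)"
      unfolding sorted_wrt_iff_nth_less
    proof (intro allI impI)
      fix a b assume ab: "a < b" "b < length (take (Suc k) ys)"
      define x where "x = ys ! a"
      define y where "y = ys ! b"
      have bk: "b \<le> k" "b < length ys" using ab by auto
      have xy: "x \<in> set ys" "y \<in> set ys" using ab bk by (auto simp: x_def y_def)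
      have ex: "ent Q x = p + a + 1" "ent Q y = p + b + 1" using E[of a] E[of b] ab bk by (auto simp: x_def y_def)
      have jx: "ent Q x \<le> j" "ent Q y \<le> j" using ex ab bk k by auto
      have "x \<noteq> y" using ex ab by auto
      hence "fst x \<noteq> fst y" using V1[OF xy(1) jx(1) xy(2) jx(2)] by auto
      moreover have "\<not> fst y < fst x" using V2[OF xy(2) jx(2) xy(1) jx(1)] ex ab by auto
      ultimately have f: "fst x < fst y" by simp
      have "\<not> snd x < snd y"
      proof
        assume s: "snd x < snd y"
        define m where "m = (fst x, snd y)"
        have m: "m \<in> set ys" using between_block[of xs ys rest x y] ch xy f s by (simp add: m_def zs)
        have "m \<noteq> y" "m \<noteq> x" using f s by (auto simp: m_def prod_eq_iff)
        hence "ent Q m \<le> j" using mono[OF m xy(2)] f jx(2) by (simp add: m_def)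
        hence "m = x" using V1[OF m _ xy(1) jx(1)] by (simp add: m_def)
        thus False using \<open>m \<noteq> x\<close> by simp
      qed
      thus "below (take (Suc k) ys ! a) (take (Suc k) ys ! b)" using f ab bk by (simp add: below_def x_def y_def)
    qed
    have b: "sorted_wrt rightof (drop k ys)"
      unfolding sorted_wrt_iff_nth_less
    proof (intro allI impI)
      fix a b assume ab: "a < b" "b < length (drop k ys)"
      define x where "x = ys ! (k + a)"
      define y where "y = ys ! (k + b)"
      have bl: "k + b < length ys" using ab by auto
      have xy: "x \<in> set ys" "y \<in> set ys" using ab bl by (auto simp: x_def y_def)
      have ex: "ent Q x = p + (k + a) + 1" "ent Q y = p + (k + b) + 1" using E[of "k + a"] E[of "k + b"] ab bl by (auto simp: x_def y_def)
      have jx: "j \<le> ent Q x" "j \<le> ent Q y" using ex k by auto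
      have "x \<noteq> y" using ex ab by auto
      hence "snd x \<noteq> snd y" using H1[OF xy(1) jx(1) xy(2) jx(2)] by auto
      moreover have "\<not> snd y < snd x" using H2[OF xy(2) jx(2) xy(1) jx(1)] ex ab by auto
      ultimately have s: "snd x < snd y" by simp
      have "\<not> fst x < fst y"
      proof
        assume f: "fst x < fst y"
        define m where "m = (fst x, snd y)"
        have m: "m \<in> set ys" using between_block[of xs ys rest x y] ch xy f s by (simp add: m_def zs)
        have "m \<noteq> y" "m \<noteq> x" using f s by (auto simp: m_def prod_eq_iff)
        hence "j \<le> ent Q m" using mono[OF xy(1) m] s jx(1) by (simp add: m_def)
        hence "m = y" using H1[OF m _ xy(2) jx(2)] by (simp add: m_def)
        thus False using \<open>m \<noteq> y\<close> by simp
      qed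
      thus "rightof (drop k ys ! a) (drop k ys ! b)" using s ab bl by (simp add: rightof_def x_def y_def)
    qed
    have "sorted_wrt below (take k ys @ [ys ! k])" using a by (simp add: take_Suc_conv_app_nth[OF k(1)])
    moreover have "sorted_wrt rightof (ys ! k # drop (Suc k) ys)" using b Cons_nth_drop_Suc[OF k(1)] by simp
    ultimately show "vlist ys" unfolding vlist_def using id_take_nth_drop[OF k(1)] by blast
  next
    assume v: "vlist ys"
    obtain V e H where y: "ys = V @ e # H" "sorted_wrt below (V @ [e])" "sorted_wrt rightof (e # H)"
      using v by (auto simp: vlist_def)
    define j where "j = p + length V + 1"
    note inj = vlist_content_inj[OF chy v]
    have yl: "ys ! i = (V @ [e]) ! i" if "i < length (V @ [e])" for i
      using that nth_append[of "V @ [e]" H i] by (simp add: y(1))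
    have yr: "ys ! (length V + i) = (e # H) ! i" for i
      by (simp add: y(1) nth_append)
    have ly: "length ys = length V + length (e # H)" by (simp add: y(1))
    have Vs: "x \<in> set ys \<and> ent Q x \<le> j \<longleftrightarrow> x \<in> set (V @ [e])" for x
    proof
      assume a: "x \<in> set ys \<and> ent Q x \<le> j"
      then obtain i where i: "i < length ys" "x = ys ! i" by (metis in_set_conv_nth)
      hence l: "i < length (V @ [e])" using a E[of i] by (simp add: j_def)
      show "x \<in> set (V @ [e])" unfolding i(2) yl[OF l] by (rule nth_mem[OF l])
    next
      assume "x \<in> set (V @ [e])"
      then obtain i where i: "i < length (V @ [e])" "x = (V @ [e]) ! i" by (metis in_set_conv_nth)
      have il: "i < length ys" using i(1) ly by simp
      have xi: "x = ys ! i" using i(2) yl[OF i(1)] by simp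
      show "x \<in> set ys \<and> ent Q x \<le> j" unfolding xi using E[OF il] il i(1) by (simp add: j_def)
    qed
    have Hs: "x \<in> set ys \<and> j \<le> ent Q x \<longleftrightarrow> x \<in> set (e # H)" for x
    proof
      assume a: "x \<in> set ys \<and> j \<le> ent Q x"
      then obtain i where i: "i < length ys" "x = ys ! i" by (metis in_set_conv_nth)
      hence "length V \<le> i" using a E[of i] by (simp add: j_def)
      then obtain k where k: "i = length V + k" by (metis le_iff_add)
      have l: "k < length (e # H)" using i(1) ly k by simp
      show "x \<in> set (e # H)" unfolding i(2) k yr by (rule nth_mem[OF l])
    next
      assume "x \<in> set (e # H)"
      then obtain i where i: "i < length (e # H)" "x = (e # H) ! i" by (metis in_set_conv_nth)
      have il: "length V + i < length ys" using i(1) ly by simp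
      have xi: "x = ys ! (length V + i)" using i(2) yr by simp
      show "x \<in> set ys \<and> j \<le> ent Q x" unfolding xi using E[OF il] il by (simp add: j_def)
    qed
    have Vord: "ent Q x < ent Q z" if xin: "x \<in> set (V @ [e])" and zin: "z \<in> set (V @ [e])" and lt: "fst x < fst z" for x z
    proof (rule ccontr)
      assume n: "\<not> ent Q x < ent Q z"
      obtain a where a: "a < length (V @ [e])" "x = (V @ [e]) ! a" using xin by (metis in_set_conv_nth)
      obtain b where b: "b < length (V @ [e])" "z = (V @ [e]) ! b" using zin by (metis in_set_conv_nth)
      have l: "a < length ys" "b < length ys" using a(1) b(1) ly by simp_all
      have xa: "x = ys ! a" "z = ys ! b" using yl[OF a(1)] yl[OF b(1)] a(2) b(2) by simp_all
      have "b \<le> a" using n E[OF l(1)] E[OF l(2)] unfolding xa by simp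
      moreover have "a \<noteq> b" using a(2) b(2) lt by blast
      ultimately have ba: "b < a" by simp
      have "below z x" unfolding a(2) b(2) by (rule sorted_wrt_nth_less[OF y(2) ba a(1)])
      thus False using lt by (simp add: below_def)
    qed
    have Hord: "ent Q x < ent Q z" if xin: "x \<in> set (e # H)" and zin: "z \<in> set (e # H)" and lt: "snd x < snd z" for x z
    proof (rule ccontr)
      assume n: "\<not> ent Q x < ent Q z"
      obtain a where a: "a < length (e # H)" "x = (e # H) ! a" using xin by (metis in_set_conv_nth)
      obtain b where b: "b < length (e # H)" "z = (e # H) ! b" using zin by (metis in_set_conv_nth)
      have l: "length V + a < length ys" "length V + b < length ys" using a(1) b(1) ly by simp_all
      have xa: "x = ys ! (length V + a)" "z = ys ! (length V + b)" using yr[of a] yr[of b] a(2) b(2) by simp_all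
      have "b \<le> a" using n E[OF l(1)] E[OF l(2)] unfolding xa by simp
      moreover have "a \<noteq> b" using a(2) b(2) lt by blast
      ultimately have ba: "b < a" by simp
      have "rightof z x" unfolding a(2) b(2) by (rule sorted_wrt_nth_less[OF y(3) ba a(1)])
      thus False using lt by (simp add: rightof_def)
    qed
    have sq: "no_square (set ys)"
      unfolding no_square_def
    proof (intro allI notI)
      fix r c assume "(r, c) \<in> set ys \<and> (r, c + 1) \<in> set ys \<and> (r + 1, c) \<in> set ys \<and> (r + 1, c + 1) \<in> set ys"
      hence "(r, c) = (r + 1, c + 1)" using inj_onD[OF inj, of "(r, c)" "(r + 1, c + 1)"] by (simp add: content_def)
      thus False by simp
    qed
    have VH: "snd x \<le> snd z" if "x \<in> set (V @ [e])" "z \<in> set (e # H)" "fst x = fst z" for x z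
    proof (rule ccontr)
      assume n: "\<not> snd x \<le> snd z"
      have x: "x \<in> set ys" "ent Q x \<le> j" and z: "z \<in> set ys" "j \<le> ent Q z"
        using Vs[of x] Hs[of z] that by blast+
      have "ent Q z < ent Q x" using mono[OF z(1) x(1)] n that(3) by auto
      thus False using x z by simp
    qed
    have V: "{x \<in> set ys. ent Q x \<le> j} = set (V @ [e])" and H: "{x \<in> set ys. j \<le> ent Q x} = set (e # H)"
      using Vs Hs by blast+
    have jb: "p + 1 \<le> j" "j \<le> p + length ys" by (simp_all add: j_def y(1))
    have "1 \<le> length ys" using ne by (simp add: Suc_leI)
    show "is_vee Q (length xs + 1) (length xs + length ys)"
      unfolding is_vee_def Let_def p_def[symmetric] S
    proof (intro conjI exI[of _ j])
      show "p + 1 \<le> p + length ys" using \<open>1 \<le> length ys\<close> by simp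
      show "no_square (set ys)" by (rule sq)
      show "p + 1 \<le> j" "j \<le> p + length ys" using jb by auto
      show "\<forall>x\<in>{x \<in> set ys. ent Q x \<le> j}. \<forall>y\<in>{x \<in> set ys. ent Q x \<le> j}. fst x = fst y \<longrightarrow> x = y"
        unfolding V using below_row_inj[OF y(2)] by blast
      show "\<forall>x\<in>{x \<in> set ys. ent Q x \<le> j}. \<forall>y\<in>{x \<in> set ys. ent Q x \<le> j}. fst x < fst y \<longrightarrow> ent Q x < ent Q y"
        unfolding V using Vord by blast
      show "\<forall>x\<in>{x \<in> set ys. j \<le> ent Q x}. \<forall>y\<in>{x \<in> set ys. j \<le> ent Q x}. snd x = snd y \<longrightarrow> x = y"
        unfolding H using rightof_col_inj[OF y(3)] by blast
      show "\<forall>x\<in>{x \<in> set ys. j \<le> ent Q x}. \<forall>y\<in>{x \<in> set ys. j \<le> ent Q x}. snd x < snd y \<longrightarrow> ent Q x < ent Q y"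
        unfolding H using Hord by blast
      show "\<forall>x\<in>{x \<in> set ys. ent Q x \<le> j}. \<forall>y\<in>{x \<in> set ys. j \<le> ent Q x}. fst x = fst y \<longrightarrow> snd x \<le> snd y"
        unfolding V H using VH by blast
    qed
  }
qed

lemma adj_in_sym: "adj_in S x y \<Longrightarrow> adj_in S y x"
  by (auto simp: adj_in_def)

text \<open>By \<open>block_neighbour\<close>, every box is joined to the pivot through adjacent
  boxes of decreasing content.\<close>

lemma block_connected:
  assumes ch: "chain M ys" and full: "M \<union> set ys = push n M" and v: "vlist ys"
  shows "connected_cells (set ys)"
proof -
  obtain V e H where y: "ys = V @ e # H" "sorted_wrt below (V @ [e])" "sorted_wrt rightof (e # H)"
    using v by (auto simp: vlist_def)
  have e: "content e = 0" "e \<in> set ys" using vlist_parts(1)[OF ch full y] y(1) by auto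
  note inj = vlist_content_inj[OF ch v]
  have to_e: "(adj_in (set ys))\<^sup>*\<^sup>* b e" if "b \<in> set ys" for b
    using that
  proof (induction "content b" arbitrary: b rule: less_induct)
    case less
    show ?case
    proof (cases "content b = 0")
      case True
      hence "b = e" using inj_onD[OF inj _ less.prems e(2)] e(1) by simp
      thus ?thesis by simp
    next
      case False
      hence c: "0 < content b" by simp
      hence lt: "fst b < snd b" by (simp add: content_def)
      from block_neighbour[OF ch full less.prems c] obtain b' where
        b': "b' \<in> set ys" "b' = (Suc (fst b), snd b) \<or> b' = (fst b, snd b - 1)" by blast
      have "content b' < content b" using b'(2) lt by (auto simp: content_def)
      hence "(adj_in (set ys))\<^sup>*\<^sup>* b' e" using less.hyps b'(1) by blast
      moreover have "adj_in (set ys) b b'" using b' less.prems lt by (auto simp: adj_in_def)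
      ultimately show ?thesis by (rule converse_rtranclp_into_rtranclp[rotated])
    qed
  qed
  have "symp (adj_in (set ys))" using adj_in_sym by (auto intro: sympI)
  hence "symp (adj_in (set ys))\<^sup>*\<^sup>*" by (rule symp_rtranclp)
  hence "(adj_in (set ys))\<^sup>*\<^sup>* x z" if "x \<in> set ys" "z \<in> set ys" for x z
    using to_e[OF that(1)] to_e[OF that(2)] by (meson rtranclp_trans sympE)
  moreover have "set ys \<noteq> {}" using e(2) by auto
  ultimately show ?thesis unfolding connected_cells_def by blast
qed

text \<open>Adjacent boxes differ by one in content, so on a path from the diagonal box no value is
  skipped. The contents are thus an initial segment, and as they are distinct, their number
  determines it.\<close>

lemma connected_contents:
  assumes ch: "chain M ys" and v: "vlist ys" and con: "connected_cells (set ys)"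
    and z: "b0 \<in> set ys" "content b0 = 0"
  shows "content ` set ys = {0..<length ys}"
proof -
  define A where "A = content ` set ys"
  have i: "ideal (M \<union> set ys)" using chain_ideal'[OF ch] .
  have le: "fst b \<le> snd b" if "b \<in> set ys" for b using ideal_le[OF i, of "fst b" "snd b"] that by simp
  have dn: "\<forall>k\<le>content b. k \<in> A" if "(adj_in (set ys))\<^sup>*\<^sup>* b0 b" for b
    using that
  proof (induction rule: rtranclp_induct)
    case base
    thus ?case using z by (auto simp: A_def)
  next
    case (step x y)
    have y: "y \<in> set ys" and x: "x \<in> set ys" using step.hyps(2) by (auto simp: adj_in_def)
    have "content y \<le> Suc (content x)" using step.hyps(2) le[OF x] le[OF y] by (auto simp: adj_in_def content_def)
    moreover have "content y \<in> A" using y by (simp add: A_def)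
    ultimately show ?case using step.IH by (metis le_Suc_eq le_trans)
  qed
  have down: "k \<in> A" if cA: "c \<in> A" and kc: "k \<le> c" for c k
  proof -
    obtain b where "b \<in> set ys" "c = content b" using cA unfolding A_def by blast
    thus ?thesis using dn[of b] con z(1) kc unfolding connected_cells_def by blast
  qed
  have cA: "card A = length ys"
    unfolding A_def using card_image[OF vlist_content_inj[OF ch v]] chain_distinct[OF ch] by (simp add: distinct_card)
  have fin: "finite A" by (simp add: A_def)
  have "A \<subseteq> {0..<length ys}"
  proof
    fix c assume c: "c \<in> A"
    have "{0..c} \<subseteq> A" using down[OF c] by auto
    hence "card {0..c} \<le> card A" using fin by (rule card_mono[rotated])
    thus "c \<in> {0..<length ys}" using cA by simp
  qed
  thus ?thesis using cA card_subset_eq[of "{0..<length ys}" A] by (simp add: A_def)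
qed

lemma special_list_snoc:
  assumes xs: "special_list lam xs" and ch: "chain (set xs) ys" and v: "vlist ys"
    and im: "content ` set ys = {0..<length ys}" and M0: "\<And>c. (0, c) \<in> diagram lam \<Longrightarrow> c < length ys"
  shows "special_list (length ys # lam) (xs @ ys)"
proof -
  have M: "set xs = diagram lam" using special_list_chain[OF xs] by simp
  note ch' = ch[unfolded M]
  have "diagram lam \<union> set ys = push (length ys) (diagram lam)"
    by (rule push_full[OF ch' vlist_content_inj[OF ch' v] im M0])
  hence "diagram lam \<union> set ys = diagram (length ys # lam)" by simp
  thus ?thesis unfolding special_list.simps using xs ch' v by blast
qed

lemma special_list_split:
  assumes "special_list lam zs" "i < length lam"
  obtains xs ys rest where "zs = xs @ ys @ rest" "special_list (drop (Suc i) lam) xs" "length ys = lam ! i" "vlist ys"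
    "chain (diagram (drop (Suc i) lam)) ys"
    "diagram (drop (Suc i) lam) \<union> set ys = push (lam ! i) (diagram (drop (Suc i) lam))"
  using assms
proof (induction lam arbitrary: i zs thesis)
  case (Cons n lam)
  obtain xs0 ys0 where 1: "zs = xs0 @ ys0" "special_list lam xs0" "length ys0 = n" "vlist ys0"
    "chain (diagram lam) ys0" "diagram lam \<union> set ys0 = push n (diagram lam)" using Cons.prems(2) by auto
  show ?case
  proof (cases i)
    case 0
    show ?thesis using Cons.prems(1)[of xs0 ys0 "[]"] 1 0 by simp
  next
    case (Suc i')
    have "i' < length lam" using Cons.prems(3) Suc by simp
    then obtain xs ys rest where 2: "xs0 = xs @ ys @ rest" "special_list (drop (Suc i') lam) xs" "length ys = lam ! i'"
      "vlist ys" "chain (diagram (drop (Suc i') lam)) ys"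
      "diagram (drop (Suc i') lam) \<union> set ys = push (lam ! i') (diagram (drop (Suc i') lam))"
      using Cons.IH[OF _ 1(2)] by blast
    show ?thesis using Cons.prems(1)[of xs ys "rest @ ys0"] 1(1) 2 Suc by simp
  qed
qed simp

lemma set_concat_ent: "set (concat T) = ent T ` cells T"
proof (intro set_eqI iffI)
  fix x assume "x \<in> set (concat T)"
  then obtain r k where "r < length T" "k < length (T ! r)" "x = T ! r ! k"
    by (auto simp: in_set_conv_nth)
  hence "(r, r + k) \<in> cells T" "x = ent T (r, r + k)" by (simp_all add: cells_iff ent_def)
  thus "x \<in> ent T ` cells T" by blast
next
  fix x assume "x \<in> ent T ` cells T"
  then obtain r c where "(r, c) \<in> cells T" "x = ent T (r, c)" by auto
  hence "r < length T" "c - r < length (T ! r)" "x = T ! r ! (c - r)" by (auto simp: cells_iff ent_def)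
  thus "x \<in> set (concat T)" unfolding set_concat by (metis UN_I nth_mem)
qed

text \<open>The predicate under \<open>THE\<close> in \<open>special_recording\<close>.\<close>

definition is_special :: "nat list list \<Rightarrow> nat list \<Rightarrow> bool" where
  "is_special Q lam \<longleftrightarrow> standard_shifted Q \<and> shape Q = lam \<and>
     (\<forall>i < length lam. is_connected_vee Q (sum_list (drop (Suc i) lam) + 1) (sum_list (drop i lam)))"

lemma sum_list_drop: "i < length lam \<Longrightarrow> sum_list (drop i lam) = sum_list (drop (Suc i) lam) + lam ! i"
  for lam :: "nat list"
  by (simp add: Cons_nth_drop_Suc[symmetric])

lemma standard_shifted_timed:
  assumes ch: "chain {} zs" and R: "rep Q (timed zs)"
  shows "standard_shifted Q"
proof -
  have c: "cells Q = set zs" by (rule timed_cells[OF R])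
  have d: "distinct zs" using chain_distinct[OF ch] by simp
  have l: "length (concat Q) = length zs" using card_cells[of Q] c d by (simp add: distinct_card)
  have "ent Q ` set zs = {1..length zs}"
  proof (intro set_eqI iffI)
    fix x assume "x \<in> ent Q ` set zs"
    then obtain i where "i < length zs" "x = ent Q (zs ! i)" by (metis imageE in_set_conv_nth)
    thus "x \<in> {1..length zs}" using timed_ent[OF R] by simp
  next
    fix x assume x: "x \<in> {1..length zs}"
    hence "ent Q (zs ! (x - 1)) = x" using timed_ent[OF R, of "x - 1"] by auto
    moreover have "zs ! (x - 1) \<in> set zs" using x by auto
    ultimately show "x \<in> ent Q ` set zs" by (metis imageI)
  qed
  hence s: "set (concat Q) = {1..length (concat Q)}" using set_concat_ent[of Q] c l by simp
  hence "distinct (concat Q)" by (intro card_distinct) simp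
  moreover have "strict_partition (shape Q)"
    using shape_strict[OF R] chain_ideal'[OF ch] by (simp add: fst_timed)
  moreover have "ent Q (r, k) < ent Q (r, k')" if "(r, k) \<in> cells Q" "(r, k') \<in> cells Q" "k < k'" for r k k'
    using ent_mono[OF ch R, of "(r, k)" "(r, k')"] that c by simp
  moreover have "ent Q (r, k) < ent Q (r', k)" if "(r, k) \<in> cells Q" "(r', k) \<in> cells Q" "r < r'" for r r' k
    using ent_mono[OF ch R, of "(r, k)" "(r', k)"] that c by simp
  ultimately show ?thesis unfolding standard_shifted_def using s by blast
qed

lemma special_list_is_special:
  assumes sp: "strict_partition lam" and zs: "special_list lam zs" and R: "rep Q (timed zs)"
  shows "is_special Q lam"
proof -
  have ch: "chain {} zs" and d: "set zs = diagram lam" using special_list_chain[OF zs] by simp_all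
  have z: "0 \<notin> set lam" using sp by (simp add: strict_partition_def)
  have "is_connected_vee Q (sum_list (drop (Suc i) lam) + 1) (sum_list (drop i lam))" if i: "i < length lam" for i
  proof -
    obtain xs ys rest where 1: "zs = xs @ ys @ rest" "special_list (drop (Suc i) lam) xs" "length ys = lam ! i" "vlist ys"
      "chain (diagram (drop (Suc i) lam)) ys"
      "diagram (drop (Suc i) lam) \<union> set ys = push (lam ! i) (diagram (drop (Suc i) lam))"
      by (rule special_list_split[OF zs i])
    have s: "sum_list (drop (Suc i) lam) = length xs" using special_list_length[OF 1(2)] by simp
    have s': "sum_list (drop i lam) = length xs + length ys" using sum_list_drop[OF i] s 1(3) by simp
    have "lam ! i \<noteq> 0" using nth_mem[OF i] z by metis
    hence "ys \<noteq> []" using 1(3) by auto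
    hence "is_vee Q (length xs + 1) (length xs + length ys)" using is_vee_iff_vlist[OF R ch 1(1)] 1(4) by blast
    moreover have "connected_cells (set ys)" by (rule block_connected[OF 1(5,6,4)])
    ultimately show ?thesis unfolding is_connected_vee_def s s' block_cells(1)[OF R 1(1)] by blast
  qed
  moreover have "shape Q = lam" by (rule rep_shape[OF R _ z]) (simp add: fst_timed d)
  ultimately show ?thesis unfolding is_special_def using standard_shifted_timed[OF ch R] by blast
qed

text \<open>If the boxes are listed by their entries, the upper and the left neighbour of a box have
  smaller entries and come earlier, which is the criterion of \<open>chain_build\<close>.\<close>

lemma standard_shifted_list:
  assumes st: "standard_shifted Q"
  obtains zs where "chain {} zs" "rep Q (timed zs)"
proof -
  define n where "n = length (concat Q)"
  define zs where "zs = map (inv_into (cells Q) (ent Q)) [1..<Suc n]"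
  have sp: "strict_partition (shape Q)" and s: "set (concat Q) = {1..n}"
    and row: "\<And>r c c'. (r, c) \<in> cells Q \<Longrightarrow> (r, c') \<in> cells Q \<Longrightarrow> c < c' \<Longrightarrow> ent Q (r, c) < ent Q (r, c')"
    and col: "\<And>r r' c. (r, c) \<in> cells Q \<Longrightarrow> (r', c) \<in> cells Q \<Longrightarrow> r < r' \<Longrightarrow> ent Q (r, c) < ent Q (r', c)"
    using st unfolding standard_shifted_def n_def by blast+
  have idl: "ideal (cells Q)" unfolding cells_diagram by (rule ideal_diagram[OF sp])
  hence fin: "finite (cells Q)" by (simp add: ideal_def)
  have im: "ent Q ` cells Q = {1..n}" using s set_concat_ent[of Q] by simp
  have inj: "inj_on (ent Q) (cells Q)"
    by (rule eq_card_imp_inj_on[OF fin]) (simp add: im card_cells n_def)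
  have len: "length zs = n" by (simp add: zs_def)
  have nth: "zs ! i = inv_into (cells Q) (ent Q) (Suc i)" if "i < n" for i
    using that by (simp add: zs_def del: upt_Suc)
  have en: "ent Q (zs ! i) = Suc i" and zc: "zs ! i \<in> cells Q" if "i < n" for i
  proof -
    have m: "Suc i \<in> ent Q ` cells Q" unfolding im using that by simp
    show "ent Q (zs ! i) = Suc i" "zs ! i \<in> cells Q" unfolding nth[OF that]
      using f_inv_into_f[OF m] inv_into_into[OF m] by simp_all
  qed
  have idx: "ent Q b - 1 < n \<and> zs ! (ent Q b - 1) = b \<and> 0 < ent Q b" if "b \<in> cells Q" for b
  proof -
    have e: "ent Q b \<in> {1..n}" unfolding im[symmetric] using that by (rule imageI)
    hence l: "ent Q b - 1 < n" by auto
    have "ent Q (zs ! (ent Q b - 1)) = ent Q b" using en[OF l] e by simp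
    hence "zs ! (ent Q b - 1) = b" using inj_onD[OF inj _ zc[OF l] that] by simp
    thus ?thesis using l e by simp
  qed
  have sz: "set zs = cells Q"
  proof (intro set_eqI iffI)
    fix b assume "b \<in> set zs"
    then obtain i where "i < n" "b = zs ! i" unfolding in_set_conv_nth len by blast
    thus "b \<in> cells Q" using zc by simp
  next
    fix b assume "b \<in> cells Q"
    thus "b \<in> set zs" using idx nth_mem[of "ent Q b - 1" zs] len by metis
  qed
  have R: "rep Q (timed zs)"
  proof -
    have "[] \<notin> set Q" using sp by (auto simp: strict_partition_def shape_def)
    moreover have "ent Q (fst e) = snd e" if e: "e \<in> timed zs" for e
    proof -
      have "(fst e, snd e) \<in> timed zs" using e by simp
      then obtain i where "i < n" "fst e = zs ! i" "snd e = Suc i" unfolding timed_iff len by blast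
      thus ?thesis using en by simp
    qed
    ultimately show ?thesis unfolding rep_def fst_timed sz by blast
  qed
  have "ideal {}" by (simp add: ideal_def)
  hence "chain {} zs"
  proof (rule chain_build)
    fix A b B assume spl: "zs = A @ b # B"
    have lA: "length A < n" using len spl by simp
    have zA: "zs ! length A = b" by (simp add: spl)
    have bc: "b \<in> cells Q" using zc[OF lA] zA by simp
    have eb: "ent Q b = Suc (length A)" using en[OF lA] zA by simp
    have bl: "fst b \<le> snd b" using ideal_le[OF idl, of "fst b" "snd b"] bc by simp
    have prev: "p \<in> set A" if p: "p \<in> cells Q" "ent Q p < ent Q b" for p
    proof -
      have "0 < ent Q p" and zp: "zs ! (ent Q p - 1) = p" using idx[OF p(1)] by simp_all
      hence "ent Q p - 1 < length A" using p(2) eb by linarith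
      moreover from this have "A ! (ent Q p - 1) = p" using zp by (simp add: spl nth_append)
      ultimately show ?thesis using nth_mem by metis
    qed
    have "b \<notin> set A"
    proof
      assume "b \<in> set A"
      then obtain i where i: "i < length A" "b = A ! i" by (metis in_set_conv_nth)
      hence "b = zs ! i" by (simp add: spl nth_append)
      thus False using en[of i] eb i(1) lA by simp
    qed
    moreover have "(fst b - 1, snd b) \<in> set A" if "0 < fst b"
    proof (rule prev)
      show "(fst b - 1, snd b) \<in> cells Q" using ideal_down[OF idl, of "fst b" "snd b" "fst b - 1" "snd b"] bc bl by simp
      thus "ent Q (fst b - 1, snd b) < ent Q b" using col[of "fst b - 1" "snd b" "fst b"] bc that by simp
    qed
    moreover have "(fst b, snd b - 1) \<in> set A" if "fst b < snd b"
    proof (rule prev)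
      show "(fst b, snd b - 1) \<in> cells Q" using ideal_down[OF idl, of "fst b" "snd b" "fst b" "snd b - 1"] bc that by simp
      thus "ent Q (fst b, snd b - 1) < ent Q b" using row[of "fst b" "snd b - 1" "snd b"] bc that by simp
    qed
    ultimately show "b \<notin> {} \<union> set A \<and> fst b \<le> snd b \<and>
      (0 < fst b \<longrightarrow> (fst b - 1, snd b) \<in> {} \<union> set A) \<and> (fst b < snd b \<longrightarrow> (fst b, snd b - 1) \<in> {} \<union> set A)"
      using bl by simp
  qed
  thus ?thesis using R that by blast
qed

section \<open>Identification of the special recording tableau\<close>

definition diagonals :: "(nat \<times> nat) list \<Rightarrow> nat" where
  "diagonals zs = length (filter (\<lambda>b. content b = 0) zs)"

lemma diagonals_append [simp]: "diagonals (xs @ ys) = diagonals xs + diagonals ys"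
  by (simp add: diagonals_def)

lemma diagonals_diagram:
  assumes "distinct zs" "set zs = diagram lam" "0 \<notin> set lam"
  shows "diagonals zs = length lam"
proof -
  have "diagonals zs = card {b \<in> diagram lam. content b = 0}"
    unfolding diagonals_def using distinct_card[OF distinct_filter[OF assms(1)], of "\<lambda>b. content b = 0"] assms(2) by simp
  also have "{b \<in> diagram lam. content b = 0} = (\<lambda>r. (r, r)) ` {..<length lam}"
  proof (intro set_eqI iffI)
    fix b assume "b \<in> {b \<in> diagram lam. content b = 0}"
    hence "(fst b, snd b) \<in> diagram lam" "content b = 0" by simp_all
    hence "fst b < length lam" "snd b = fst b" using diagram_iff[of "fst b" "snd b" lam] by (simp_all add: content_def)
    thus "b \<in> (\<lambda>r. (r, r)) ` {..<length lam}" by (cases b) auto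
  next
    fix b assume "b \<in> (\<lambda>r. (r, r)) ` {..<length lam}"
    then obtain r where r: "b = (r, r)" "r < length lam" by blast
    have "lam ! r \<noteq> 0" using nth_mem[OF r(2)] assms(3) by metis
    thus "b \<in> {b \<in> diagram lam. content b = 0}" using r by (simp add: diagram_iff content_def)
  qed
  also have "card \<dots> = length lam" by (subst card_image) (auto simp: inj_on_def)
  finally show ?thesis .
qed

lemma diagonals_vlist:
  assumes "chain M ys" "vlist ys"
  shows "diagonals ys \<le> 1"
proof -
  have "diagonals ys = card {b \<in> set ys. content b = 0}"
    unfolding diagonals_def using distinct_card[OF distinct_filter, of ys "\<lambda>b. content b = 0"] chain_distinct[OF assms(1)] by simp
  also have "\<dots> \<le> 1"
    using vlist_content_inj[OF assms] by (simp add: card_le_Suc0_iff_eq inj_on_def)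
  finally show ?thesis .
qed

text \<open>The induction starts with the smallest part of \<open>lam\<close>, whose block comes
  first in the list. Of the \<open>length lam\<close> diagonal boxes, the blocks before block
  \<open>i\<close> contain exactly one for each part after \<open>i\<close>, and the blocks behind
  it contain at most \<open>i\<close> in all; so block \<open>i\<close> contains one, and
  \<open>connected_contents\<close> applies.\<close>

lemma is_special_special_list:
  assumes sp: "is_special Q lam"
  obtains zs where "special_list lam zs" "rep Q (timed zs)"
proof -
  have st: "standard_shifted Q" and sh: "shape Q = lam"
    and vee: "\<And>i. i < length lam \<Longrightarrow> is_connected_vee Q (sum_list (drop (Suc i) lam) + 1) (sum_list (drop i lam))"
    using sp by (simp_all add: is_special_def)
  obtain zs where ch: "chain {} zs" and R: "rep Q (timed zs)" by (rule standard_shifted_list[OF st])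
  have str: "strict_partition lam" using st sh by (simp add: standard_shifted_def)
  hence z: "0 \<notin> set lam" by (simp add: strict_partition_def)
  have szs: "set zs = diagram lam" using timed_cells[OF R] cells_diagram[of Q] sh by simp
  have d: "distinct zs" using chain_distinct[OF ch] by simp
  define s where "s i = sum_list (drop i lam)" for i
  have lz: "length zs = s 0"
    using card_cells[of Q] timed_cells[OF R] d sh by (simp add: distinct_card s_def length_concat shape_def)
  have sS: "s i = s (Suc i) + lam ! i" if "i < length lam" for i using sum_list_drop[OF that] by (simp add: s_def)
  have s0: "s i \<le> s 0" for i
  proof (induction i)
    case (Suc i)
    show ?case
    proof (cases "i < length lam")
      case True
      thus ?thesis using sS[OF True] Suc by simp
    qed (simp add: s_def)
  qed simp
  \<comment> \<open>\<open>s i\<close> is the total size of the parts from index \<open>i\<close>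
    on, so block \<open>i\<close> occupies the list positions from \<open>s (Suc i)\<close> up to,
    but excluding, \<open>s i\<close>.\<close>
  define Y where "Y i = take (lam ! i) (drop (s (Suc i)) zs)" for i
  have spl: "zs = take (s (Suc i)) zs @ Y i @ drop (s i) zs" and tk: "take (s i) zs = take (s (Suc i)) zs @ Y i"
    and lY: "length (Y i) = lam ! i" and lt: "length (take (s (Suc i)) zs) = s (Suc i)" if i: "i < length lam" for i
  proof -
    show tk: "take (s i) zs = take (s (Suc i)) zs @ Y i" by (simp add: sS[OF i] take_add Y_def)
    show "zs = take (s (Suc i)) zs @ Y i @ drop (s i) zs" using append_take_drop_id[of "s i" zs] tk by simp
    show "length (Y i) = lam ! i" "length (take (s (Suc i)) zs) = s (Suc i)"
      using s0[of i] s0[of "Suc i"] sS[OF i] lz by (simp_all add: Y_def)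
  qed
  have chY: "chain (set (take (s (Suc i)) zs)) (Y i)" if i: "i < length lam" for i
  proof -
    have "chain {} (take (s (Suc i)) zs @ Y i @ drop (s i) zs)" using ch spl[OF i] by simp
    thus ?thesis by (simp add: chain_append)
  qed
  have vY: "vlist (Y i) \<and> connected_cells (set (Y i))" if i: "i < length lam" for i
  proof -
    have "lam ! i \<noteq> 0" using nth_mem[OF i] z by metis
    hence ne: "Y i \<noteq> []" using lY[OF i] by auto
    have "is_connected_vee Q (s (Suc i) + 1) (s (Suc i) + lam ! i)" using vee[OF i] sS[OF i] by (simp add: s_def)
    hence "is_connected_vee Q (length (take (s (Suc i)) zs) + 1) (length (take (s (Suc i)) zs) + length (Y i))"
      unfolding lt[OF i] lY[OF i] .
    thus ?thesis
      unfolding is_connected_vee_def is_vee_iff_vlist[OF R ch spl[OF i] ne] block_cells(1)[OF R spl[OF i]] .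
  qed
  \<comment> \<open>What is left after \<open>s j\<close> boxes are the blocks of the parts with
    index below \<open>j\<close>.\<close>
  have dj: "diagonals (drop (s j) zs) \<le> j" if "j \<le> length lam" for j
    using that
  proof (induction j)
    case (Suc j)
    hence j: "j < length lam" by simp
    have "drop (s (Suc j)) zs = drop (length (take (s (Suc j)) zs)) (take (s (Suc j)) zs @ Y j @ drop (s j) zs)"
      using spl[OF j] lt[OF j] by metis
    hence "drop (s (Suc j)) zs = Y j @ drop (s j) zs" by simp
    moreover have "diagonals (Y j) \<le> 1" using diagonals_vlist[OF chY[OF j]] vY[OF j] by blast
    ultimately show ?case using Suc j by simp
  qed (simp add: lz diagonals_def)
  have "special_list (drop j lam) (take (s j) zs)" if "j \<le> length lam" for j
    using that
  proof (induction rule: inc_induct)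
    case base
    show ?case by (simp add: s_def)
  next
    case (step i)
    have i: "i < length lam" using step.hyps by simp
    define xs where "xs = take (s (Suc i)) zs"
    have xs: "special_list (drop (Suc i) lam) xs" using step.IH by (simp add: xs_def)
    have v: "vlist (Y i)" and con: "connected_cells (set (Y i))" using vY[OF i] by simp_all
    have cy: "chain (set xs) (Y i)" using chY[OF i] by (simp add: xs_def)
    have "diagonals xs = length (drop (Suc i) lam)"
    proof (rule diagonals_diagram)
      show "distinct xs" using d by (simp add: xs_def)
      show "set xs = diagram (drop (Suc i) lam)" using special_list_chain[OF xs] by simp
      show "0 \<notin> set (drop (Suc i) lam)" using z set_drop_subset by fastforce
    qed
    moreover have "diagonals zs = length lam" by (rule diagonals_diagram[OF d szs z])
    moreover have "diagonals zs = diagonals xs + (diagonals (Y i) + diagonals (drop (s i) zs))"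
      using arg_cong[OF spl[OF i], of diagonals] by (simp add: xs_def)
    moreover have "diagonals (drop (s i) zs) \<le> i" using dj i by simp
    ultimately have "diagonals (Y i) \<noteq> 0" using i by simp
    then obtain b0 where b0: "b0 \<in> set (Y i)" "content b0 = 0"
      unfolding diagonals_def length_0_conv filter_empty_conv by blast
    have im: "content ` set (Y i) = {0..<length (Y i)}" by (rule connected_contents[OF cy v con b0])
    have "c < length (Y i)" if c: "(0, c) \<in> diagram (drop (Suc i) lam)" for c
    proof -
      have l: "Suc i < length lam" "c < lam ! Suc i" using c by (auto simp: diagram_iff)
      have "lam ! Suc i < lam ! i" using str l(1) by (simp add: strict_partition_def sorted_wrt_iff_nth_less)
      thus ?thesis using l(2) lY[OF i] by simp
    qed
    from special_list_snoc[OF xs cy v im this]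
    have "special_list (lam ! i # drop (Suc i) lam) (take (s i) zs)" unfolding tk[OF i] xs_def lY[OF i] .
    thus ?case using Cons_nth_drop_Suc[OF i] by simp
  qed
  from this[of 0] have "special_list lam zs" using lz by simp
  thus ?thesis using R that by blast
qed

lemma special_recording_eq:
  assumes sp: "strict_partition lam" and zs: "special_list lam zs" and R: "rep Q (timed zs)"
  shows "special_recording lam = Q"
  unfolding special_recording_def is_special_def[symmetric]
proof (rule the_equality)
  show "is_special Q lam" by (rule special_list_is_special[OF assms])
  fix Q' assume "is_special Q' lam"
  then obtain zs' where z': "special_list lam zs'" "rep Q' (timed zs')" by (rule is_special_special_list)
  have "zs' = zs" by (rule special_list_unique[OF z'(1) zs])
  thus "Q' = Q" using rep_unique z'(2) R by blast
qed

section \<open>Hook factorizations\<close>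

text \<open>The list starts with the rightmost factor, so index \<open>i\<close> stands for the
  factor numbered \<open>i + 1\<close>. The last list element is the leftmost factor; its maximality
  within itself is automatic and is recovered in
  \<open>special_list_of_factorization\<close>.\<close>

definition hook_factorization :: "nat list list \<Rightarrow> bool" where
  "hook_factorization us \<longleftrightarrow> (\<forall>u \<in> set us. hook_word u) \<and>
     (\<forall>i. i + 1 < length us \<longrightarrow> max_hook_subword (us ! i) (concat (rev (drop i us))))"

lemma hook_factorization_Nil: "hook_factorization []"
  by (simp add: hook_factorization_def)

lemma hook_factorization_Cons:
  "hook_factorization (u # us) \<longleftrightarrow> hook_word u \<and>
     (us \<noteq> [] \<longrightarrow> max_hook_subword u (concat (rev us) @ u)) \<and> hook_factorization us"
proof -
  have "(\<forall>i. i + 1 < length (u # us) \<longrightarrow> max_hook_subword ((u # us) ! i) (concat (rev (drop i (u # us))))) \<longleftrightarrow>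
    (us \<noteq> [] \<longrightarrow> max_hook_subword u (concat (rev us) @ u)) \<and>
    (\<forall>i. i + 1 < length us \<longrightarrow> max_hook_subword (us ! i) (concat (rev (drop i us))))"
  proof -
    have "(\<forall>i. P i) \<longleftrightarrow> P 0 \<and> (\<forall>i. P (Suc i))" for P :: "nat \<Rightarrow> bool" by (metis not0_implies_Suc)
    from this[of "\<lambda>i. i + 1 < length (u # us) \<longrightarrow> max_hook_subword ((u # us) ! i) (concat (rev (drop i (u # us))))"]
    show ?thesis by simp
  qed
  thus ?thesis by (auto simp: hook_factorization_def)
qed

lemma hook_factorization_drop: "hook_factorization us \<Longrightarrow> hook_factorization (drop i us)"
proof (induction i arbitrary: us)
  case (Suc i)
  thus ?case by (cases us) (auto simp: hook_factorization_Cons)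
qed simp

lemma boxes_Nil_chain: "chain {} (boxes [] w)" "set (map fst (foldl ins [] w)) = set (boxes [] w)"
  using chain_boxes[OF state_ok_Nil, of w] by simp_all

lemma row0_iff: "(0, c) \<in> set (boxes [] w) \<longleftrightarrow> c < row0 w"
proof -
  define N where "N = set (boxes [] w)"
  have i: "ideal N" using chain_ideal'[OF boxes_Nil_chain(1), of w] by (simp add: N_def)
  define A where "A = {c. (0, c) \<in> N}"
  have f: "finite A"
    unfolding A_def by (rule finite_subset[of _ "snd ` N"]) (force simp: N_def)+
  have "{b \<in> N. fst b = 0} = Pair 0 ` A" by (auto simp: A_def)
  hence cA: "row0 w = card A" by (simp add: row0_def N_def card_image inj_on_def)
  have down: "k \<in> A" if "c \<in> A" "k \<le> c" for c k
    using ideal_down[OF i, of 0 c 0 k] that by (simp add: A_def)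
  have "A = {..<card A}"
  proof -
    have "A \<subseteq> {..<card A}"
    proof
      fix c assume c: "c \<in> A"
      have "{..c} \<subseteq> A" using down[OF c] by auto
      hence "card {..c} \<le> card A" by (rule card_mono[OF f])
      thus "c \<in> {..<card A}" by simp
    qed
    thus ?thesis by (intro card_subset_eq) auto
  qed
  thus ?thesis using cA by (auto simp: A_def N_def)
qed

lemma max_hook_subword_iff:
  "w \<noteq> [] \<Longrightarrow> max_hook_subword u w \<longleftrightarrow> hook_subword u w \<and> length u = row0 w"
  unfolding max_hook_subword_def using hook_subword_row0 by (metis le_antisym)

lemma hook_word_ne: "hook_word u \<Longrightarrow> u \<noteq> []"
  by (auto simp: hook_word_def)

lemma special_list_boxes_snoc:
  assumes sp: "special_list lam (boxes [] w)" and h: "hook_word u" and r0: "row0 (w @ u) = length u"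
  shows "special_list (length u # lam) (boxes [] (w @ u))"
proof -
  define ys where "ys = boxes (foldl ins [] w) u"
  have b: "boxes [] (w @ u) = boxes [] w @ ys" by (simp add: boxes_append ys_def)
  have v: "vlist ys" unfolding ys_def
    using h hook_word_iff_vlist[OF state_ok_foldl[OF state_ok_Nil]] by blast
  have ch0: "chain {} (boxes [] w @ ys)" using boxes_Nil_chain(1)[of "w @ u"] b by simp
  hence ch: "chain (set (boxes [] w)) ys" by (simp add: chain_append)
  have i: "ideal (set (boxes [] w @ ys))" using chain_ideal'[OF ch0] by simp
  have row: "(0, c) \<in> set (boxes [] w @ ys) \<longleftrightarrow> c < length u" for c using row0_iff[of c "w @ u"] b r0 by simp
  have "content ` set ys \<subseteq> {0..<length ys}"
  proof
    fix x assume "x \<in> content ` set ys"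
    then obtain y where y: "y \<in> set ys" "x = content y" by blast
    have "(0, content y) \<in> set (boxes [] w @ ys)" by (rule content_ideal[OF i]) (simp add: y(1))
    thus "x \<in> {0..<length ys}" unfolding row y(2) by (simp add: ys_def)
  qed
  moreover have "card (content ` set ys) = length ys"
    using card_image[OF vlist_content_inj[OF ch v]] chain_distinct[OF ch] by (simp add: distinct_card)
  ultimately have im: "content ` set ys = {0..<length ys}" by (intro card_subset_eq) auto
  have M: "c < length ys" if "(0, c) \<in> diagram lam" for c
  proof -
    have "(0, c) \<in> set (boxes [] w @ ys)" using that special_list_chain[OF sp] by simp
    thus ?thesis unfolding row by (simp add: ys_def)
  qed
  show ?thesis using special_list_snoc[OF sp ch v im M] b by (simp add: ys_def)
qed

lemma special_list_of_factorization:
  "hook_factorization us \<Longrightarrow> special_list (map length us) (boxes [] (concat (rev us)))"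
proof (induction us)
  case (Cons u us)
  have h: "hook_word u" and m: "us \<noteq> [] \<longrightarrow> max_hook_subword u (concat (rev us) @ u)" and hf: "hook_factorization us"
    using Cons.prems by (simp_all add: hook_factorization_Cons)
  define w where "w = concat (rev us)"
  have ne: "w @ u \<noteq> []" using hook_word_ne[OF h] by simp
  have "max_hook_subword u (w @ u)"
  proof (cases "us = []")
    \<comment> \<open>The leftmost factor is compared with its own subwords only, which are not
      longer.\<close>
    case True
    thus ?thesis using h list_emb_length
      by (auto simp: w_def max_hook_subword_def hook_subword_def)
  qed (use m in \<open>simp add: w_def\<close>)
  hence "row0 (w @ u) = length u" using max_hook_subword_iff[OF ne] by simp
  from special_list_boxes_snoc[OF _ h this] show ?case using Cons.IH[OF hf] by (simp add: w_def)
qed simp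

text \<open>The word is cut where the list of its boxes is cut. The completed diagram has a first
  row of length \<open>n\<close>, which is the length of the last factor, so this factor attains the
  maximum given by \<open>hook_subword_row0\<close>.\<close>

lemma factorization_of_special_list:
  "special_list lam (boxes [] w) \<Longrightarrow> 0 \<notin> set lam \<Longrightarrow>
     \<exists>us. w = concat (rev us) \<and> map length us = lam \<and> hook_factorization us"
proof (induction lam arbitrary: w)
  case Nil
  hence "w = []" by (metis length_0_conv length_boxes special_list.simps(1))
  thus ?case using hook_factorization_Nil by auto
next
  case (Cons n lam)
  obtain xs ys where 1: "boxes [] w = xs @ ys" "special_list lam xs" "length ys = n" "vlist ys"
    "diagram lam \<union> set ys = push n (diagram lam)" using Cons.prems(1) by auto
  define k where "k = length xs"
  define v where "v = take k w"
  define u where "u = drop k w"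
  have w: "w = v @ u" by (simp add: u_def v_def)
  have lw: "length w = k + n" using length_boxes[of "[]" w] unfolding 1(1) by (simp add: k_def 1(3))
  have lv: "length v = k" and lu: "length u = n" using lw by (simp_all add: v_def u_def)
  have "boxes [] v @ boxes (foldl ins [] v) u = xs @ ys" using 1(1) w by (simp add: boxes_append)
  hence bx: "boxes [] v = xs" and bu: "boxes (foldl ins [] v) u = ys" using lv by (simp_all add: k_def append_eq_append_conv)
  have h: "hook_word u"
    using hook_word_iff_vlist[OF state_ok_foldl[OF state_ok_Nil], of u v] bu 1(4) by simp
  have "set (boxes [] w) = push n (diagram lam)" using 1(1,5) special_list_chain[OF 1(2)] by simp
  hence "c < n \<longleftrightarrow> c < row0 w" for c using row0_iff[of c w] push_0 by simp
  hence r0: "row0 w = n" by (meson linorder_neqE_nat nat_neq_iff)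
  obtain us where us: "v = concat (rev us)" "map length us = lam" "hook_factorization us"
    using Cons.IH[of v] 1(2) bx Cons.prems(2) by auto
  have "w \<noteq> []" using w hook_word_ne[OF h] by simp
  moreover have "hook_subword u w" using h w list_emb_append2[of "(=)" u u v] by (simp add: hook_subword_def)
  ultimately have "max_hook_subword u w" using max_hook_subword_iff r0 lu by simp
  hence hf: "hook_factorization (u # us)" using us h w by (simp add: hook_factorization_Cons)
  have cw: "w = concat (rev (u # us))" using w us(1) by simp
  have ml: "map length (u # us) = n # lam" using us(2) lu by simp
  show ?case by (intro exI[of _ "u # us"] conjI cw ml hf)
qed

lemma length_factorization: "hook_factorization us \<Longrightarrow> 0 \<notin> set (map length us)"
  using hook_word_ne by (auto simp: hook_factorization_def)

lemma shape_factorization: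
  assumes "hook_factorization us"
  shows "shape (P_mix (concat (rev us))) = map length us"
proof (rule rep_shape)
  define w where "w = concat (rev us)"
  show "rep (P_mix w) (set (foldl ins [] w))" using mix_rep by blast
  have "fst ` set (foldl ins [] w) = set (boxes [] w)" using boxes_Nil_chain(2)[of w] by simp
  thus "fst ` set (foldl ins [] w) = diagram (map length us)"
    using special_list_chain[OF special_list_of_factorization[OF assms]] by (simp add: w_def)
  show "0 \<notin> set (map length us)" by (rule length_factorization[OF assms])
qed

lemma timed_inj:
  assumes "timed xs = timed ys" shows "xs = ys"
proof -
  have "Suc i \<in> snd ` timed zs \<longleftrightarrow> i < length zs" for i and zs :: "'a list"
  proof
    assume "Suc i \<in> snd ` timed zs"
    then obtain x where "(x, Suc i) \<in> timed zs" by auto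
    thus "i < length zs" by (simp add: timed_iff)
  next
    assume "i < length zs"
    hence "(zs ! i, Suc i) \<in> timed zs" unfolding timed_iff by blast
    thus "Suc i \<in> snd ` timed zs" by force
  qed
  from this[of _ xs] this[of _ ys] have "i < length xs \<longleftrightarrow> i < length ys" for i using assms by simp
  hence l: "length xs = length ys" by (meson linorder_neqE_nat nat_neq_iff)
  show ?thesis
  proof (rule nth_equalityI[OF l])
    fix i assume i: "i < length xs"
    hence "(xs ! i, Suc i) \<in> timed ys" unfolding assms[symmetric] timed_iff by blast
    thus "xs ! i = ys ! i" unfolding timed_iff by auto
  qed
qed

lemma rep_timed_unique:
  assumes "rep Q (timed xs)" "rep Q (timed ys)"
  shows "xs = ys"
proof (rule timed_inj)
  have "e \<in> timed zs \<longleftrightarrow> fst e \<in> cells Q \<and> ent Q (fst e) = snd e" if R: "rep Q (timed zs)" for e and zs :: "(nat \<times> nat) list"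
  proof
    assume "e \<in> timed zs"
    thus "fst e \<in> cells Q \<and> ent Q (fst e) = snd e" using R by (auto simp: rep_def)
  next
    assume a: "fst e \<in> cells Q \<and> ent Q (fst e) = snd e"
    hence "fst e \<in> fst ` timed zs" using R by (simp add: rep_def)
    then obtain e' where e': "e' \<in> timed zs" "fst e = fst e'" by blast
    hence "snd e' = snd e" using R a by (simp add: rep_def)
    hence "e' = e" using e'(2) by (simp add: prod_eq_iff)
    thus "e \<in> timed zs" using e'(1) by simp
  qed
  thus "timed xs = timed ys" using assms(1,2) by blast
qed

text \<open>A recording tableau and its list of boxes determine each other, so equality with the
  special recording tableau becomes equality of lists. The converse direction also needs
  \<open>P_mix w\<close> to be a shifted Young tableau, which is where positivity of the letters
  enters.\<close>

lemma word_iff_special_list: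
  assumes pos: "\<forall>a \<in> set w. 1 \<le> a"
  shows "shifted_tableau_word w \<longleftrightarrow> (\<exists>lam. strict_partition lam \<and> special_list lam (boxes [] w))"
proof
  assume "shifted_tableau_word w"
  then obtain T where T: "shifted_young_tableau T" "P_mix w = T" "Q_mix w = special_recording (shape T)"
    by (auto simp: shifted_tableau_word_def)
  have sp: "strict_partition (shape T)" using T(1) by (simp add: shifted_young_tableau_def)
  then obtain zs where zs: "special_list (shape T) zs" using special_list_exists by blast
  have ch: "chain {} zs" using special_list_chain[OF zs] by simp
  obtain Q :: "nat list list" where Q: "rep Q (timed zs)" using rep_exists[OF ch] by blast
  have "Q_mix w = Q" using special_recording_eq[OF sp zs Q] T(3) by simp
  hence "rep Q (timed (boxes [] w))" using mix_rep[of w] by simp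
  hence "boxes [] w = zs" using rep_timed_unique[OF _ Q] by blast
  thus "\<exists>lam. strict_partition lam \<and> special_list lam (boxes [] w)" using sp zs by auto
next
  assume "\<exists>lam. strict_partition lam \<and> special_list lam (boxes [] w)"
  then obtain lam where sp: "strict_partition lam" and sl: "special_list lam (boxes [] w)" by blast
  have "fst ` set (foldl ins [] w) = diagram lam"
    using boxes_Nil_chain(2)[of w] special_list_chain[OF sl] by simp
  hence sh: "shape (P_mix w) = lam"
    using rep_shape[of "P_mix w" "set (foldl ins [] w)" lam] mix_rep[of w] sp by (simp add: strict_partition_def)
  have "special_recording lam = Q_mix w" using special_recording_eq[OF sp sl] mix_rep[of w] by blast
  thus "shifted_tableau_word w" using syt_P_mix[OF pos] sh by (simp add: shifted_tableau_word_def)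
qed

theorem mainTheorem14:
  fixes w :: "nat list"
  assumes "\<forall>a \<in> set w. 1 \<le> a"
  shows "(shifted_tableau_word w \<longleftrightarrow>
           (\<exists>us :: nat list list. w = concat (rev us) \<and>
              (\<forall>u \<in> set us. hook_word u) \<and>
              (\<forall>i. i + 1 < length us \<longrightarrow> max_hook_subword (us ! i) (concat (rev (drop i us))))))
       \<and> (\<forall>us :: nat list list. w = concat (rev us) \<and>
              (\<forall>u \<in> set us. hook_word u) \<and>
              (\<forall>i. i + 1 < length us \<longrightarrow> max_hook_subword (us ! i) (concat (rev (drop i us))))
            \<longrightarrow> (\<forall>i < length us. shape (P_mix (concat (rev (drop i us)))) = map length (drop i us))
                \<and> shape (P_mix w) = map length us)"
  unfolding hook_factorization_def[symmetric]
proof (intro conjI allI impI)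
  show "shifted_tableau_word w \<longleftrightarrow> (\<exists>us. w = concat (rev us) \<and> hook_factorization us)"
    unfolding word_iff_special_list[OF assms]
  proof
    assume "\<exists>lam. strict_partition lam \<and> special_list lam (boxes [] w)"
    then obtain lam where sp: "strict_partition lam" and sl: "special_list lam (boxes [] w)" by blast
    have "0 \<notin> set lam" using sp by (simp add: strict_partition_def)
    thus "\<exists>us. w = concat (rev us) \<and> hook_factorization us" using factorization_of_special_list[OF sl] by blast
  next
    assume "\<exists>us. w = concat (rev us) \<and> hook_factorization us"
    then obtain us where us: "w = concat (rev us)" "hook_factorization us" by blast
    \<comment> \<open>That the lengths of the factors decrease strictly is read off from the shape
      of the insertion tableau.\<close>
    have "strict_partition (shape (P_mix w))" using syt_P_mix[OF assms] by (simp add: shifted_young_tableau_def)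
    hence "strict_partition (map length us)" using shape_factorization[OF us(2)] us(1) by simp
    thus "\<exists>lam. strict_partition lam \<and> special_list lam (boxes [] w)"
      using special_list_of_factorization[OF us(2)] us(1) by blast
  qed
next
  fix us i
  assume us: "w = concat (rev us) \<and> hook_factorization us"
  show "shape (P_mix (concat (rev (drop i us)))) = map length (drop i us)"
    using shape_factorization[OF hook_factorization_drop] us by blast
next
  fix us assume "w = concat (rev us) \<and> hook_factorization us"
  thus "shape (P_mix w) = map length us" using shape_factorization by simp
qed

end
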